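(* Let $X$ be a simplicial list. Then $X$ is isomorphic (in $\mathsf{sList}$) to the list nerve $N^l(\mathcal{P})$ of some operad $\mathcal{P}$ if and only if $X$ is operadic and the simplicial set $\mathcal{L}X$ is isomorphic to the nerve of a category.
   Context: **Lists.** For a set $X$, $\mathcal{L}X=\coprod_{n\ge 0}X^n$ is the set of finite sequences in $X$. A listing $u$ from $A$ to $X$ is a function $u:A\to\mathcal{L}X$. Listings compose by concatenation: if $u(a)=(x_1,\dots,x_k)$ then $(vu)(a)=v(x_1)*\dots*v(x_k)$. $\mathsf{List}$ is the category of sets and listings; a function is viewed as a listing all of whose values have length $1$. The functor $\mathcal{L}:\mathsf{List}\to\mathsf{Set}$ sends $A$ to $\mathcal{L}A$ and extends listings by concatenation. A simplicial list is a functor $X:\Delta^{op}\to\mathsf{List}$; $\mathsf{sList}$ is the category of simplicial lists with morphisms the natural transformations all of whose components are functions. $\mathcal{L}X$ is the simplicial set $\mathcal{L}\circ X$. $X$ is operadic if for every $\theta:[k]\to[n]$ in $\Delta$ with $\theta(k)=n$, the structure map $\theta^*:X_n\to X_k$ is a function. **Operads.** "Operad" means coloured non-symmetric operad in sets (nullary operations allowed); $\mathsf{Op}$ is the category of operads and structure-preserving maps. **Leveled trees.** $\Delta_+$ is the category of finite (possibly empty) totally ordered sets and order-preserving maps, objects being considered up to their unique isomorphism. An $n$-simplex $\alpha$ of its nerve $N(\Delta_+)$ is a chain $A_0\xrightarrow{\alpha_1}A_1\to\dots\xrightarrow{\alpha_n}A_n$, with composites $\alpha_{i,j}:A_i\to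 A_j$. It is rooted if $A_n$ has exactly one element. For $a\in A_n$, $\alpha_a$ is the rooted simplex obtained by restricting the chain to the preimages of $\{a\}$. $T_\alpha$ is the free operad with colours $\coprod_{i=0}^nA_i$ and generating operations $p_i^{(a)}:\alpha_i^{-1}(a)\to a$ for $1\le i\le n$, $a\in A_i$ (the domain is the ordered set $\alpha_i^{-1}(a)$ regarded as a sequence). For $i\le j$ and $a\in A_j$, $p_{i,j}^{(a)}:\alpha_{i,j}^{-1}(a)\to a$ is the evident composite of generators ($p_{i,i}^{(a)}=1_a$). For $\theta:[k]\to[n]$, the morphism $\lambda_\theta:T_{\theta^*\alpha}\to T_\alpha$ sends a colour $b$ in level $i$ of $\theta^*\alpha$ to $b\in A_{\theta(i)}$ and $p_i^{(b)}$ to $p_{\theta(i-1),\theta(i)}^{(b)}$. **List nerve.** $N^l(\mathcal{P})_n=\coprod_{\alpha\in N(\Delta_+)_n\text{ rooted}}\mathsf{Op}(T_\alpha,\mathcal{P})$. For $\theta:[k]\to[n]$ and $x:T_\alpha\to\mathcal{P}$, $\theta^*x$ is the list $((\theta,a)^*x)_{a\in A_{\theta(k)}}$, where $(\theta,a)^*x$ is the composite $T_{(\theta^*\alpha)_a}\subseteq T_{\theta^*\alpha}\xrightarrow{\lambda_\theta}T_\alpha\xrightarrow{x}\mathcal{P}$. *)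

theory Defs
  imports "HOL-Library.FuncSet"
begin

section \<open>Small categories and the simplex category\<close>

record ('c, 'd) category =
  Obj :: "'c set"
  Arr :: "'d set"
  cdom :: "'d \<Rightarrow> 'c"
  ccod :: "'d \<Rightarrow> 'c"
  cid :: "'c \<Rightarrow> 'd"
  ccomp :: "'d \<Rightarrow> 'd \<Rightarrow> 'd"

text \<open>\<open>ccomp C g f\<close> is ``\<open>f\<close> first, then \<open>g\<close>''; it is only meaningful if
  \<open>cdom C g = ccod C f\<close>.\<close>

locale category =
  fixes C :: "('c, 'd) category"
  assumes dom_in: "f \<in> Arr C \<Longrightarrow> cdom C f \<in> Obj C"
    and cod_in: "f \<in> Arr C \<Longrightarrow> ccod C f \<in> Obj C"
    and id_in: "a \<in> Obj C \<Longrightarrow> cid C a \<in> Arr C"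
    and dom_id: "a \<in> Obj C \<Longrightarrow> cdom C (cid C a) = a"
    and cod_id: "a \<in> Obj C \<Longrightarrow> ccod C (cid C a) = a"
    and comp_in: "\<lbrakk>f \<in> Arr C; g \<in> Arr C; cdom C g = ccod C f\<rbrakk> \<Longrightarrow> ccomp C g f \<in> Arr C"
    and dom_comp: "\<lbrakk>f \<in> Arr C; g \<in> Arr C; cdom C g = ccod C f\<rbrakk> \<Longrightarrow> cdom C (ccomp C g f) = cdom C f"
    and cod_comp: "\<lbrakk>f \<in> Arr C; g \<in> Arr C; cdom C g = ccod C f\<rbrakk> \<Longrightarrow> ccod C (ccomp C g f) = ccod C g"
    and comp_id_right: "f \<in> Arr C \<Longrightarrow> ccomp C f (cid C (cdom C f)) = f"
    and comp_id_left: "f \<in> Arr C \<Longrightarrow> ccomp C (cid C (ccod C f)) f = f"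
    and comp_assoc: "\<lbrakk>f \<in> Arr C; g \<in> Arr C; h \<in> Arr C; cdom C g = ccod C f; cdom C h = ccod C g\<rbrakk>
      \<Longrightarrow> ccomp C h (ccomp C g f) = ccomp C (ccomp C h g) f"

text \<open>The maps \<open>[k] \<rightarrow> [n]\<close> of \<open>\<Delta>\<close>, where \<open>[n]\<close> is \<open>{..n}\<close>. They are extensional functions,
  so that equality and \<^const>\<open>compose\<close> are those of \<open>\<Delta>\<close>.\<close>

definition simplex_maps :: "nat \<Rightarrow> nat \<Rightarrow> (nat \<Rightarrow> nat) set" where
  "simplex_maps k n = {\<theta> \<in> {..k} \<rightarrow>\<^sub>E {..n}. mono_on {..k} \<theta>}"


section \<open>Simplicial sets and simplicial lists\<close>

text \<open>\<open>act X k n \<theta>\<close> is the structure map \<open>\<theta>\<^sup>*\<close> on \<open>n\<close>-simplices for \<open>\<theta> : [k] \<rightarrow> [n]\<close>;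
  its values outside \<open>simps X n\<close> are irrelevant. For a simplicial set \<open>'b\<close> is \<open>'a\<close>; for a
  simplicial list \<open>'b\<close> is \<open>'a list\<close>, the structure maps being listings.\<close>

record ('a, 'b) simplicial =
  simps :: "nat \<Rightarrow> 'a set"
  act :: "nat \<Rightarrow> nat \<Rightarrow> (nat \<Rightarrow> nat) \<Rightarrow> 'a \<Rightarrow> 'b"

type_synonym 'a sset = "('a, 'a) simplicial"
type_synonym 'a slist = "('a, 'a list) simplicial"

definition sset_morphism :: "'a sset \<Rightarrow> 'b sset \<Rightarrow> (nat \<Rightarrow> 'a \<Rightarrow> 'b) \<Rightarrow> bool" where
  "sset_morphism X Y f \<longleftrightarrow>
     (\<forall>n. f n \<in> simps X n \<rightarrow> simps Y n) \<and>
     (\<forall>k n. \<forall>\<theta>\<in>simplex_maps k n. \<forall>x\<in>simps X n. act Y k n \<theta> (f n x) = f k (act X k n \<theta> x))"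

definition sset_iso :: "'a sset \<Rightarrow> 'b sset \<Rightarrow> bool" where
  "sset_iso X Y \<longleftrightarrow>
     (\<exists>f g. sset_morphism X Y f \<and> sset_morphism Y X g \<and>
        (\<forall>n. \<forall>x\<in>simps X n. g n (f n x) = x) \<and> (\<forall>n. \<forall>y\<in>simps Y n. f n (g n y) = y))"

text \<open>\<open>extend_listing u\<close> is \<open>\<L>u\<close>, so the composite of the listings \<open>v\<close> and \<open>u\<close> is
  \<open>\<lambda>a. extend_listing v (u a)\<close>.\<close>

definition extend_listing :: "('a \<Rightarrow> 'b list) \<Rightarrow> 'a list \<Rightarrow> 'b list" where
  "extend_listing u xs = concat (map u xs)"

locale simplicial_list =
  fixes X :: "'a slist"
  assumes act_in: "\<lbrakk>\<theta> \<in> simplex_maps k n; x \<in> simps X n\<rbrakk> \<Longrightarrow> act X k n \<theta> x \<in> lists (simps X k)"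
    and act_id: "x \<in> simps X n \<Longrightarrow> act X n n (\<lambda>i\<in>{..n}. i) x = [x]"
    and act_comp: "\<lbrakk>\<phi> \<in> simplex_maps j k; \<theta> \<in> simplex_maps k n; x \<in> simps X n\<rbrakk>
      \<Longrightarrow> act X j n (compose {..j} \<theta> \<phi>) x = extend_listing (act X j k \<phi>) (act X k n \<theta> x)"

text \<open>Morphisms of simplicial lists have functions as components, hence the \<open>map\<close>.\<close>

definition slist_morphism :: "'a slist \<Rightarrow> 'b slist \<Rightarrow> (nat \<Rightarrow> 'a \<Rightarrow> 'b) \<Rightarrow> bool" where
  "slist_morphism X Y f \<longleftrightarrow>
     (\<forall>n. f n \<in> simps X n \<rightarrow> simps Y n) \<and>
     (\<forall>k n. \<forall>\<theta>\<in>simplex_maps k n. \<forall>x\<in>simps X n. act Y k n \<theta> (f n x) = map (f k) (act X k n \<theta> x))"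

definition slist_iso :: "'a slist \<Rightarrow> 'b slist \<Rightarrow> bool" where
  "slist_iso X Y \<longleftrightarrow>
     (\<exists>f g. slist_morphism X Y f \<and> slist_morphism Y X g \<and>
        (\<forall>n. \<forall>x\<in>simps X n. g n (f n x) = x) \<and> (\<forall>n. \<forall>y\<in>simps Y n. f n (g n y) = y))"

definition lists_of :: "'a slist \<Rightarrow> 'a list sset" where
  "lists_of X = \<lparr>simps = (\<lambda>n. lists (simps X n)),
                 act = (\<lambda>k n \<theta>. extend_listing (act X k n \<theta>))\<rparr>"

definition operadic :: "'a slist \<Rightarrow> bool" where
  "operadic X \<longleftrightarrow>
     (\<forall>k n. \<forall>\<theta>\<in>simplex_maps k n. \<theta> k = n \<longrightarrow> (\<forall>x\<in>simps X n. length (act X k n \<theta> x) = 1))"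


section \<open>The nerve of a category\<close>

text \<open>An \<open>n\<close>-simplex is a functor \<open>(ob, ar)\<close> from the ordered set \<open>{..n}\<close> to \<open>C\<close>, that is,
  a chain of \<open>n\<close> composable arrows \<open>ar (i - 1, i)\<close> together with all its composites
  \<open>ar (i, j) : ob i \<rightarrow> ob j\<close>. Both components are extensional.\<close>

type_synonym ('c, 'd) chain = "(nat \<Rightarrow> 'c) \<times> (nat \<times> nat \<Rightarrow> 'd)"

definition intervals :: "nat \<Rightarrow> (nat \<times> nat) set" where
  "intervals n = {(i, j). i \<le> j \<and> j \<le> n}"

definition nerve :: "('c, 'd) category \<Rightarrow> ('c, 'd) chain sset" where
  "nerve C = \<lparr>
     simps = (\<lambda>n. {(ob, ar).
        ob \<in> {..n} \<rightarrow>\<^sub>E Obj C \<and> ar \<in> intervals n \<rightarrow>\<^sub>E Arr C \<and>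
        (\<forall>(i, j)\<in>intervals n. cdom C (ar (i, j)) = ob i \<and> ccod C (ar (i, j)) = ob j) \<and>
        (\<forall>i\<le>n. ar (i, i) = cid C (ob i)) \<and>
        (\<forall>i j l. i \<le> j \<and> j \<le> l \<and> l \<le> n \<longrightarrow> ar (i, l) = ccomp C (ar (j, l)) (ar (i, j)))}),
     act = (\<lambda>k n \<theta> (ob, ar).
        (\<lambda>i\<in>{..k}. ob (\<theta> i), \<lambda>(i, j)\<in>intervals k. ar (\<theta> i, \<theta> j)))\<rparr>"


section \<open>Operads\<close>

text \<open>Coloured non-symmetric operads. An operation \<open>p\<close> goes from the sequence \<open>src P p\<close> to
  \<open>tgt P p\<close>; \<open>ocomp P p qs\<close> is the simultaneous composite, only meaningful if
  \<open>map (tgt P) qs = src P p\<close>.\<close>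

record ('c, 'o) operad =
  colours :: "'c set"
  ops :: "'o set"
  src :: "'o \<Rightarrow> 'c list"
  tgt :: "'o \<Rightarrow> 'c"
  ounit :: "'c \<Rightarrow> 'o"
  ocomp :: "'o \<Rightarrow> 'o list \<Rightarrow> 'o"

locale operad =
  fixes P :: "('c, 'o) operad"
  assumes src_in: "p \<in> ops P \<Longrightarrow> src P p \<in> lists (colours P)"
    and tgt_in: "p \<in> ops P \<Longrightarrow> tgt P p \<in> colours P"
    and unit_in: "a \<in> colours P \<Longrightarrow> ounit P a \<in> ops P"
    and src_unit: "a \<in> colours P \<Longrightarrow> src P (ounit P a) = [a]"
    and tgt_unit: "a \<in> colours P \<Longrightarrow> tgt P (ounit P a) = a"
    and comp_in: "\<lbrakk>p \<in> ops P; qs \<in> lists (ops P); map (tgt P) qs = src P p\<rbrakk>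
      \<Longrightarrow> ocomp P p qs \<in> ops P"
    and src_comp: "\<lbrakk>p \<in> ops P; qs \<in> lists (ops P); map (tgt P) qs = src P p\<rbrakk>
      \<Longrightarrow> src P (ocomp P p qs) = concat (map (src P) qs)"
    and tgt_comp: "\<lbrakk>p \<in> ops P; qs \<in> lists (ops P); map (tgt P) qs = src P p\<rbrakk>
      \<Longrightarrow> tgt P (ocomp P p qs) = tgt P p"
    and comp_unit_right: "p \<in> ops P \<Longrightarrow> ocomp P p (map (ounit P) (src P p)) = p"
    and comp_unit_left: "p \<in> ops P \<Longrightarrow> ocomp P (ounit P (tgt P p)) [p] = p"
    and comp_assoc: "\<lbrakk>p \<in> ops P; qs \<in> lists (ops P); map (tgt P) qs = src P p;
        rss \<in> lists (lists (ops P)); map (map (tgt P)) rss = map (src P) qs\<rbrakk>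
      \<Longrightarrow> ocomp P p (map2 (ocomp P) qs rss) = ocomp P (ocomp P p qs) (concat rss)"

text \<open>A morphism is a pair of functions, on colours and on operations, which are extensional so
  that equal morphisms are equal as terms.\<close>

definition operad_morphisms ::
    "('c, 'o) operad \<Rightarrow> ('d, 'q) operad \<Rightarrow> (('c \<Rightarrow> 'd) \<times> ('o \<Rightarrow> 'q)) set" where
  "operad_morphisms P Q = {(f, g).
     f \<in> colours P \<rightarrow>\<^sub>E colours Q \<and> g \<in> ops P \<rightarrow>\<^sub>E ops Q \<and>
     (\<forall>p\<in>ops P. src Q (g p) = map f (src P p) \<and> tgt Q (g p) = f (tgt P p)) \<and>
     (\<forall>a\<in>colours P. g (ounit P a) = ounit Q (f a)) \<and>
     (\<forall>p\<in>ops P. \<forall>qs\<in>lists (ops P). map (tgt P) qs = src P p \<longrightarrow>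
        g (ocomp P p qs) = ocomp Q (g p) (map g qs))}"

definition morphism_comp ::
    "('c, 'o) operad \<Rightarrow> (('d \<Rightarrow> 'e) \<times> ('q \<Rightarrow> 'r)) \<Rightarrow> (('c \<Rightarrow> 'd) \<times> ('o \<Rightarrow> 'q)) \<Rightarrow>
      (('c \<Rightarrow> 'e) \<times> ('o \<Rightarrow> 'r))" where
  "morphism_comp P v u = (compose (colours P) (fst v) (fst u), compose (ops P) (snd v) (snd u))"


section \<open>Free operads\<close>

record ('c, 'g) collection =
  gcolours :: "'c set"
  gens :: "'g set"
  gsrc :: "'g \<Rightarrow> 'c list"
  gtgt :: "'g \<Rightarrow> 'c"

text \<open>The operations of the free operad on a collection are the well-formed planar trees with
  nodes labelled by generators; \<open>Leaf a\<close> is the unit at \<open>a\<close>, a node without subtrees is a nullary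
  generator, and composition grafts trees onto the leaves, taken from left to right.\<close>

datatype ('c, 'g) tree = Leaf 'c | Node 'g "('c, 'g) tree list"

fun root :: "('c, 'g) collection \<Rightarrow> ('c, 'g) tree \<Rightarrow> 'c" where
  "root S (Leaf c) = c"
| "root S (Node g ts) = gtgt S g"

fun leaves :: "('c, 'g) tree \<Rightarrow> 'c list" where
  "leaves (Leaf c) = [c]"
| "leaves (Node g ts) = concat (map leaves ts)"

inductive_set trees :: "('c, 'g) collection \<Rightarrow> ('c, 'g) tree set" for S where
  leaf: "c \<in> gcolours S \<Longrightarrow> Leaf c \<in> trees S"
| node: "\<lbrakk>g \<in> gens S; \<forall>t\<in>set ts. t \<in> trees S; map (root S) ts = gsrc S g\<rbrakk>
    \<Longrightarrow> Node g ts \<in> trees S"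

fun graft :: "('c, 'g) tree \<Rightarrow> ('c, 'g) tree list \<Rightarrow> ('c, 'g) tree"
  and graft_list :: "('c, 'g) tree list \<Rightarrow> ('c, 'g) tree list \<Rightarrow> ('c, 'g) tree list" where
  "graft (Leaf c) ss = hd ss"
| "graft (Node g ts) ss = Node g (graft_list ts ss)"
| "graft_list [] ss = []"
| "graft_list (t # ts) ss =
     graft t (take (length (leaves t)) ss) # graft_list ts (drop (length (leaves t)) ss)"

definition free_operad :: "('c, 'g) collection \<Rightarrow> ('c, ('c, 'g) tree) operad" where
  "free_operad S = \<lparr>colours = gcolours S, ops = trees S, src = leaves, tgt = root S,
                    ounit = Leaf, ocomp = graft\<rparr>"

text \<open>The morphism from the free operad on \<open>S\<close> to \<open>Q\<close> given by \<open>f\<close> on colours and by \<open>h\<close> on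
  generators.\<close>

fun free_eval :: "('d, 'q) operad \<Rightarrow> ('c \<Rightarrow> 'd) \<Rightarrow> ('g \<Rightarrow> 'q) \<Rightarrow> ('c, 'g) tree \<Rightarrow> 'q" where
  "free_eval Q f h (Leaf c) = ounit Q (f c)"
| "free_eval Q f h (Node g ts) = ocomp Q (h g) (map (free_eval Q f h) ts)"

definition free_morphism :: "('c, 'g) collection \<Rightarrow> ('d, 'q) operad \<Rightarrow> ('c \<Rightarrow> 'd) \<Rightarrow> ('g \<Rightarrow> 'q) \<Rightarrow>
    (('c \<Rightarrow> 'd) \<times> (('c, 'g) tree \<Rightarrow> 'q))" where
  "free_morphism S Q f h = (restrict f (gcolours S), restrict (free_eval Q f h) (trees S))"


section \<open>Leveled trees\<close>

text \<open>\<open>\<Delta>\<^sub>+\<close> is represented by its skeleton: the object \<open>m\<close> is the ordered set \<open>{..<m}\<close>, and an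
  arrow carries its domain and codomain.\<close>

type_synonym dplus_arrow = "nat \<times> nat \<times> (nat \<Rightarrow> nat)"

definition Delta_plus :: "(nat, dplus_arrow) category" where
  "Delta_plus = \<lparr>
     Obj = UNIV,
     Arr = {(m, n, f). f \<in> {..<m} \<rightarrow>\<^sub>E {..<n} \<and> mono_on {..<m} f},
     cdom = (\<lambda>(m, n, f). m),
     ccod = (\<lambda>(m, n, f). n),
     cid = (\<lambda>m. (m, m, \<lambda>b\<in>{..<m}. b)),
     ccomp = (\<lambda>(_, n, g) (m, _, f). (m, n, compose {..<m} g f))\<rparr>"

type_synonym leveled = "(nat, dplus_arrow) chain"

text \<open>\<open>level \<alpha> i\<close> is the number of elements of \<open>A\<^sub>i\<close>, and \<open>lmap \<alpha> i j\<close> is \<open>\<alpha>\<^sub>i\<^sub>,\<^sub>j : A\<^sub>i \<rightarrow> A\<^sub>j\<close>.\<close>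

definition level :: "leveled \<Rightarrow> nat \<Rightarrow> nat" where
  "level \<alpha> i = fst \<alpha> i"

definition lmap :: "leveled \<Rightarrow> nat \<Rightarrow> nat \<Rightarrow> nat \<Rightarrow> nat" where
  "lmap \<alpha> i j = snd (snd (snd \<alpha> (i, j)))"

definition rooted :: "nat \<Rightarrow> leveled \<Rightarrow> bool" where
  "rooted n \<alpha> \<longleftrightarrow> level \<alpha> n = 1"

definition fibre :: "leveled \<Rightarrow> nat \<Rightarrow> nat \<Rightarrow> nat \<Rightarrow> nat list" where
  "fibre \<alpha> i j a = filter (\<lambda>b. lmap \<alpha> i j b = a) [0..<level \<alpha> i]"

text \<open>The rooted \<open>n\<close>-simplex \<open>\<alpha>\<^sub>a\<close>. Its level \<open>i\<close> is the preimage \<open>fibre \<alpha> i n a\<close> of \<open>a\<close>, whose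
  elements are renumbered by their position in this increasing list; the position of \<open>c\<close> is the
  number of elements less than \<open>c\<close>.\<close>

definition subtree :: "nat \<Rightarrow> leveled \<Rightarrow> nat \<Rightarrow> leveled" where
  "subtree n \<alpha> a =
     (\<lambda>i\<in>{..n}. length (fibre \<alpha> i n a),
      \<lambda>(i, j)\<in>intervals n.
        (length (fibre \<alpha> i n a), length (fibre \<alpha> j n a),
         \<lambda>b\<in>{..<length (fibre \<alpha> i n a)}.
           length (filter (\<lambda>c. c < lmap \<alpha> i j (fibre \<alpha> i n a ! b)) (fibre \<alpha> j n a))))"

text \<open>The colour \<open>a \<in> A\<^sub>i\<close> and the generator \<open>p\<^sub>i\<^sup>(\<^sup>a\<^sup>)\<close> of \<open>T\<^sub>\<alpha>\<close> are both encoded as \<open>(i, a)\<close>.\<close>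

type_synonym ltree = "(nat \<times> nat, nat \<times> nat) tree"

definition tree_collection :: "nat \<Rightarrow> leveled \<Rightarrow> (nat \<times> nat, nat \<times> nat) collection" where
  "tree_collection n \<alpha> = \<lparr>
     gcolours = {(i, a). i \<le> n \<and> a < level \<alpha> i},
     gens = {(i, a). 1 \<le> i \<and> i \<le> n \<and> a < level \<alpha> i},
     gsrc = (\<lambda>(i, a). map (Pair (i - 1)) (fibre \<alpha> (i - 1) i a)),
     gtgt = (\<lambda>(i, a). (i, a))\<rparr>"

definition tree_operad :: "nat \<Rightarrow> leveled \<Rightarrow> (nat \<times> nat, ltree) operad" where
  "tree_operad n \<alpha> = free_operad (tree_collection n \<alpha>)"

text \<open>\<open>gen_comp \<alpha> i j a\<close> is \<open>p\<^sub>i\<^sub>,\<^sub>j\<^sup>(\<^sup>a\<^sup>)\<close>, for \<open>i \<le> j\<close>.\<close>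

fun gen_comp :: "leveled \<Rightarrow> nat \<Rightarrow> nat \<Rightarrow> nat \<Rightarrow> ltree" where
  "gen_comp \<alpha> i 0 a = Leaf (0, a)"
| "gen_comp \<alpha> i (Suc j) a =
     (if i \<le> j then Node (Suc j, a) (map (gen_comp \<alpha> i j) (fibre \<alpha> j (Suc j) a))
      else Leaf (Suc j, a))"

text \<open>\<open>\<lambda>\<^sub>\<theta> : T\<^bsub>\<theta>\<^sup>*\<alpha>\<^esub> \<rightarrow> T\<^sub>\<alpha>\<close>, for \<open>\<theta> : [k] \<rightarrow> [n]\<close>\<close>

definition tree_pullback :: "nat \<Rightarrow> nat \<Rightarrow> (nat \<Rightarrow> nat) \<Rightarrow> leveled \<Rightarrow>
    (nat \<times> nat \<Rightarrow> nat \<times> nat) \<times> (ltree \<Rightarrow> ltree)" where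
  "tree_pullback k n \<theta> \<alpha> =
     free_morphism (tree_collection k (act (nerve Delta_plus) k n \<theta> \<alpha>)) (tree_operad n \<alpha>)
       (\<lambda>(i, b). (\<theta> i, b))
       (\<lambda>(i, b). gen_comp \<alpha> (\<theta> (i - 1)) (\<theta> i) b)"

text \<open>The inclusion \<open>T\<^bsub>\<alpha>\<^sub>a\<^esub> \<subseteq> T\<^sub>\<alpha>\<close>, which undoes the renumbering of \<^const>\<open>subtree\<close>.\<close>

definition tree_inclusion :: "nat \<Rightarrow> leveled \<Rightarrow> nat \<Rightarrow>
    (nat \<times> nat \<Rightarrow> nat \<times> nat) \<times> (ltree \<Rightarrow> ltree)" where
  "tree_inclusion n \<alpha> a =
     (let \<iota> = (\<lambda>(i, b). (i, fibre \<alpha> i n a ! b)); T = tree_operad n (subtree n \<alpha> a)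
      in (restrict \<iota> (colours T), restrict (map_tree \<iota> \<iota>) (ops T)))"


section \<open>The list nerve of an operad\<close>

type_synonym ('c, 'o) list_simplex = "leveled \<times> (nat \<times> nat \<Rightarrow> 'c) \<times> (ltree \<Rightarrow> 'o)"

definition list_nerve :: "('c, 'o) operad \<Rightarrow> ('c, 'o) list_simplex slist" where
  "list_nerve P = \<lparr>
     simps = (\<lambda>n. {(\<alpha>, x). \<alpha> \<in> simps (nerve Delta_plus) n \<and> rooted n \<alpha> \<and>
                           x \<in> operad_morphisms (tree_operad n \<alpha>) P}),
     act = (\<lambda>k n \<theta> (\<alpha>, x).
        let \<beta> = act (nerve Delta_plus) k n \<theta> \<alpha>
        in map (\<lambda>a. (subtree k \<beta> a,
                     morphism_comp (tree_operad k (subtree k \<beta> a)) x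
                       (morphism_comp (tree_operad k (subtree k \<beta> a))
                          (tree_pullback k n \<theta> \<alpha>) (tree_inclusion k \<beta> a))))
               [0..<level \<beta> k])\<rparr>"

end

theory Submission
  imports Defs
begin

text \<open>
  An operad \<open>P\<close> has a monoidal envelope: its objects are lists of colours and its arrows are lists
  of operations, composed blockwise. A leveled forest labelled in \<open>P\<close> (a chain in \<open>\<Delta>\<^sub>+\<close>, not
  necessarily rooted, with a morphism \<open>T\<^sub>\<alpha> \<rightarrow> P\<close>) is the same thing as a simplex of the nerve of the
  envelope: the vertices of the chain are the lists of colours of the levels, and its edges are the
  lists of values of the composites \<open>p\<^sub>i\<^sub>,\<^sub>j\<close>. Cutting a forest into its rooted components then
  identifies \<open>\<L>(N\<^sup>l(P))\<close> with the nerve of the envelope, a list of rooted simplices being sent to the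
  concatenation of their chains.

  Conversely, if \<open>\<L>X\<close> is a nerve, then it is the nerve of a category \<open>D\<close> on \<open>\<L>X\<^sub>0\<close> and \<open>\<L>X\<^sub>1\<close>, and every
  simplex is determined by its vertices and edges. If \<open>X\<close> is moreover operadic, then the target and
  the identities of \<open>D\<close> are given by functions, composition preserves lengths and is compatible with
  concatenation, so \<open>D\<close> is the envelope of an operad with colours \<open>X\<^sub>0\<close> and operations \<open>X\<^sub>1\<close>. The
  simplices of \<open>X\<close> and of the list nerve of this operad both correspond to the chains whose last
  vertex has length 1.
\<close>

section \<open>The envelope of an operad\<close>

text \<open>Two features of the list nerve make a direct comparison awkward: \<open>subtree\<close>
  renumbers the elements of every level, and the structure maps are composites through free operads.
  Both disappear in a chain of the envelope, which records only lists of colours and operations. No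
  shape has to be recorded there: the arities of the operations are the sizes of the fibres, and a
  monotone map is determined by these sizes. Hence equations between lists of simplices of the list
  nerve are proved by comparing concatenated chains. The factors of a concatenation can be separated
  because the last vertex of a rooted simplex has length 1. This fixes the number of factors and
  then, going back along the edges into the last vertex, every other length. The operadic condition
  concerns last vertices too. The map from \<open>[0]\<close> to \<open>[1]\<close> with value 1 and
  the map from \<open>[1]\<close> to \<open>[0]\<close> preserve last vertices, so targets and
  identities are functions, while the map with value 0 may act as a listing and gives the
  sources.\<close>

fun chop :: "nat list \<Rightarrow> 'a list \<Rightarrow> 'a list list" where
  "chop [] xs = []"
| "chop (k # ks) xs = take k xs # chop ks (drop k xs)"

lemma chop_concat: "chop (map length xss) (concat xss) = xss"
  by (induction xss) auto

text \<open>Serves to recover data from a concatenation: the fibres in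
  \<open>forest_chain_inj\<close>, the factors in \<open>chain_concat_inj\<close>.\<close>

lemma concat_injective_map:
  assumes "concat (map u xs) = concat (map v ys)" "length xs = length ys"
    and "\<And>i. i < length xs \<Longrightarrow> length (u (xs ! i)) = length (v (ys ! i))"
  shows "map u xs = map v ys"
proof -
  have "\<forall>(x, y)\<in>set (zip (map u xs) (map v ys)). length x = length y"
    using assms(2,3) by (auto simp: set_zip)
  then show ?thesis
    using assms(1,2) by (intro concat_injective) auto
qed

text \<open>The arities of \<open>gs\<close> cut \<open>fs\<close> into argument lists, one for each
  letter of \<open>gs\<close>: this is composition in the envelope. As \<open>chop\<close> is total,
  the recursion in \<open>lcomp_Cons\<close> is unconditional.\<close>

definition lcomp :: "('c, 'o) operad \<Rightarrow> 'o list \<Rightarrow> 'o list \<Rightarrow> 'o list" where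
  "lcomp P gs fs = map2 (ocomp P) gs (chop (map (\<lambda>g. length (src P g)) gs) fs)"

lemma lcomp_Nil [simp]: "lcomp P [] fs = []"
  by (simp add: lcomp_def)

lemma lcomp_Cons [simp]:
  "lcomp P (g # gs) fs =
     ocomp P g (take (length (src P g)) fs) # lcomp P gs (drop (length (src P g)) fs)"
  by (simp add: lcomp_def)

lemma length_chop [simp]: "length (chop ks xs) = length ks"
  by (induction ks arbitrary: xs) auto

lemma length_lcomp [simp]: "length (lcomp P gs fs) = length gs"
  by (simp add: lcomp_def)

lemma lcomp_append:
  "length f1 = length (concat (map (src P) g1)) \<Longrightarrow>
     lcomp P (g1 @ g2) (f1 @ f2) = lcomp P g1 f1 @ lcomp P g2 f2"
  by (induction g1 arbitrary: f1) auto

lemma lcomp_concat: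
  "map length rss = map (\<lambda>g. length (src P g)) gs \<Longrightarrow>
     lcomp P gs (concat rss) = map2 (ocomp P) gs rss"
  unfolding lcomp_def by (metis chop_concat)

definition envelope :: "('c, 'o) operad \<Rightarrow> ('c list, 'o list) category" where
  "envelope P = \<lparr>Obj = lists (colours P), Arr = lists (ops P),
     cdom = (\<lambda>f. concat (map (src P) f)), ccod = map (tgt P),
     cid = map (ounit P), ccomp = lcomp P\<rparr>"

lemma map_eq_concat_conv:
  "map t fs = concat xss \<Longrightarrow> \<exists>rss. fs = concat rss \<and> map (map t) rss = xss"
proof (induction xss arbitrary: fs)
  case (Cons xs xss)
  then obtain f1 f2 where "fs = f1 @ f2" "map t f1 = xs" "map t f2 = concat xss"
    by (auto simp: map_eq_append_conv)
  with Cons.IH[of f2] show ?case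
    by (metis concat.simps(2) list.simps(9))
qed auto

context operad
begin

lemma lcomp_in:
  "\<lbrakk>gs \<in> lists (ops P); fs \<in> lists (ops P); map (tgt P) fs = concat (map (src P) gs)\<rbrakk> \<Longrightarrow>
     lcomp P gs fs \<in> lists (ops P) \<and> map (tgt P) (lcomp P gs fs) = map (tgt P) gs \<and>
     concat (map (src P) (lcomp P gs fs)) = concat (map (src P) fs)"
proof (induction gs arbitrary: fs)
  case (Cons g gs)
  then obtain f1 f2 where f: "fs = f1 @ f2" "map (tgt P) f1 = src P g"
      "map (tgt P) f2 = concat (map (src P) gs)"
    by (auto simp: map_eq_append_conv)
  have len: "length (src P g) = length f1"
    using f(2) by (metis length_map)
  show ?case
    using Cons f len comp_in[of g f1] src_comp[of g f1] tgt_comp[of g f1] by auto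
qed simp

lemma lcomp_id_right:
  "fs \<in> lists (ops P) \<Longrightarrow> lcomp P fs (map (ounit P) (concat (map (src P) fs))) = fs"
  by (induction fs) (auto simp: comp_unit_right)

lemma lcomp_id_left:
  "fs \<in> lists (ops P) \<Longrightarrow> lcomp P (map (ounit P) (map (tgt P) fs)) fs = fs"
  by (induction fs) (auto simp: src_unit tgt_in comp_unit_left)

text \<open>\<open>comp_assoc\<close> takes the innermost arguments as a list of lists, the envelope
  as one flat list. The targets of \<open>fs\<close> tell how to cut it along the sources of
  \<open>qs\<close>.\<close>

lemma ocomp_lcomp:
  assumes "p \<in> ops P" "qs \<in> lists (ops P)" "map (tgt P) qs = src P p"
    "fs \<in> lists (ops P)" "map (tgt P) fs = concat (map (src P) qs)"
  shows "ocomp P p (lcomp P qs fs) = ocomp P (ocomp P p qs) fs"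
proof -
  obtain rss where r: "fs = concat rss" "map (map (tgt P)) rss = map (src P) qs"
    using map_eq_concat_conv[OF assms(5)] by blast
  have "map length (map (map (tgt P)) rss) = map length (map (src P) qs)"
    using r(2) by simp
  then have "map length rss = map (\<lambda>g. length (src P g)) qs"
    by (simp add: comp_def)
  moreover have "rss \<in> lists (lists (ops P))"
    using assms(4) r(1) by auto
  ultimately show ?thesis
    using assms r comp_assoc[of p qs rss] by (simp add: lcomp_concat)
qed

text \<open>The arity of the first letter of \<open>hs\<close> splits \<open>gs\<close>, and the
  sources of that part of \<open>gs\<close> split \<open>fs\<close>; the head is then
  \<open>ocomp_lcomp\<close>, the tail the induction hypothesis.\<close>

lemma lcomp_assoc:
  "\<lbrakk>hs \<in> lists (ops P); gs \<in> lists (ops P); fs \<in> lists (ops P);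
    map (tgt P) fs = concat (map (src P) gs); map (tgt P) gs = concat (map (src P) hs)\<rbrakk> \<Longrightarrow>
     lcomp P hs (lcomp P gs fs) = lcomp P (lcomp P hs gs) fs"
proof (induction hs arbitrary: gs fs)
  case (Cons p hs)
  then obtain g1 g2 where g: "gs = g1 @ g2" "map (tgt P) g1 = src P p"
      "map (tgt P) g2 = concat (map (src P) hs)"
    by (auto simp: map_eq_append_conv)
  then have "map (tgt P) fs = concat (map (src P) g1) @ concat (map (src P) g2)"
    using Cons.prems by simp
  then obtain f1 f2 where f: "fs = f1 @ f2" "map (tgt P) f1 = concat (map (src P) g1)"
      "map (tgt P) f2 = concat (map (src P) g2)"
    by (auto simp: map_eq_append_conv)
  have len: "length (src P p) = length g1" "length (concat (map (src P) g1)) = length f1"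
    using g(2) f(2) by (metis length_map)+
  have p: "src P (ocomp P p g1) = concat (map (src P) g1)"
    using Cons.prems g by (intro src_comp) auto
  have "lcomp P hs (lcomp P g2 f2) = lcomp P (lcomp P hs g2) f2"
    using Cons.prems g f by (intro Cons.IH) auto
  moreover have "ocomp P p (lcomp P g1 f1) = ocomp P (ocomp P p g1) f1"
    using Cons.prems g f by (intro ocomp_lcomp) auto
  ultimately show ?case
    using g f len p by (simp add: lcomp_append)
qed simp

lemma category_envelope: "category (envelope P)"
proof (unfold_locales, unfold envelope_def, simp_all del: in_lists_conv_set)
  show "concat (map (src P) f) \<in> lists (colours P)" if "f \<in> lists (ops P)" for f
    using that by (fastforce dest: src_in)
  show "map (tgt P) f \<in> lists (colours P)" if "f \<in> lists (ops P)" for f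
    using that tgt_in by auto
  show "map (ounit P) a \<in> lists (ops P)" if "a \<in> lists (colours P)" for a
    using that unit_in by auto
  show "concat (map (src P \<circ> ounit P) a) = a" if "a \<in> lists (colours P)" for a
    using that by (induction a) (auto simp: src_unit)
  show "map (tgt P \<circ> ounit P) a = a" if "a \<in> lists (colours P)" for a
    using that by (induction a) (auto simp: tgt_unit)
  show "lcomp P f (map (ounit P) (concat (map (src P) f))) = f" if "f \<in> lists (ops P)" for f
    using that by (rule lcomp_id_right)
  show "lcomp P (map (ounit P \<circ> tgt P) f) f = f" if "f \<in> lists (ops P)" for f
    using lcomp_id_left[OF that] by simp
qed (use lcomp_in lcomp_assoc in \<open>auto simp del: in_lists_conv_set\<close>)

end

section \<open>Free operads and their morphisms\<close>

definition wf_collection :: "('c, 'g) collection \<Rightarrow> bool" where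
  "wf_collection S \<longleftrightarrow>
     (\<forall>g\<in>gens S. gsrc S g \<in> lists (gcolours S) \<and> gtgt S g \<in> gcolours S)"

lemma leaves_graft:
  "length ss = length (leaves t) \<Longrightarrow> leaves (graft t ss) = concat (map leaves ss)"
  "length ss = length (concat (map leaves ts)) \<Longrightarrow>
     concat (map leaves (graft_list ts ss)) = concat (map leaves ss)"
proof (induction t ss and ts ss rule: graft_graft_list.induct)
  case (1 c ss)
  then show ?case by (cases ss) auto
next
  case (4 t ts ss)
  have "concat (map leaves ss) = concat (map leaves (take (length (leaves t)) ss)) @
      concat (map leaves (drop (length (leaves t)) ss))"
    by (metis append_take_drop_id concat_append map_append)
  with 4 show ?case by simp
qed auto

lemma root_graft:
  "map (root S) ss = leaves t \<Longrightarrow> root S (graft t ss) = root S t"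
  by (cases t) (auto simp: Cons_eq_map_conv)

lemma map_root_graft_list:
  "map (root S) ss = concat (map leaves ts) \<Longrightarrow>
     map (root S) (graft_list ts ss) = map (root S) ts"
proof (induction ts arbitrary: ss)
  case (Cons t ts)
  then have "map (root S) (take (length (leaves t)) ss) = leaves t"
    "map (root S) (drop (length (leaves t)) ss) = concat (map leaves ts)"
    by (simp_all flip: take_map drop_map)
  with Cons.IH show ?case by (simp add: root_graft)
qed simp

lemma graft_in_trees:
  "t \<in> trees S \<Longrightarrow> ss \<in> lists (trees S) \<Longrightarrow> map (root S) ss = leaves t \<Longrightarrow> graft t ss \<in> trees S"
proof (induction arbitrary: ss rule: trees.induct)
  case (leaf c)
  then show ?case by (cases ss) auto
next
  case (node g ts)
  \<comment> \<open>Generalised from \<open>ts\<close> to lists \<open>us\<close> with letters in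
    \<open>ts\<close>: \<open>graft_list\<close> consumes \<open>ss\<close> and needs an induction
    of its own, while the bound by \<open>set ts\<close> keeps the induction hypothesis for the
    subtrees available.\<close>
  have "set (graft_list us ss) \<subseteq> trees S"
    if "set us \<subseteq> set ts" "ss \<in> lists (trees S)" "map (root S) ss = concat (map leaves us)" for us ss
    using that
  proof (induction us arbitrary: ss)
    case (Cons t us)
    then have "map (root S) (take (length (leaves t)) ss) = leaves t"
      "map (root S) (drop (length (leaves t)) ss) = concat (map leaves us)"
      by (simp_all flip: take_map drop_map)
    moreover have "take (length (leaves t)) ss \<in> lists (trees S)"
      "drop (length (leaves t)) ss \<in> lists (trees S)"
      using Cons.prems(2) by (auto dest: in_set_takeD in_set_dropD)
    moreover have "set us \<subseteq> set ts" "t \<in> set ts"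
      using Cons.prems(1) by auto
    ultimately have "graft t (take (length (leaves t)) ss) \<in> trees S"
      "set (graft_list us (drop (length (leaves t)) ss)) \<subseteq> trees S"
      using Cons.IH node.IH by blast+
    then show ?case by simp
  qed simp
  then show ?case
    using node by (auto simp: map_root_graft_list intro!: trees.node)
qed

lemma graft_leaves: "graft t (map Leaf (leaves t)) = t"
proof (induction t)
  case (Node g ts)
  then have "graft_list ts (map Leaf (concat (map leaves ts))) = ts"
    by (induction ts) auto
  then show ?case by simp
qed simp

lemma graft_list_append:
  "length fs = length (concat (map leaves qs)) \<Longrightarrow>
     graft_list (qs @ qs') (fs @ fs') = graft_list qs fs @ graft_list qs' fs'"
  by (induction qs arbitrary: fs) auto

lemma length_graft_list [simp]: "length (graft_list ts ss) = length ts"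
  by (induction ts arbitrary: ss) auto

text \<open>Both sides cut \<open>fs\<close> in the same places: the part grafted onto the trees
  above \<open>t\<close> has as many entries as those trees have leaves.\<close>

lemma graft_assoc:
  "length qs = length (leaves t) \<Longrightarrow> length fs = length (concat (map leaves qs)) \<Longrightarrow>
     graft t (graft_list qs fs) = graft (graft t qs) fs"
proof (induction t arbitrary: qs fs)
  case (Leaf c)
  then show ?case by (auto simp: length_Suc_conv)
next
  case (Node g ts)
  have "graft_list us (graft_list qs fs) = graft_list (graft_list us qs) fs"
    if "set us \<subseteq> set ts" "length qs = length (concat (map leaves us))"
      "length fs = length (concat (map leaves qs))" for us and qs fs :: "('a, 'b) tree list"
    using that
  proof (induction us arbitrary: qs fs)
    case (Cons t us)
    \<comment> \<open>\<open>q1\<close> is what the leaves of \<open>t\<close> receive, and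
      \<open>f1\<close> is what the leaves of \<open>q1\<close> receive in turn.\<close>
    define q1 q2 where q: "q1 = take (length (leaves t)) qs" "q2 = drop (length (leaves t)) qs"
    define m where "m = length (concat (map leaves q1))"
    define f1 f2 where f: "f1 = take m fs" "f2 = drop m fs"
    have qs: "qs = q1 @ q2" "length q1 = length (leaves t)"
      "length q2 = length (concat (map leaves us))"
      using Cons.prems q by auto
    have fs: "fs = f1 @ f2" "length f1 = length (concat (map leaves q1))"
      "length f2 = length (concat (map leaves q2))"
      using Cons.prems(3) f qs(1) by (auto simp: m_def)
    have "graft t (graft_list q1 f1) = graft (graft t q1) f1"
      using Cons.prems qs fs by (intro Node.IH) auto
    moreover have "graft_list us (graft_list q2 f2) = graft_list (graft_list us q2) f2"
      using Cons.prems qs fs by (intro Cons.IH) auto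
    ultimately show ?case
      using qs(2,3) fs(2,3) by (simp add: qs(1) fs(1) graft_list_append leaves_graft(1))
  qed simp
  then show ?case using Node.prems by simp
qed

lemma graft_list_concat:
  "map length rss = map (\<lambda>q. length (leaves q)) qs \<Longrightarrow>
     graft_list qs (concat rss) = map2 graft qs rss"
proof (induction qs arbitrary: rss)
  case (Cons q qs)
  then show ?case by (cases rss) auto
qed simp

lemma leaves_in: "t \<in> trees S \<Longrightarrow> set (leaves t) \<subseteq> gcolours S"
  by (induction rule: trees.induct) auto

lemma root_in: "wf_collection S \<Longrightarrow> t \<in> trees S \<Longrightarrow> root S t \<in> gcolours S"
  by (erule trees.cases) (auto simp: wf_collection_def)

lemma operad_free_operad:
  assumes "wf_collection S"
  shows "operad (free_operad S)"
proof (unfold_locales, unfold free_operad_def, simp_all del: in_lists_conv_set)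
  show "leaves p \<in> lists (gcolours S)" if "p \<in> trees S" for p
    using leaves_in[OF that] by auto
  show "root S p \<in> gcolours S" if "p \<in> trees S" for p
    using assms that by (rule root_in)
  show "Leaf a \<in> trees S" if "a \<in> gcolours S" for a
    using that by (rule trees.leaf)
  show "graft p qs \<in> trees S"
    if "p \<in> trees S" "qs \<in> lists (trees S)" "map (root S) qs = leaves p" for p qs
    using that by (rule graft_in_trees)
  show "leaves (graft p qs) = concat (map leaves qs)"
    if "p \<in> trees S" "qs \<in> lists (trees S)" "map (root S) qs = leaves p" for p qs
    using that(3) by (intro leaves_graft(1)) (metis length_map)
  show "root S (graft p qs) = root S p"
    if "p \<in> trees S" "qs \<in> lists (trees S)" "map (root S) qs = leaves p" for p qs
    using that(3) by (rule root_graft)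
  show "graft p (map Leaf (leaves p)) = p" for p :: "('a, 'b) tree"
    by (rule graft_leaves)
  show "graft p (map2 graft qs rss) = graft (graft p qs) (concat rss)"
    if p: "map (root S) qs = leaves p" "map (map (root S)) rss = map leaves qs" for p qs rss
  proof -
    have "map length (map (map (root S)) rss) = map length (map leaves qs)"
      using p(2) by simp
    then have len: "map length rss = map (\<lambda>q. length (leaves q)) qs"
      by (simp add: comp_def)
    moreover have "length qs = length (leaves p)"
      using p(1) by (metis length_map)
    ultimately show ?thesis
      using graft_assoc[of qs p "concat rss"]
      by (simp add: graft_list_concat length_concat comp_def)
  qed
qed

section \<open>Morphisms out of a free operad\<close>

definition gen_maps :: "('c, 'g) collection \<Rightarrow> ('d, 'q) operad \<Rightarrow> (('c \<Rightarrow> 'd) \<times> ('g \<Rightarrow> 'q)) set" where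
  "gen_maps S P = {(f, h). f \<in> gcolours S \<rightarrow> colours P \<and>
     (\<forall>g\<in>gens S. h g \<in> ops P \<and> src P (h g) = map f (gsrc S g) \<and> tgt P (h g) = f (gtgt S g))}"

context operad
begin

lemma free_eval_in:
  assumes "(f, h) \<in> gen_maps S P"
  shows "t \<in> trees S \<Longrightarrow> free_eval P f h t \<in> ops P \<and>
    src P (free_eval P f h t) = map f (leaves t) \<and> tgt P (free_eval P f h t) = f (root S t)"
proof (induction rule: trees.induct)
  case (leaf c)
  then have "f c \<in> colours P"
    using assms by (auto simp: gen_maps_def)
  then show ?case
    by (simp add: src_unit tgt_unit unit_in)
next
  case (node g ts)
  have h: "h g \<in> ops P" "src P (h g) = map f (gsrc S g)" "tgt P (h g) = f (gtgt S g)"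
    using assms node.hyps by (auto simp: gen_maps_def)
  have "map (tgt P) (map (free_eval P f h) ts) = map (f \<circ> root S) ts"
    using node.IH by auto
  also have "\<dots> = src P (h g)"
    using node.hyps h(2) by (metis list.map_comp)
  finally have c: "map (tgt P) (map (free_eval P f h) ts) = src P (h g)" .
  have l: "map (free_eval P f h) ts \<in> lists (ops P)"
    using node.IH by auto
  have "concat (map (src P) (map (free_eval P f h) ts)) = concat (map (map f \<circ> leaves) ts)"
    using node.IH by (auto intro!: arg_cong[of _ _ concat])
  then show ?case
    using comp_in[OF h(1) l c] src_comp[OF h(1) l c] tgt_comp[OF h(1) l c] h
    by (simp add: map_concat)
qed

text \<open>Grafting onto a list of trees is evaluated to composition in the envelope, so
  compatibility with grafting at a node becomes associativity in the form
  \<open>ocomp_lcomp\<close>.\<close>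

lemma free_eval_graft:
  assumes fh: "(f, h) \<in> gen_maps S P"
  shows "t \<in> trees S \<Longrightarrow> ss \<in> lists (trees S) \<Longrightarrow> map (root S) ss = leaves t \<Longrightarrow>
     free_eval P f h (graft t ss) = ocomp P (free_eval P f h t) (map (free_eval P f h) ss)"
proof (induction arbitrary: ss rule: trees.induct)
  case (leaf c)
  then obtain s where "ss = [s]" "s \<in> trees S" "root S s = c"
    by (auto simp: map_eq_Cons_conv)
  then show ?case
    using free_eval_in[OF fh, of s] comp_unit_left[of "free_eval P f h s"] by simp
next
  case (node g ts)
  let ?ev = "free_eval P f h"
  have "map ?ev (graft_list us ss) = lcomp P (map ?ev us) (map ?ev ss)"
    if "set us \<subseteq> set ts" "ss \<in> lists (trees S)" "map (root S) ss = concat (map leaves us)" for us ss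
    using that
  proof (induction us arbitrary: ss)
    case (Cons t us)
    have r: "map (root S) (take (length (leaves t)) ss) = leaves t"
      "map (root S) (drop (length (leaves t)) ss) = concat (map leaves us)"
      using Cons.prems(3) by (simp_all flip: take_map drop_map)
    have in_trees: "take (length (leaves t)) ss \<in> lists (trees S)"
      "drop (length (leaves t)) ss \<in> lists (trees S)"
      using Cons.prems(2) by (auto dest: in_set_takeD in_set_dropD)
    have t: "t \<in> trees S"
      using Cons.prems(1) node.IH by auto
    have "?ev (graft t (take (length (leaves t)) ss)) =
        ocomp P (?ev t) (map ?ev (take (length (leaves t)) ss))"
      using Cons.prems(1) node.IH r(1) in_trees(1) by auto
    moreover have "length (src P (?ev t)) = length (leaves t)"
      using free_eval_in[OF fh t] by simp
    ultimately show ?case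
      using Cons.prems(1) Cons.IH[OF _ in_trees(2) r(2)] by (simp add: take_map drop_map)
  qed simp
  then have "?ev (graft (Node g ts) ss) = ocomp P (h g) (lcomp P (map ?ev ts) (map ?ev ss))"
    using node.prems by simp
  also have "\<dots> = ocomp P (ocomp P (h g) (map ?ev ts)) (map ?ev ss)"
  proof (rule ocomp_lcomp)
    show "h g \<in> ops P"
      using fh node.hyps by (auto simp: gen_maps_def)
    show "map ?ev ts \<in> lists (ops P)" "map ?ev ss \<in> lists (ops P)"
      using free_eval_in[OF fh] node.IH node.prems by auto
    have "map (tgt P) (map ?ev ts) = map (f \<circ> root S) ts"
      using free_eval_in[OF fh] node.IH by auto
    also have "\<dots> = map f (gsrc S g)"
      using node.hyps(2) by (metis list.map_comp)
    finally show "map (tgt P) (map ?ev ts) = src P (h g)"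
      using fh node.hyps by (auto simp: gen_maps_def)
    have src_ev: "\<forall>t\<in>set ts. src P (?ev t) = map f (leaves t)"
      using free_eval_in[OF fh] node.IH by blast
    have "map (tgt P) (map ?ev ss) = map (f \<circ> root S) ss"
      using free_eval_in[OF fh] node.prems by auto
    also have "\<dots> = map f (map (root S) ss)"
      by simp
    also have "\<dots> = map f (concat (map leaves ts))"
      using node.prems(2) by (simp only: leaves.simps)
    also have "\<dots> = concat (map (\<lambda>t. src P (?ev t)) ts)"
      using src_ev by (simp add: map_concat comp_def cong: map_cong)
    also have "\<dots> = concat (map (src P) (map ?ev ts))"
      by (simp add: comp_def)
    finally show "map (tgt P) (map ?ev ss) = concat (map (src P) (map ?ev ts))" .
  qed
  finally show ?case by simp
qed

text \<open>The existence half of the universal property: the elements of \<open>gen_maps\<close>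
  are the maps of collections from \<open>S\<close> to \<open>P\<close>.\<close>

lemma free_morphism_in:
  assumes S: "wf_collection S" and fh: "(f, h) \<in> gen_maps S P"
  shows "free_morphism S P f h \<in> operad_morphisms (free_operad S) P"
proof -
  interpret F: operad "free_operad S"
    using S by (rule operad_free_operad)
  show ?thesis
    unfolding operad_morphisms_def free_morphism_def mem_Collect_eq case_prod_conv
  proof (intro conjI ballI impI)
    show "restrict f (gcolours S) \<in> colours (free_operad S) \<rightarrow>\<^sub>E colours P"
      using fh by (auto simp: free_operad_def gen_maps_def)
    show "restrict (free_eval P f h) (trees S) \<in> ops (free_operad S) \<rightarrow>\<^sub>E ops P"
      using free_eval_in[OF fh] by (auto simp: free_operad_def)
    show "src P (restrict (free_eval P f h) (trees S) p) =
          map (restrict f (gcolours S)) (src (free_operad S) p)"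
        "tgt P (restrict (free_eval P f h) (trees S) p) =
          restrict f (gcolours S) (tgt (free_operad S) p)"
      if "p \<in> ops (free_operad S)" for p
      using that free_eval_in[OF fh, of p] leaves_in[of p S] root_in[OF S, of p]
      by (auto simp: free_operad_def)
    show "restrict (free_eval P f h) (trees S) (ounit (free_operad S) a) =
        ounit P (restrict f (gcolours S) a)"
      if "a \<in> colours (free_operad S)" for a
      using that by (auto simp: free_operad_def intro: trees.leaf)
    show "restrict (free_eval P f h) (trees S) (ocomp (free_operad S) p qs) =
        ocomp P (restrict (free_eval P f h) (trees S) p) (map (restrict (free_eval P f h) (trees S)) qs)"
      if "p \<in> ops (free_operad S)" "qs \<in> lists (ops (free_operad S))"
        "map (tgt (free_operad S)) qs = src (free_operad S) p" for p qs
    proof -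
      have q: "p \<in> trees S" "qs \<in> lists (trees S)" "map (root S) qs = leaves p"
        using that by (auto simp: free_operad_def)
      then have "map (restrict (free_eval P f h) (trees S)) qs = map (free_eval P f h) qs"
        by auto
      then show ?thesis
        using free_eval_graft[OF fh q] q(1) graft_in_trees[OF q]
        by (simp add: free_operad_def del: map_eq_conv)
    qed
  qed
qed

end

lemma graft_list_Leaf: "length cs = length ts \<Longrightarrow> graft_list (map Leaf cs) ts = ts"
  by (induction cs ts rule: list_induct2) auto

lemma corolla_in_trees:
  assumes "wf_collection S" "c \<in> gens S"
  shows "Node c (map Leaf (gsrc S c)) \<in> trees S"
proof (rule trees.node)
  show "\<forall>t\<in>set (map Leaf (gsrc S c)). t \<in> trees S"
    using assms by (auto simp: wf_collection_def intro!: trees.leaf)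
  show "map (root S) (map Leaf (gsrc S c)) = gsrc S c"
    by (simp add: comp_def)
qed fact

text \<open>The uniqueness half: a node is its corolla with the subtrees grafted on, so a morphism
  is determined by its values on colours and on corollas.\<close>

lemma operad_morphism_free_eval:
  assumes S: "wf_collection S" and x: "(f, g) \<in> operad_morphisms (free_operad S) P"
  shows "t \<in> trees S \<Longrightarrow> g t = free_eval P f (\<lambda>c. g (Node c (map Leaf (gsrc S c)))) t"
proof (induction rule: trees.induct)
  case (leaf c)
  then show ?case
    using x by (auto simp: operad_morphisms_def free_operad_def)
next
  case (node c ts)
  let ?corolla = "Node c (map Leaf (gsrc S c))"
  have "length (gsrc S c) = length ts"
    using node.hyps(2) by (metis length_map)
  then have "Node c ts = graft ?corolla ts"
    by (simp add: graft_list_Leaf)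
  also have "g \<dots> = ocomp P (g ?corolla) (map g ts)"
  proof -
    have "leaves ?corolla = gsrc S c"
      by (simp add: comp_def)
    moreover have "ts \<in> lists (trees S)"
      using node.IH by auto
    ultimately show ?thesis
      using x node.hyps(2) corolla_in_trees[OF S node.hyps(1)]
      by (simp add: operad_morphisms_def free_operad_def del: graft.simps in_lists_conv_set)
  qed
  finally show ?case
    using node.IH by (simp cong: map_cong)
qed

lemma operad_morphism_eqI:
  assumes S: "wf_collection S"
    and x: "(f, g) \<in> operad_morphisms (free_operad S) P"
    and x': "(f', g') \<in> operad_morphisms (free_operad S) P"
    and f: "\<And>a. a \<in> gcolours S \<Longrightarrow> f a = f' a"
    and g: "\<And>c. c \<in> gens S \<Longrightarrow>
      g (Node c (map Leaf (gsrc S c))) = g' (Node c (map Leaf (gsrc S c)))"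
  shows "(f, g) = (f', g')"
proof -
  have ev: "free_eval P f h t = free_eval P f' h' t"
    if "\<forall>c\<in>gens S. h c = h' c" "t \<in> trees S" for h h' t
    using that(2,1) by (induction rule: trees.induct) (auto simp: f cong: map_cong)
  have ext: "f \<in> extensional (gcolours S)" "f' \<in> extensional (gcolours S)"
    "g \<in> extensional (trees S)" "g' \<in> extensional (trees S)"
    using x x' by (auto simp: operad_morphisms_def free_operad_def PiE_def)
  have "g t = g' t" if "t \<in> trees S" for t
    using operad_morphism_free_eval[OF S x that] operad_morphism_free_eval[OF S x' that]
      ev[OF _ that] g by auto
  then show ?thesis
    using ext f by (auto intro: extensionalityI)
qed

section \<open>Leveled trees\<close>

lemma nerve_iff:
  "c \<in> simps (nerve C) n \<longleftrightarrow>
     fst c \<in> {..n} \<rightarrow>\<^sub>E Obj C \<and> snd c \<in> intervals n \<rightarrow>\<^sub>E Arr C \<and>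
     (\<forall>i j. i \<le> j \<and> j \<le> n \<longrightarrow> cdom C (snd c (i, j)) = fst c i \<and> ccod C (snd c (i, j)) = fst c j) \<and>
     (\<forall>i\<le>n. snd c (i, i) = cid C (fst c i)) \<and>
     (\<forall>i j l. i \<le> j \<and> j \<le> l \<and> l \<le> n \<longrightarrow> snd c (i, l) = ccomp C (snd c (j, l)) (snd c (i, j)))"
  by (cases c) (auto simp: nerve_def intervals_def)

lemma act_nerve:
  "act (nerve C) k n \<theta> c =
     (\<lambda>i\<in>{..k}. fst c (\<theta> i), \<lambda>(i, j)\<in>intervals k. snd c (\<theta> i, \<theta> j))"
  by (cases c) (auto simp: nerve_def)

lemma simplex_maps_le: "\<theta> \<in> simplex_maps k n \<Longrightarrow> i \<le> k \<Longrightarrow> \<theta> i \<le> n"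
  by (auto simp: simplex_maps_def)

lemma simplex_maps_mono: "\<theta> \<in> simplex_maps k n \<Longrightarrow> i \<le> j \<Longrightarrow> j \<le> k \<Longrightarrow> \<theta> i \<le> \<theta> j"
  by (auto simp: simplex_maps_def mono_on_def)

lemma act_nerve_in:
  assumes \<theta>: "\<theta> \<in> simplex_maps k n" and c: "c \<in> simps (nerve C) n"
  shows "act (nerve C) k n \<theta> c \<in> simps (nerve C) k"
proof -
  have "fst c i \<in> Obj C" if "i \<le> n" for i
    using c that unfolding nerve_iff by blast
  moreover have "snd c (i, j) \<in> Arr C" if "i \<le> j" "j \<le> n" for i j
    using c that unfolding nerve_iff intervals_def by blast
  ultimately show ?thesis
    using c simplex_maps_le[OF \<theta>] simplex_maps_mono[OF \<theta>]
    by (auto simp: nerve_iff act_nerve intervals_def)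
qed

lemma Delta_plus_simps:
  "(m, m', f) \<in> Arr Delta_plus \<longleftrightarrow> f \<in> {..<m} \<rightarrow>\<^sub>E {..<m'} \<and> mono_on {..<m} f"
  "Obj Delta_plus = UNIV"
  "cdom Delta_plus (m, m', f) = m" "ccod Delta_plus (m, m', f) = m'"
  "cid Delta_plus m = (m, m, \<lambda>b\<in>{..<m}. b)"
  "ccomp Delta_plus (l, l', g) (m, m', f) = (m, l', compose {..<m} g f)"
  by (auto simp: Delta_plus_def)

text \<open>The fibres of a monotone map are consecutive intervals, so listing them in the order of
  their values lists the domain in order.\<close>

lemma filter_monotone_less:
  assumes "\<And>b c. b \<le> c \<Longrightarrow> c < m \<Longrightarrow> f b \<le> (f c :: nat)"
  shows "concat (map (\<lambda>a. filter (\<lambda>b. f b = a) [0..<m]) [0..<n]) = filter (\<lambda>b. f b < n) [0..<m]"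
proof (induction n)
  case (Suc n)
  have "filter (\<lambda>b. f b < n) [0..<m] @ filter (\<lambda>b. f b = n) [0..<m] = filter (\<lambda>b. f b < Suc n) [0..<m]"
    using assms
  proof (induction m)
    case (Suc m)
    have "f b \<le> f m" if "b < m" for b
      using that Suc.prems[of b m] by simp
    \<comment> \<open>The new last element may join the first list only if nothing of value
      \<open>n\<close> came before it, which monotonicity guarantees.\<close>
    then have "filter (\<lambda>b. f b = n) [0..<m] = []" if "f m < n"
      using that by (fastforce simp: filter_empty_conv)
    then show ?case
      using Suc.IH Suc.prems by (auto simp: less_Suc_eq)
  qed simp
  with Suc show ?case by simp
qed simp

lemma filter_less_nth:
  "sorted_wrt (<) xs \<Longrightarrow> k < length xs \<Longrightarrow> filter (\<lambda>c. c < xs ! k) xs = take k (xs :: nat list)"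
proof (induction xs arbitrary: k)
  case (Cons x xs)
  show ?case
  proof (cases k)
    case 0
    with Cons.prems(1) show ?thesis by (auto simp: filter_empty_conv)
  next
    case (Suc k')
    with Cons show ?thesis by auto
  qed
qed simp

lemma length_filter_mono:
  "(\<And>x. P x \<Longrightarrow> Q x) \<Longrightarrow> length (filter P xs) \<le> length (filter Q xs)"
  by (induction xs) (auto simp: le_Suc_eq)

text \<open>Justifies the renumbering in \<open>subtree\<close>: in a strictly increasing list,
  counting the smaller elements gives the position.\<close>

lemma length_filter_less_nth:
  assumes "sorted_wrt (<) xs" "(x :: nat) \<in> set xs"
  shows "length (filter (\<lambda>c. c < x) xs) < length xs \<and> xs ! length (filter (\<lambda>c. c < x) xs) = x"
proof -
  obtain k where "k < length xs" "x = xs ! k"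
    using assms(2) by (auto simp: in_set_conv_nth)
  then show ?thesis
    using filter_less_nth[OF assms(1), of k] by simp
qed

lemma set_fibre: "set (fibre \<alpha> i j a) = {b. b < level \<alpha> i \<and> lmap \<alpha> i j b = a}"
  by (auto simp: fibre_def)

lemma sorted_fibre: "sorted_wrt (<) (fibre \<alpha> i j a)"
  by (simp add: fibre_def sorted_wrt_filter)

lemma nth_fibre:
  assumes "b < length (fibre \<alpha> i j a)"
  shows "fibre \<alpha> i j a ! b < level \<alpha> i" "lmap \<alpha> i j (fibre \<alpha> i j a ! b) = a"
  using nth_mem[OF assms] by (auto simp: set_fibre)

section \<open>Fibres and composites in one leveled tree\<close>

locale leveled_tree =
  fixes n :: nat and \<alpha> :: leveled
  assumes chain: "\<alpha> \<in> simps (nerve Delta_plus) n"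
begin

lemma arrow:
  assumes "i \<le> j" "j \<le> n"
  shows "snd \<alpha> (i, j) = (level \<alpha> i, level \<alpha> j, lmap \<alpha> i j)"
    "lmap \<alpha> i j \<in> {..<level \<alpha> i} \<rightarrow>\<^sub>E {..<level \<alpha> j}" "mono_on {..<level \<alpha> i} (lmap \<alpha> i j)"
proof -
  obtain m m' f where f: "snd \<alpha> (i, j) = (m, m', f)"
    by (metis prod_cases3)
  have "(i, j) \<in> intervals n"
    using assms by (simp add: intervals_def)
  then have "snd \<alpha> (i, j) \<in> Arr Delta_plus" "cdom Delta_plus (snd \<alpha> (i, j)) = fst \<alpha> i"
    "ccod Delta_plus (snd \<alpha> (i, j)) = fst \<alpha> j"
    using chain assms unfolding nerve_iff by blast+
  then show "snd \<alpha> (i, j) = (level \<alpha> i, level \<alpha> j, lmap \<alpha> i j)"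
    "lmap \<alpha> i j \<in> {..<level \<alpha> i} \<rightarrow>\<^sub>E {..<level \<alpha> j}" "mono_on {..<level \<alpha> i} (lmap \<alpha> i j)"
    by (simp_all add: f Delta_plus_simps level_def lmap_def)
qed

lemma lmap_less: "i \<le> j \<Longrightarrow> j \<le> n \<Longrightarrow> b < level \<alpha> i \<Longrightarrow> lmap \<alpha> i j b < level \<alpha> j"
  using arrow(2)[of i j] by auto

lemma lmap_mono:
  "i \<le> j \<Longrightarrow> j \<le> n \<Longrightarrow> b \<le> c \<Longrightarrow> c < level \<alpha> i \<Longrightarrow> lmap \<alpha> i j b \<le> lmap \<alpha> i j c"
  using arrow(3)[of i j] by (auto simp: mono_on_def)

lemma lmap_refl:
  assumes "i \<le> n" "b < level \<alpha> i"
  shows "lmap \<alpha> i i b = b"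
proof -
  have "snd \<alpha> (i, i) = cid Delta_plus (fst \<alpha> i)"
    using chain assms unfolding nerve_iff by blast
  then show ?thesis
    using assms by (simp add: arrow(1) Delta_plus_simps level_def)
qed

lemma lmap_trans:
  assumes "i \<le> j" "j \<le> l" "l \<le> n" "b < level \<alpha> i"
  shows "lmap \<alpha> i l b = lmap \<alpha> j l (lmap \<alpha> i j b)"
proof -
  have "snd \<alpha> (i, l) = ccomp Delta_plus (snd \<alpha> (j, l)) (snd \<alpha> (i, j))"
    using chain assms unfolding nerve_iff by blast
  then show ?thesis
    using assms by (simp add: arrow(1) Delta_plus_simps compose_def)
qed

text \<open>Monotone maps cut their domain into intervals ordered like the codomain. Through this
  equation labels over level \<open>i\<close> are identified with concatenations over level
  \<open>j\<close>.\<close>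

lemma concat_fibre:
  assumes "i \<le> j" "j \<le> n"
  shows "concat (map (fibre \<alpha> i j) [0..<level \<alpha> j]) = [0..<level \<alpha> i]"
proof -
  have "filter (\<lambda>b. lmap \<alpha> i j b < level \<alpha> j) [0..<level \<alpha> i] = [0..<level \<alpha> i]"
    using lmap_less[OF assms] by (auto simp: filter_id_conv)
  then show ?thesis
    using filter_monotone_less[of "level \<alpha> i" "lmap \<alpha> i j" "level \<alpha> j"] lmap_mono[OF assms]
    by (simp add: fibre_def[abs_def])
qed

lemma fibre_refl:
  assumes "i \<le> n" "a < level \<alpha> i"
  shows "fibre \<alpha> i i a = [a]"
proof -
  have "fibre \<alpha> i i a = filter (\<lambda>b. b = a) [0..<level \<alpha> i]"
    unfolding fibre_def by (rule filter_cong) (auto simp: lmap_refl assms)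
  also have "\<dots> = [a]"
  proof -
    have "[0..<level \<alpha> i] = [0..<a] @ a # [Suc a..<level \<alpha> i]"
      using assms(2) by (metis less_imp_le_nat upt_add_eq_append upt_conv_Cons le0 le_add_diff_inverse)
    then show ?thesis by (simp add: filter_empty_conv)
  qed
  finally show ?thesis .
qed

text \<open>The composite map is constant on each fibre over level \<open>j\<close>, so filtering
  the partition of level \<open>i\<close> by its value keeps or drops whole fibres.\<close>

lemma fibre_trans:
  assumes "i \<le> j" "j \<le> l" "l \<le> n"
  shows "fibre \<alpha> i l a = concat (map (fibre \<alpha> i j) (fibre \<alpha> j l a))"
proof -
  have conv: "concat (map u (filter p xs)) = concat (map (\<lambda>x. if p x then u x else []) xs)"
    for u :: "nat \<Rightarrow> nat list" and p xs
    by (induction xs) auto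
  have "fibre \<alpha> i l a = filter (\<lambda>b. lmap \<alpha> i l b = a) (concat (map (fibre \<alpha> i j) [0..<level \<alpha> j]))"
    using assms by (simp add: concat_fibre fibre_def[of \<alpha> i l])
  also have "\<dots> = concat (map (\<lambda>c. filter (\<lambda>b. lmap \<alpha> i l b = a) (fibre \<alpha> i j c)) [0..<level \<alpha> j])"
    by (simp add: filter_concat comp_def)
  also have "\<dots> = concat (map (\<lambda>c. if lmap \<alpha> j l c = a then fibre \<alpha> i j c else []) [0..<level \<alpha> j])"
  proof (intro arg_cong[of _ _ concat] map_cong refl)
    fix c
    show "filter (\<lambda>b. lmap \<alpha> i l b = a) (fibre \<alpha> i j c) =
        (if lmap \<alpha> j l c = a then fibre \<alpha> i j c else [])"
      using lmap_trans[OF assms] by (auto simp: filter_id_conv filter_empty_conv set_fibre)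
  qed
  finally show ?thesis
    by (simp add: conv fibre_def[of \<alpha> j l])
qed

lemma wf_tree_collection: "wf_collection (tree_collection n \<alpha>)"
  by (auto simp: wf_collection_def tree_collection_def fibre_def)

lemma gen_comp_in:
  "i \<le> j \<Longrightarrow> j \<le> n \<Longrightarrow> a < level \<alpha> j \<Longrightarrow>
     gen_comp \<alpha> i j a \<in> trees (tree_collection n \<alpha>) \<and>
     root (tree_collection n \<alpha>) (gen_comp \<alpha> i j a) = (j, a) \<and>
     leaves (gen_comp \<alpha> i j a) = map (Pair i) (fibre \<alpha> i j a)"
proof (induction j arbitrary: a)
  case 0
  then show ?case
    by (auto simp: fibre_refl tree_collection_def intro!: trees.leaf)
next
  case (Suc j)
  show ?case
  proof (cases "i \<le> j")
    case True
    have IH: "gen_comp \<alpha> i j b \<in> trees (tree_collection n \<alpha>) \<and>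
        root (tree_collection n \<alpha>) (gen_comp \<alpha> i j b) = (j, b) \<and>
        leaves (gen_comp \<alpha> i j b) = map (Pair i) (fibre \<alpha> i j b)"
      if "b \<in> set (fibre \<alpha> j (Suc j) a)" for b
      using that Suc True by (auto simp: set_fibre)
    have "Node (Suc j, a) (map (gen_comp \<alpha> i j) (fibre \<alpha> j (Suc j) a)) \<in> trees (tree_collection n \<alpha>)"
    proof (rule trees.node)
      show "(Suc j, a) \<in> gens (tree_collection n \<alpha>)"
        using Suc.prems by (simp add: tree_collection_def)
      show "map (root (tree_collection n \<alpha>)) (map (gen_comp \<alpha> i j) (fibre \<alpha> j (Suc j) a)) =
          gsrc (tree_collection n \<alpha>) (Suc j, a)"
        using IH by (simp add: tree_collection_def)
    qed (use IH in auto)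
    moreover have "concat (map (\<lambda>b. leaves (gen_comp \<alpha> i j b)) (fibre \<alpha> j (Suc j) a)) =
        map (Pair i) (fibre \<alpha> i (Suc j) a)"
      using IH fibre_trans[of i j "Suc j" a] True Suc.prems
      by (simp add: map_concat comp_def cong: map_cong)
    ultimately show ?thesis
      using True by (simp add: tree_collection_def comp_def)
  next
    case False
    then have "i = Suc j"
      using Suc.prems by simp
    then show ?thesis
      using Suc.prems by (auto simp: fibre_refl tree_collection_def intro!: trees.leaf)
  qed
qed

lemma gen_comp_refl [simp]: "gen_comp \<alpha> i i a = Leaf (i, a)"
  by (cases i) auto

text \<open>The induction follows \<open>gen_comp\<close>, which peels off the top level;
  \<open>fibre_trans\<close> cuts the flat list of grafted trees into the blocks belonging to the
  subtrees of the top node.\<close>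

lemma graft_gen_comp:
  "i \<le> j \<Longrightarrow> j \<le> l \<Longrightarrow> l \<le> n \<Longrightarrow> a < level \<alpha> l \<Longrightarrow>
     graft (gen_comp \<alpha> j l a) (map (gen_comp \<alpha> i j) (fibre \<alpha> j l a)) = gen_comp \<alpha> i l a"
proof (induction l arbitrary: a)
  case 0
  then show ?case by (simp add: fibre_refl)
next
  case (Suc l)
  show ?case
  proof (cases "j \<le> l")
    case True
    let ?bs = "fibre \<alpha> l (Suc l) a"
    let ?rss = "map (\<lambda>b. map (gen_comp \<alpha> i j) (fibre \<alpha> j l b)) ?bs"
    have bs: "b < level \<alpha> l" if "b \<in> set ?bs" for b
      using that by (simp add: set_fibre)
    have "map (gen_comp \<alpha> i j) (fibre \<alpha> j (Suc l) a) = concat ?rss"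
      using fibre_trans[of j l "Suc l" a] True Suc.prems by (simp add: map_concat comp_def)
    moreover have "graft_list (map (gen_comp \<alpha> j l) ?bs) (concat ?rss) =
        map2 graft (map (gen_comp \<alpha> j l) ?bs) ?rss"
      using gen_comp_in[of j l] True Suc.prems bs by (intro graft_list_concat) simp
    moreover have "map2 graft (map (gen_comp \<alpha> j l) ?bs) ?rss = map (gen_comp \<alpha> i l) ?bs"
      using Suc.IH Suc.prems True bs by (simp add: zip_map_map zip_same_conv_map)
    ultimately show ?thesis
      using True Suc.prems by simp
  next
    case False
    then have "j = Suc l"
      using Suc.prems by simp
    then show ?thesis
      using Suc.prems by (simp add: fibre_refl)
  qed
qed

section \<open>Restriction to the preimages of one element\<close>

lemma level_subtree: "i \<le> n \<Longrightarrow> level (subtree n \<alpha> a) i = length (fibre \<alpha> i n a)"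
  by (simp add: subtree_def level_def)

lemma lmap_subtree:
  assumes "i \<le> j" "j \<le> n" "b < length (fibre \<alpha> i n a)"
  shows "lmap (subtree n \<alpha> a) i j b =
    length (filter (\<lambda>c. c < lmap \<alpha> i j (fibre \<alpha> i n a ! b)) (fibre \<alpha> j n a))"
  unfolding lmap_def[of "subtree n \<alpha> a"] using assms by (simp add: subtree_def intervals_def)

text \<open>Reading positions through \<open>(!)\<close> of the fibre is the inclusion of the
  preimages, and it commutes with the maps of the tree: an element over \<open>a\<close> is sent to
  an element over \<open>a\<close>, which therefore has a position.\<close>

lemma nth_lmap_subtree:
  assumes "i \<le> j" "j \<le> n" "b < length (fibre \<alpha> i n a)"
  shows "lmap (subtree n \<alpha> a) i j b < length (fibre \<alpha> j n a)"
    "fibre \<alpha> j n a ! lmap (subtree n \<alpha> a) i j b = lmap \<alpha> i j (fibre \<alpha> i n a ! b)"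
proof -
  have "lmap \<alpha> i j (fibre \<alpha> i n a ! b) \<in> set (fibre \<alpha> j n a)"
    using assms nth_fibre[OF assms(3)] lmap_less lmap_trans[of i j n] by (auto simp: set_fibre)
  then show "lmap (subtree n \<alpha> a) i j b < length (fibre \<alpha> j n a)"
    "fibre \<alpha> j n a ! lmap (subtree n \<alpha> a) i j b = lmap \<alpha> i j (fibre \<alpha> i n a ! b)"
    using length_filter_less_nth[OF sorted_fibre] lmap_subtree[OF assms] by auto
qed

lemma nth_fibre_inj:
  "b < length (fibre \<alpha> i j a) \<Longrightarrow> c < length (fibre \<alpha> i j a) \<Longrightarrow>
     fibre \<alpha> i j a ! b = fibre \<alpha> i j a ! c \<Longrightarrow> b = c"
  using sorted_fibre[of \<alpha> i j a] by (auto simp: strict_sorted_iff nth_eq_iff_index_eq)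

text \<open>Restricting to the preimages of \<open>a\<close> does not shrink the fibre over an
  element lying over \<open>a\<close>: whatever is sent there lies over \<open>a\<close> as
  well.\<close>

lemma map_nth_fibre_subtree:
  assumes "i \<le> j" "j \<le> n" "b < length (fibre \<alpha> j n a)"
  shows "map ((!) (fibre \<alpha> i n a)) (fibre (subtree n \<alpha> a) i j b) = fibre \<alpha> i j (fibre \<alpha> j n a ! b)"
proof -
  let ?F = "fibre \<alpha> i n a" and ?d = "fibre \<alpha> j n a ! b"
  have "fibre (subtree n \<alpha> a) i j b = filter (\<lambda>c. lmap \<alpha> i j (?F ! c) = ?d) [0..<length ?F]"
  proof -
    have "lmap (subtree n \<alpha> a) i j c = b \<longleftrightarrow> lmap \<alpha> i j (?F ! c) = ?d" if "c < length ?F" for c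
      using nth_lmap_subtree[OF assms(1,2) that] nth_fibre_inj assms(3) by metis
    then have "filter (\<lambda>c. lmap (subtree n \<alpha> a) i j c = b) [0..<length ?F] =
        filter (\<lambda>c. lmap \<alpha> i j (?F ! c) = ?d) [0..<length ?F]"
      by (intro filter_cong) simp_all
    then show ?thesis
      using assms by (simp add: fibre_def[of "subtree n \<alpha> a"] level_subtree)
  qed
  then have "map ((!) ?F) (fibre (subtree n \<alpha> a) i j b) =
      filter (\<lambda>c. lmap \<alpha> i j c = ?d) (map ((!) ?F) [0..<length ?F])"
    by (simp add: filter_map comp_def)
  also have "\<dots> = filter (\<lambda>c. lmap \<alpha> i j c = ?d) ?F"
    by (simp only: map_nth)
  also have "\<dots> = fibre \<alpha> i j ?d"
  proof -
    have "lmap \<alpha> i n c = a" if "c < level \<alpha> i" "lmap \<alpha> i j c = ?d" for c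
      using that lmap_trans[of i j n c] nth_fibre[OF assms(3)] assms by simp
    then show ?thesis
      by (auto simp: fibre_def[of \<alpha> i] intro!: filter_cong)
  qed
  finally show ?thesis .
qed

text \<open>Identities and composites are checked in the ambient levels, since
  \<open>nth_fibre_inj\<close> allows positions to be replaced by elements; monotonicity is that of
  counting smaller elements.\<close>

lemma subtree_in: "subtree n \<alpha> a \<in> simps (nerve Delta_plus) n"
proof -
  let ?F = "\<lambda>i. fibre \<alpha> i n a" and ?s = "subtree n \<alpha> a"
  have s: "fst ?s i = length (?F i)" if "i \<le> n" for i
    using level_subtree[OF that] by (simp add: level_def)
  have arr: "snd ?s (i, j) = (length (?F i), length (?F j), lmap ?s i j)"
    if "i \<le> j" "j \<le> n" for i j
    unfolding lmap_def[of ?s] using that by (simp add: subtree_def intervals_def)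
  have ext: "lmap ?s i j \<in> extensional {..<length (?F i)}" if "i \<le> j" "j \<le> n" for i j
    unfolding lmap_def[of ?s] using that by (simp add: subtree_def intervals_def)
  have mono: "mono_on {..<length (?F i)} (lmap ?s i j)" if ij: "i \<le> j" "j \<le> n" for i j
  proof (rule mono_onI)
    fix b c assume bc: "b \<in> {..<length (?F i)}" "c \<in> {..<length (?F i)}" "b \<le> c"
    then have "?F i ! b \<le> ?F i ! c"
      using sorted_fibre[of \<alpha> i n a] by (auto simp: sorted_wrt_iff_nth_less le_less)
    then have "lmap \<alpha> i j (?F i ! b) \<le> lmap \<alpha> i j (?F i ! c)"
      using lmap_mono[OF ij] nth_fibre(1)[of c] bc by auto
    then have "length (filter (\<lambda>d. d < lmap \<alpha> i j (?F i ! b)) (?F j)) \<le>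
        length (filter (\<lambda>d. d < lmap \<alpha> i j (?F i ! c)) (?F j))"
      by (intro length_filter_mono) simp
    then show "lmap ?s i j b \<le> lmap ?s i j c"
      using bc ij by (simp add: lmap_subtree)
  qed
  have maps: "lmap ?s i j \<in> {..<length (?F i)} \<rightarrow>\<^sub>E {..<length (?F j)}" if ij: "i \<le> j" "j \<le> n" for i j
    using nth_lmap_subtree(1)[OF ij] ext[OF ij] by (auto simp: PiE_iff)
  have id: "lmap ?s i i = (\<lambda>b\<in>{..<length (?F i)}. b)" if "i \<le> n" for i
  proof (rule extensionalityI[OF ext])
    fix b assume "b \<in> {..<length (?F i)}"
    then show "lmap ?s i i b = (\<lambda>b\<in>{..<length (?F i)}. b) b"
      using nth_lmap_subtree[of i i b a] that nth_fibre_inj lmap_refl nth_fibre by auto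
  qed (use that in auto)
  have trans: "lmap ?s i l = compose {..<length (?F i)} (lmap ?s j l) (lmap ?s i j)"
    if ijl: "i \<le> j" "j \<le> l" "l \<le> n" for i j l
  proof (rule extensionalityI[OF ext])
    fix b assume "b \<in> {..<length (?F i)}"
    then have b: "b < length (?F i)" by simp
    have "?F l ! lmap ?s i l b = ?F l ! lmap ?s j l (lmap ?s i j b)"
      using ijl b nth_lmap_subtree[of i j b a] nth_lmap_subtree[of i l b a]
        nth_lmap_subtree[of j l "lmap ?s i j b" a] lmap_trans[OF ijl] nth_fibre[OF b] by simp
    then show "lmap ?s i l b = compose {..<length (?F i)} (lmap ?s j l) (lmap ?s i j) b"
      using ijl b nth_lmap_subtree(1)[of i j b a] nth_lmap_subtree(1)[of i l b a]
        nth_lmap_subtree(1)[of j l "lmap ?s i j b" a] nth_fibre_inj by (auto simp: compose_def)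
  qed (use ijl in auto)
  show ?thesis
    unfolding nerve_iff
  proof (intro conjI allI impI)
    show "fst ?s \<in> {..n} \<rightarrow>\<^sub>E Obj Delta_plus"
      by (simp add: subtree_def Delta_plus_simps)
    show "snd ?s \<in> intervals n \<rightarrow>\<^sub>E Arr Delta_plus"
    proof (rule PiE_I)
      show "snd ?s p \<in> Arr Delta_plus" if "p \<in> intervals n" for p
        using that mono maps by (auto simp: intervals_def arr Delta_plus_simps(1))
      show "snd ?s p = undefined" if "p \<notin> intervals n" for p
        using that by (simp add: subtree_def)
    qed
  next
    fix i j assume "i \<le> j \<and> j \<le> n"
    then show "cdom Delta_plus (snd ?s (i, j)) = fst ?s i" "ccod Delta_plus (snd ?s (i, j)) = fst ?s j"
      by (simp_all add: s arr Delta_plus_simps)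
  next
    fix i assume "i \<le> n"
    then show "snd ?s (i, i) = cid Delta_plus (fst ?s i)"
      by (simp add: s arr id Delta_plus_simps)
  next
    fix i j l assume ijl: "i \<le> j \<and> j \<le> l \<and> l \<le> n"
    then show "snd ?s (i, l) = ccomp Delta_plus (snd ?s (j, l)) (snd ?s (i, j))"
      using trans[of i j l] by (simp add: arr Delta_plus_simps)
  qed
qed

lemma rooted_subtree: "a < level \<alpha> n \<Longrightarrow> rooted n (subtree n \<alpha> a)"
  by (simp add: rooted_def level_subtree fibre_refl)

end

lemma level_act: "i \<le> k \<Longrightarrow> level (act (nerve Delta_plus) k n \<theta> \<alpha>) i = level \<alpha> (\<theta> i)"
  by (simp add: act_nerve level_def)

lemma lmap_act:
  "i \<le> j \<Longrightarrow> j \<le> k \<Longrightarrow> lmap (act (nerve Delta_plus) k n \<theta> \<alpha>) i j = lmap \<alpha> (\<theta> i) (\<theta> j)"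
  by (simp add: act_nerve lmap_def intervals_def)

lemma fibre_act:
  "i \<le> j \<Longrightarrow> j \<le> k \<Longrightarrow> fibre (act (nerve Delta_plus) k n \<theta> \<alpha>) i j a = fibre \<alpha> (\<theta> i) (\<theta> j) a"
  by (simp add: fibre_def level_act lmap_act)

section \<open>Forests as chains in the envelope\<close>

lemma map_tree_in:
  assumes u: "\<And>c. c \<in> gcolours S \<Longrightarrow> u c \<in> gcolours S'"
    and v: "\<And>g. g \<in> gens S \<Longrightarrow>
      v g \<in> gens S' \<and> gsrc S' (v g) = map u (gsrc S g) \<and> gtgt S' (v g) = u (gtgt S g)"
  shows "t \<in> trees S \<Longrightarrow> map_tree u v t \<in> trees S' \<and> root S' (map_tree u v t) = u (root S t)"
proof (induction rule: trees.induct)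
  case (leaf c)
  then show ?case by (simp add: trees.leaf u)
next
  case (node g ts)
  have "map (root S') (map (map_tree u v) ts) = map u (map (root S) ts)"
    using node.IH by simp
  also have "\<dots> = gsrc S' (v g)"
    using node.hyps v by simp
  finally show ?case
    using node.IH v[OF node.hyps(1)] by (auto intro!: trees.node)
qed

lemma free_eval_map_tree:
  "free_eval P f h (map_tree u v t) = free_eval P (\<lambda>c. f (u c)) (\<lambda>g. h (v g)) t"
  by (induction t) (auto simp: comp_def cong: map_cong)

lemma gen_maps_comp:
  assumes x: "(f, g) \<in> operad_morphisms Q P" and uh: "(u, h) \<in> gen_maps S Q"
  shows "(\<lambda>c. f (u c), \<lambda>c. g (h c)) \<in> gen_maps S P"
proof -
  have "f c \<in> colours P" if "c \<in> colours Q" for c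
    using x that by (auto simp: operad_morphisms_def)
  moreover have "g p \<in> ops P" "src P (g p) = map f (src Q p)" "tgt P (g p) = f (tgt Q p)"
    if "p \<in> ops Q" for p
    using x that by (auto simp: operad_morphisms_def)
  ultimately show ?thesis
    using uh by (auto simp: gen_maps_def Pi_iff)
qed

lemma gen_maps_reindex:
  assumes fh: "(f, h) \<in> gen_maps S' P"
    and u: "\<And>c. c \<in> gcolours S \<Longrightarrow> u c \<in> gcolours S'"
    and v: "\<And>g. g \<in> gens S \<Longrightarrow>
      v g \<in> gens S' \<and> gsrc S' (v g) = map u (gsrc S g) \<and> gtgt S' (v g) = u (gtgt S g)"
  shows "(\<lambda>c. f (u c), \<lambda>g. h (v g)) \<in> gen_maps S P"
  using fh u v by (auto simp: gen_maps_def Pi_iff)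

text \<open>With \<open>free_eval_map_tree\<close> this collapses the composite of inclusion,
  \<open>\<lambda>_\<theta>\<close> and labelling to a single evaluation, determined by values on
  generators.\<close>

lemma (in operad) operad_morphism_free_eval_comp:
  assumes x: "(f, g) \<in> operad_morphisms P Q" and uh: "(u, h) \<in> gen_maps S P"
  shows "t \<in> trees S \<Longrightarrow> g (free_eval P u h t) = free_eval Q (\<lambda>c. f (u c)) (\<lambda>c. g (h c)) t"
proof (induction rule: trees.induct)
  case (leaf c)
  then have "u c \<in> colours P"
    using uh by (auto simp: gen_maps_def)
  then show ?case
    using x by (auto simp: operad_morphisms_def)
next
  case (node c ts)
  let ?ev = "free_eval P u h"
  have "map (tgt P) (map ?ev ts) = map u (map (root S) ts)"
    using node.IH free_eval_in[OF uh] by simp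
  also have "\<dots> = src P (h c)"
    using node.hyps uh by (simp add: gen_maps_def)
  finally have "map (tgt P) (map ?ev ts) = src P (h c)" .
  moreover have "map ?ev ts \<in> lists (ops P)"
    using node.IH free_eval_in[OF uh] by auto
  moreover have "h c \<in> ops P"
    using node.hyps uh by (simp add: gen_maps_def)
  ultimately have "g (ocomp P (h c) (map ?ev ts)) = ocomp Q (g (h c)) (map g (map ?ev ts))"
    using x by (simp add: operad_morphisms_def del: in_lists_conv_set map_map)
  then show ?case
    using node.IH by (simp cong: map_cong)
qed

text \<open>Rootedness is dropped because a chain in the envelope may end at a list of any
  length.\<close>

definition forests :: "('c, 'o) operad \<Rightarrow> nat \<Rightarrow> ('c, 'o) list_simplex set" where
  "forests P n = {(\<alpha>, x). \<alpha> \<in> simps (nerve Delta_plus) n \<and> x \<in> operad_morphisms (tree_operad n \<alpha>) P}"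

definition forest_chain :: "nat \<Rightarrow> ('c, 'o) list_simplex \<Rightarrow> ('c list, 'o list) chain" where
  "forest_chain n = (\<lambda>(\<alpha>, f, g).
     (\<lambda>i\<in>{..n}. map (\<lambda>a. f (i, a)) [0..<level \<alpha> i],
      \<lambda>(i, j)\<in>intervals n. map (\<lambda>a. g (gen_comp \<alpha> i j a)) [0..<level \<alpha> j]))"

text \<open>Concatenation is the monoidal product of the envelope, here taken pointwise on
  chains.\<close>

definition chain_concat :: "nat \<Rightarrow> ('c list, 'o list) chain list \<Rightarrow> ('c list, 'o list) chain" where
  "chain_concat n cs =
     (\<lambda>i\<in>{..n}. concat (map (\<lambda>c. fst c i) cs), \<lambda>p\<in>intervals n. concat (map (\<lambda>c. snd c p) cs))"

lemma simps_list_nerve: "simps (list_nerve P) n = {y \<in> forests P n. rooted n (fst y)}"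
  by (auto simp: list_nerve_def forests_def)

lemma chain_eqI:
  assumes "c \<in> simps (nerve C) n" "d \<in> simps (nerve D) n"
    and "\<And>i. i \<le> n \<Longrightarrow> fst c i = fst d i"
    and "\<And>i j. i \<le> j \<Longrightarrow> j \<le> n \<Longrightarrow> snd c (i, j) = snd d (i, j)"
  shows "c = d"
proof (rule prod_eqI)
  have "fst c \<in> extensional {..n}" "fst d \<in> extensional {..n}"
    "snd c \<in> extensional (intervals n)" "snd d \<in> extensional (intervals n)"
    using assms(1,2) unfolding nerve_iff PiE_def by blast+
  then show "fst c = fst d" "snd c = snd d"
    using assms(3,4) by (auto intro!: extensionalityI simp: intervals_def)
qed

section \<open>The chain of one forest\<close>

locale forest = operad P + leveled_tree n \<alpha>
  for P :: "('c, 'o) operad" and n :: nat and \<alpha> :: leveled +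
  fixes f :: "nat \<times> nat \<Rightarrow> 'c" and g :: "ltree \<Rightarrow> 'o"
  assumes morphism: "(f, g) \<in> operad_morphisms (tree_operad n \<alpha>) P"
begin

definition G :: "nat \<Rightarrow> nat \<Rightarrow> nat \<Rightarrow> 'o" where
  "G i j a = g (gen_comp \<alpha> i j a)"

lemma f_in: "i \<le> n \<Longrightarrow> a < level \<alpha> i \<Longrightarrow> f (i, a) \<in> colours P"
  using morphism by (auto simp: operad_morphisms_def tree_operad_def free_operad_def tree_collection_def)

lemma G_in:
  assumes "i \<le> j" "j \<le> n" "a < level \<alpha> j"
  shows "G i j a \<in> ops P" "src P (G i j a) = map (\<lambda>b. f (i, b)) (fibre \<alpha> i j a)"
    "tgt P (G i j a) = f (j, a)"
  using morphism gen_comp_in[OF assms]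
  by (auto simp: operad_morphisms_def tree_operad_def free_operad_def G_def)

lemma G_refl: "i \<le> n \<Longrightarrow> a < level \<alpha> i \<Longrightarrow> G i i a = ounit P (f (i, a))"
  using morphism
  by (auto simp: operad_morphisms_def tree_operad_def free_operad_def tree_collection_def G_def)

lemma G_trans:
  assumes "i \<le> j" "j \<le> l" "l \<le> n" "a < level \<alpha> l"
  shows "G i l a = ocomp P (G j l a) (map (G i j) (fibre \<alpha> j l a))"
proof -
  let ?S = "tree_collection n \<alpha>"
  have t: "gen_comp \<alpha> j l a \<in> trees ?S"
    using gen_comp_in assms by auto
  have b: "gen_comp \<alpha> i j b \<in> trees ?S \<and> root ?S (gen_comp \<alpha> i j b) = (j, b)"
    if "b \<in> set (fibre \<alpha> j l a)" for b
    using that gen_comp_in[of i j b] assms by (auto simp: set_fibre)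
  have "map (gen_comp \<alpha> i j) (fibre \<alpha> j l a) \<in> lists (trees ?S)"
    "map (root ?S) (map (gen_comp \<alpha> i j) (fibre \<alpha> j l a)) = leaves (gen_comp \<alpha> j l a)"
    using b gen_comp_in[of j l a] assms by auto
  then have "g (graft (gen_comp \<alpha> j l a) (map (gen_comp \<alpha> i j) (fibre \<alpha> j l a))) =
      ocomp P (G j l a) (map g (map (gen_comp \<alpha> i j) (fibre \<alpha> j l a)))"
    using morphism t
    by (simp add: operad_morphisms_def tree_operad_def free_operad_def G_def del: map_map in_lists_conv_set)
  then show ?thesis
    using graft_gen_comp[OF assms] by (simp add: G_def[abs_def] comp_def)
qed

text \<open>\<open>concat_fibre\<close> arranges the operations over level \<open>j\<close> into
  blocks, one for each element of level \<open>l\<close>; these are the arguments that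
  \<open>G_trans\<close> asks for.\<close>

lemma lcomp_G:
  assumes "i \<le> j" "j \<le> l" "l \<le> n"
  shows "lcomp P (map (G j l) [0..<level \<alpha> l]) (map (G i j) [0..<level \<alpha> j]) =
    map (G i l) [0..<level \<alpha> l]"
proof -
  let ?rss = "map (\<lambda>a. map (G i j) (fibre \<alpha> j l a)) [0..<level \<alpha> l]"
  have "map (G i j) [0..<level \<alpha> j] = concat ?rss"
    using arg_cong[OF concat_fibre[OF assms(2,3)], of "map (G i j)"] by (simp add: map_concat comp_def)
  moreover have "lcomp P (map (G j l) [0..<level \<alpha> l]) (concat ?rss) =
      map2 (ocomp P) (map (G j l) [0..<level \<alpha> l]) ?rss"
    using assms by (intro lcomp_concat) (simp add: G_in)
  moreover have "\<dots> = map (G i l) [0..<level \<alpha> l]"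
    using assms G_trans by (simp add: zip_map_map zip_same_conv_map)
  ultimately show ?thesis by simp
qed

lemma fst_forest_chain: "i \<le> n \<Longrightarrow> fst (forest_chain n (\<alpha>, f, g)) i = map (\<lambda>a. f (i, a)) [0..<level \<alpha> i]"
  by (simp add: forest_chain_def)

lemma snd_forest_chain:
  "i \<le> j \<Longrightarrow> j \<le> n \<Longrightarrow> snd (forest_chain n (\<alpha>, f, g)) (i, j) = map (G i j) [0..<level \<alpha> j]"
  by (simp add: forest_chain_def intervals_def G_def)

lemma concat_src_G:
  assumes "i \<le> j" "j \<le> n"
  shows "concat (map (src P) (map (G i j) [0..<level \<alpha> j])) = map (\<lambda>a. f (i, a)) [0..<level \<alpha> i]"
proof -
  have "concat (map (src P) (map (G i j) [0..<level \<alpha> j])) =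
      map (\<lambda>a. f (i, a)) (concat (map (fibre \<alpha> i j) [0..<level \<alpha> j]))"
    using assms by (auto simp: map_concat comp_def G_in intro!: arg_cong[of _ _ concat])
  then show ?thesis
    using concat_fibre[OF assms] by simp
qed

lemma forest_chain_in: "forest_chain n (\<alpha>, f, g) \<in> simps (nerve (envelope P)) n"
  unfolding nerve_iff
proof (intro conjI allI impI)
  show "fst (forest_chain n (\<alpha>, f, g)) \<in> {..n} \<rightarrow>\<^sub>E Obj (envelope P)"
    by (auto simp: forest_chain_def envelope_def f_in)
  show "snd (forest_chain n (\<alpha>, f, g)) \<in> intervals n \<rightarrow>\<^sub>E Arr (envelope P)"
  proof (rule PiE_I)
    show "snd (forest_chain n (\<alpha>, f, g)) p \<in> Arr (envelope P)" if "p \<in> intervals n" for p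
      using that by (auto simp: intervals_def snd_forest_chain envelope_def G_in)
    show "snd (forest_chain n (\<alpha>, f, g)) p = undefined" if "p \<notin> intervals n" for p
      using that by (simp add: forest_chain_def)
  qed
next
  fix i j assume "i \<le> j \<and> j \<le> n"
  then show "cdom (envelope P) (snd (forest_chain n (\<alpha>, f, g)) (i, j)) = fst (forest_chain n (\<alpha>, f, g)) i"
    "ccod (envelope P) (snd (forest_chain n (\<alpha>, f, g)) (i, j)) = fst (forest_chain n (\<alpha>, f, g)) j"
    using concat_src_G[of i j]
    by (simp_all add: snd_forest_chain fst_forest_chain envelope_def G_in)
next
  fix i assume "i \<le> n"
  then show "snd (forest_chain n (\<alpha>, f, g)) (i, i) = cid (envelope P) (fst (forest_chain n (\<alpha>, f, g)) i)"
    by (simp add: snd_forest_chain fst_forest_chain envelope_def G_refl)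
next
  fix i j l assume ijl: "i \<le> j \<and> j \<le> l \<and> l \<le> n"
  then show "snd (forest_chain n (\<alpha>, f, g)) (i, l) = ccomp (envelope P)
      (snd (forest_chain n (\<alpha>, f, g)) (j, l)) (snd (forest_chain n (\<alpha>, f, g)) (i, j))"
    using lcomp_G[of i j l] by (simp add: snd_forest_chain envelope_def)
qed

end

lemma forestI:
  "operad P \<Longrightarrow> (\<alpha>, f, g) \<in> forests P n \<Longrightarrow> forest P n \<alpha> f g"
  by (simp add: forest_def forest_axioms_def leveled_tree_def forests_def)

lemma tree_collection_simps [simp]:
  "(i, a) \<in> gcolours (tree_collection n \<alpha>) \<longleftrightarrow> i \<le> n \<and> a < level \<alpha> i"
  "(i, a) \<in> gens (tree_collection n \<alpha>) \<longleftrightarrow> 1 \<le> i \<and> i \<le> n \<and> a < level \<alpha> i"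
  "gsrc (tree_collection n \<alpha>) (i, a) = map (Pair (i - 1)) (fibre \<alpha> (i - 1) i a)"
  "gtgt (tree_collection n \<alpha>) (i, a) = (i, a)"
  by (auto simp: tree_collection_def)

section \<open>Structure maps of the list nerve\<close>

locale forest_pullback = forest +
  fixes k :: nat and \<theta> :: "nat \<Rightarrow> nat"
  assumes \<theta>: "\<theta> \<in> simplex_maps k n"
begin

definition \<beta> :: leveled where
  "\<beta> = act (nerve Delta_plus) k n \<theta> \<alpha>"

sublocale pullback: leveled_tree k \<beta>
  unfolding \<beta>_def by unfold_locales (rule act_nerve_in[OF \<theta> chain])

lemma \<theta>_le: "i \<le> k \<Longrightarrow> \<theta> i \<le> n"
  using \<theta> by (rule simplex_maps_le)

lemma \<theta>_mono: "i \<le> j \<Longrightarrow> j \<le> k \<Longrightarrow> \<theta> i \<le> \<theta> j"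
  using \<theta> by (rule simplex_maps_mono)

lemma level_\<beta>: "i \<le> k \<Longrightarrow> level \<beta> i = level \<alpha> (\<theta> i)"
  unfolding \<beta>_def by (rule level_act)

lemma fibre_\<beta>: "i \<le> j \<Longrightarrow> j \<le> k \<Longrightarrow> fibre \<beta> i j a = fibre \<alpha> (\<theta> i) (\<theta> j) a"
  unfolding \<beta>_def by (rule fibre_act)

definition inclusion :: "nat \<Rightarrow> nat \<times> nat \<Rightarrow> nat \<times> nat" where
  "inclusion a = (\<lambda>(i, b). (i, fibre \<beta> i k a ! b))"

abbreviation (input) \<theta>_colour :: "nat \<times> nat \<Rightarrow> nat \<times> nat" where
  "\<theta>_colour \<equiv> \<lambda>(i, b). (\<theta> i, b)"

abbreviation (input) \<theta>_gen :: "nat \<times> nat \<Rightarrow> ltree" where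
  "\<theta>_gen \<equiv> \<lambda>(i, b). gen_comp \<alpha> (\<theta> (i - 1)) (\<theta> i) b"

text \<open>The component at \<open>a\<close> of the pulled back simplex, on colours: inclusion,
  then \<open>\<lambda>_\<theta>\<close>, then the labelling. \<open>piece_gen\<close> is its value
  on generators.\<close>

definition piece_colour :: "nat \<Rightarrow> nat \<times> nat \<Rightarrow> 'a" where
  "piece_colour a c = f (\<theta>_colour (inclusion a c))"

definition piece_gen :: "nat \<Rightarrow> nat \<times> nat \<Rightarrow> 'b" where
  "piece_gen a c = g (\<theta>_gen (inclusion a c))"

text \<open>A generator of \<open>T_\<beta>\<close> may be sent to a composite in
  \<open>T_\<alpha>\<close> because the leaves of that composite form a fibre of
  \<open>\<alpha>\<close> between levels \<open>\<theta> (i - 1)\<close> and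
  \<open>\<theta> i\<close>, which is a fibre of \<open>\<beta>\<close>.\<close>

lemma \<theta>_gen_maps: "(\<theta>_colour, \<theta>_gen) \<in> gen_maps (tree_collection k \<beta>) (tree_operad n \<alpha>)"
proof -
  have "gen_comp \<alpha> (\<theta> (i - 1)) (\<theta> i) b \<in> trees (tree_collection n \<alpha>) \<and>
      root (tree_collection n \<alpha>) (gen_comp \<alpha> (\<theta> (i - 1)) (\<theta> i) b) = (\<theta> i, b) \<and>
      leaves (gen_comp \<alpha> (\<theta> (i - 1)) (\<theta> i) b) =
        map (Pair (\<theta> (i - 1))) (fibre \<beta> (i - 1) i b)"
    if "1 \<le> i" "i \<le> k" "b < level \<beta> i" for i b
    using that gen_comp_in[of "\<theta> (i - 1)" "\<theta> i" b] \<theta>_mono[of "i - 1" i] \<theta>_le[of i]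
    by (simp add: level_\<beta> fibre_\<beta>)
  then show ?thesis
    by (auto simp: gen_maps_def tree_operad_def free_operad_def level_\<beta> \<theta>_le)
qed

text \<open>The inclusion is a map of collections since \<open>map_nth_fibre_subtree\<close> matches
  the inputs of a generator with those of its image.\<close>

lemma inclusion_maps:
  assumes "a < level \<beta> k"
  shows "c \<in> gcolours (tree_collection k (subtree k \<beta> a)) \<Longrightarrow>
      inclusion a c \<in> gcolours (tree_collection k \<beta>)"
    and "c \<in> gens (tree_collection k (subtree k \<beta> a)) \<Longrightarrow>
      inclusion a c \<in> gens (tree_collection k \<beta>) \<and>
      gsrc (tree_collection k \<beta>) (inclusion a c) =
        map (inclusion a) (gsrc (tree_collection k (subtree k \<beta> a)) c) \<and>
      gtgt (tree_collection k \<beta>) (inclusion a c) =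
        inclusion a (gtgt (tree_collection k (subtree k \<beta> a)) c)"
proof -
  obtain i b where c: "c = (i, b)" by (cases c)
  show "inclusion a c \<in> gcolours (tree_collection k \<beta>)"
    if "c \<in> gcolours (tree_collection k (subtree k \<beta> a))"
    using that nth_fibre(1)[of b \<beta> i k a] by (auto simp: c inclusion_def pullback.level_subtree)
  assume "c \<in> gens (tree_collection k (subtree k \<beta> a))"
  then have i: "1 \<le> i" "i \<le> k" "b < length (fibre \<beta> i k a)"
    by (auto simp: c pullback.level_subtree)
  have "map (inclusion a) (map (Pair (i - 1)) (fibre (subtree k \<beta> a) (i - 1) i b)) =
      map (Pair (i - 1)) (map ((!) (fibre \<beta> (i - 1) k a)) (fibre (subtree k \<beta> a) (i - 1) i b))"
    by (simp add: inclusion_def)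
  also have "\<dots> = map (Pair (i - 1)) (fibre \<beta> (i - 1) i (fibre \<beta> i k a ! b))"
    using i pullback.map_nth_fibre_subtree[of "i - 1" i b a] by simp
  finally have "map (inclusion a) (map (Pair (i - 1)) (fibre (subtree k \<beta> a) (i - 1) i b)) =
      map (Pair (i - 1)) (fibre \<beta> (i - 1) i (fibre \<beta> i k a ! b))" .
  moreover have "inclusion a (i, b) = (i, fibre \<beta> i k a ! b)"
    by (simp add: inclusion_def)
  ultimately show "inclusion a c \<in> gens (tree_collection k \<beta>) \<and>
      gsrc (tree_collection k \<beta>) (inclusion a c) =
        map (inclusion a) (gsrc (tree_collection k (subtree k \<beta> a)) c) \<and>
      gtgt (tree_collection k \<beta>) (inclusion a c) =
        inclusion a (gtgt (tree_collection k (subtree k \<beta> a)) c)"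
    using i nth_fibre(1)[OF i(3)] by (simp add: c del: map_map)
qed

lemma piece_gen_maps:
  assumes "a < level \<beta> k"
  shows "(piece_colour a, piece_gen a) \<in> gen_maps (tree_collection k (subtree k \<beta> a)) P"
  unfolding piece_colour_def[abs_def] piece_gen_def[abs_def]
  using gen_maps_reindex[OF gen_maps_comp[OF morphism \<theta>_gen_maps] inclusion_maps[OF assms]]
  by simp

lemma subtree_leveled: "leveled_tree k (subtree k \<beta> a)"
  by unfold_locales (rule pullback.subtree_in)

definition piece :: "nat \<Rightarrow> ('a, 'b) list_simplex" where
  "piece a = (subtree k \<beta> a,
     free_morphism (tree_collection k (subtree k \<beta> a)) P (piece_colour a) (piece_gen a))"

text \<open>Both sides are extensional, so it suffices to compare them on colours and on well-formed
  trees, where the three maps reduce to one \<open>free_eval\<close>.\<close>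

lemma morphism_comp_eq_piece:
  assumes "a < level \<beta> k"
  shows "(subtree k \<beta> a, morphism_comp (tree_operad k (subtree k \<beta> a)) (f, g)
      (morphism_comp (tree_operad k (subtree k \<beta> a)) (tree_pullback k n \<theta> \<alpha>) (tree_inclusion k \<beta> a))) =
    piece a"
proof -
  let ?S = "tree_collection k (subtree k \<beta> a)" and ?S\<beta> = "tree_collection k \<beta>"
  interpret T: operad "tree_operad n \<alpha>"
    unfolding tree_operad_def by (rule operad_free_operad) (rule wf_tree_collection)
  have "compose (gcolours ?S) f (compose (gcolours ?S) (restrict \<theta>_colour (gcolours ?S\<beta>))
      (restrict (inclusion a) (gcolours ?S))) = restrict (piece_colour a) (gcolours ?S)"
    using inclusion_maps(1)[OF assms] by (fastforce simp: compose_def piece_colour_def)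
  moreover have "g (free_eval (tree_operad n \<alpha>) \<theta>_colour \<theta>_gen
      (map_tree (inclusion a) (inclusion a) t)) = free_eval P (piece_colour a) (piece_gen a) t \<and>
      map_tree (inclusion a) (inclusion a) t \<in> trees ?S\<beta>" if "t \<in> trees ?S" for t
  proof -
    have t: "map_tree (inclusion a) (inclusion a) t \<in> trees ?S\<beta>"
      using map_tree_in[OF inclusion_maps[OF assms] that] by simp
    show ?thesis
      using T.operad_morphism_free_eval_comp[OF morphism \<theta>_gen_maps t] t
      by (simp add: free_eval_map_tree piece_colour_def[abs_def] piece_gen_def[abs_def])
  qed
  then have "compose (trees ?S) g (compose (trees ?S)
      (restrict (free_eval (tree_operad n \<alpha>) \<theta>_colour \<theta>_gen) (trees ?S\<beta>))
      (restrict (map_tree (inclusion a) (inclusion a)) (trees ?S))) =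
    restrict (free_eval P (piece_colour a) (piece_gen a)) (trees ?S)"
    by (auto simp: compose_def)
  ultimately show ?thesis
    by (simp add: morphism_comp_def piece_def tree_pullback_def tree_inclusion_def free_morphism_def
      tree_operad_def[of k] free_operad_def[of ?S] Let_def flip: \<beta>_def inclusion_def)
qed

lemma act_list_nerve: "act (list_nerve P) k n \<theta> (\<alpha>, f, g) = map piece [0..<level \<beta> k]"
  using morphism_comp_eq_piece by (simp add: list_nerve_def Let_def flip: \<beta>_def)

lemma piece_in: "a < level \<beta> k \<Longrightarrow> piece a \<in> simps (list_nerve P) k"
  using free_morphism_in[OF leveled_tree.wf_tree_collection[OF subtree_leveled] piece_gen_maps]
    pullback.subtree_in pullback.rooted_subtree
  by (simp add: simps_list_nerve forests_def piece_def tree_operad_def)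

text \<open>\<open>\<lambda>_\<theta>\<close> preserves composites between levels: by induction on
  \<open>j\<close> the top generator contributes the composite from \<open>\<theta> j\<close> to
  \<open>\<theta> (Suc j)\<close>, and \<open>G_trans\<close> joins it to the rest.\<close>

lemma free_eval_piece:
  "i \<le> j \<Longrightarrow> j \<le> k \<Longrightarrow> a < level \<beta> k \<Longrightarrow> b < length (fibre \<beta> j k a) \<Longrightarrow>
     free_eval P (piece_colour a) (piece_gen a) (gen_comp (subtree k \<beta> a) i j b) =
       G (\<theta> i) (\<theta> j) (fibre \<beta> j k a ! b)"
proof (induction j arbitrary: b)
  case 0
  then show ?case
    using nth_fibre(1)[OF 0(4)] by (simp add: piece_colour_def inclusion_def G_refl level_\<beta> \<theta>_le)
next
  case (Suc j)
  let ?d = "fibre \<beta> (Suc j) k a ! b"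
  have d: "?d < level \<alpha> (\<theta> (Suc j))"
    using nth_fibre(1)[OF Suc.prems(4)] Suc.prems by (simp add: level_\<beta>)
  show ?case
  proof (cases "i \<le> j")
    case True
    have lt: "c < length (fibre \<beta> j k a)" if "c \<in> set (fibre (subtree k \<beta> a) j (Suc j) b)" for c
      using that Suc.prems by (simp add: set_fibre pullback.level_subtree)
    have "map (free_eval P (piece_colour a) (piece_gen a))
          (map (gen_comp (subtree k \<beta> a) i j) (fibre (subtree k \<beta> a) j (Suc j) b)) =
        map (G (\<theta> i) (\<theta> j)) (map ((!) (fibre \<beta> j k a)) (fibre (subtree k \<beta> a) j (Suc j) b))"
      using Suc True lt by simp
    also have "\<dots> = map (G (\<theta> i) (\<theta> j)) (fibre \<alpha> (\<theta> j) (\<theta> (Suc j)) ?d)"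
      using Suc.prems pullback.map_nth_fibre_subtree[of j "Suc j" b a] by (simp add: fibre_\<beta>)
    finally have args: "map (free_eval P (piece_colour a) (piece_gen a))
          (map (gen_comp (subtree k \<beta> a) i j) (fibre (subtree k \<beta> a) j (Suc j) b)) =
        map (G (\<theta> i) (\<theta> j)) (fibre \<alpha> (\<theta> j) (\<theta> (Suc j)) ?d)" .
    have "piece_gen a (Suc j, b) = G (\<theta> j) (\<theta> (Suc j)) ?d"
      by (simp add: piece_gen_def inclusion_def G_def)
    then show ?thesis
      using True args Suc.prems d G_trans[of "\<theta> i" "\<theta> j" "\<theta> (Suc j)" ?d]
      by (simp add: \<theta>_mono \<theta>_le del: map_map)
  next
    case False
    then have "i = Suc j"
      using Suc.prems by simp
    then show ?thesis
      using d Suc.prems by (simp add: piece_colour_def inclusion_def G_refl \<theta>_le)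
  qed
qed

lemma forest_chain_piece:
  assumes "a < level \<beta> k"
  shows "i \<le> k \<Longrightarrow> fst (forest_chain k (piece a)) i = map (\<lambda>b. f (\<theta> i, b)) (fibre \<beta> i k a)"
    and "i \<le> j \<Longrightarrow> j \<le> k \<Longrightarrow>
      snd (forest_chain k (piece a)) (i, j) = map (G (\<theta> i) (\<theta> j)) (fibre \<beta> j k a)"
proof -
  show "fst (forest_chain k (piece a)) i = map (\<lambda>b. f (\<theta> i, b)) (fibre \<beta> i k a)" if "i \<le> k"
    using that
    by (auto intro!: nth_equalityI simp: forest_chain_def piece_def free_morphism_def
      pullback.level_subtree piece_colour_def inclusion_def)
  assume ij: "i \<le> j" "j \<le> k"
  have "gen_comp (subtree k \<beta> a) i j b \<in> trees (tree_collection k (subtree k \<beta> a))"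
    if "b < length (fibre \<beta> j k a)" for b
    using leveled_tree.gen_comp_in[OF subtree_leveled, of i j b] ij that
    by (simp add: pullback.level_subtree)
  then show "snd (forest_chain k (piece a)) (i, j) = map (G (\<theta> i) (\<theta> j)) (fibre \<beta> j k a)"
    using ij assms
    by (auto intro!: nth_equalityI simp: forest_chain_def piece_def free_morphism_def intervals_def
      pullback.level_subtree free_eval_piece)
qed

text \<open>The pieces lie over the elements of the last level of \<open>\<beta>\<close>, and
  \<open>concat_fibre\<close> puts their levels together to those of \<open>\<beta>\<close>. This is
  the naturality of the passage to chains.\<close>

lemma chain_concat_pieces:
  "chain_concat k (map (forest_chain k) (act (list_nerve P) k n \<theta> (\<alpha>, f, g))) =
     act (nerve (envelope P)) k n \<theta> (forest_chain n (\<alpha>, f, g))"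
proof -
  have concat: "concat (map (\<lambda>a. map u (fibre \<beta> i k a)) [0..<level \<beta> k]) = map u [0..<level \<beta> i]"
    if "i \<le> k" for i and u :: "nat \<Rightarrow> 'z"
    using arg_cong[OF pullback.concat_fibre[OF that order.refl], of "map u"]
    by (simp add: map_concat comp_def)
  have "concat (map (\<lambda>a. fst (forest_chain k (piece a)) i) [0..<level \<beta> k]) =
      map (\<lambda>b. f (\<theta> i, b)) [0..<level \<beta> i]" if "i \<le> k" for i
  proof -
    have "map (\<lambda>a. fst (forest_chain k (piece a)) i) [0..<level \<beta> k] =
        map (\<lambda>a. map (\<lambda>b. f (\<theta> i, b)) (fibre \<beta> i k a)) [0..<level \<beta> k]"
      using that by (simp add: forest_chain_piece)
    then show ?thesis by (simp only: concat[OF that])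
  qed
  moreover have "concat (map (\<lambda>a. snd (forest_chain k (piece a)) (i, j)) [0..<level \<beta> k]) =
      map (G (\<theta> i) (\<theta> j)) [0..<level \<beta> j]" if "i \<le> j" "j \<le> k" for i j
  proof -
    have "map (\<lambda>a. snd (forest_chain k (piece a)) (i, j)) [0..<level \<beta> k] =
        map (\<lambda>a. map (G (\<theta> i) (\<theta> j)) (fibre \<beta> j k a)) [0..<level \<beta> k]"
      using that by (simp add: forest_chain_piece)
    then show ?thesis by (simp only: concat[OF that(2)])
  qed
  ultimately show ?thesis
    unfolding act_list_nerve chain_concat_def act_nerve
    by (auto intro!: ext simp: restrict_def comp_def concat fst_forest_chain snd_forest_chain
      \<theta>_le \<theta>_mono level_\<beta> intervals_def)
qed

end

lemma act_list_nerve_in: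
  assumes "operad P" "y \<in> forests P n" "\<theta> \<in> simplex_maps k n"
  shows "act (list_nerve P) k n \<theta> y \<in> lists (simps (list_nerve P) k)"
proof -
  obtain \<alpha> f g where y: "y = (\<alpha>, f, g)" by (cases y)
  interpret forest P n \<alpha> f g
    using assms y by (intro forestI) auto
  interpret forest_pullback P n \<alpha> f g k \<theta>
    using assms(3) by unfold_locales
  show ?thesis
    unfolding y act_list_nerve using piece_in by auto
qed

lemma chain_concat_act:
  assumes "operad P" "y \<in> forests P n" "\<theta> \<in> simplex_maps k n"
  shows "chain_concat k (map (forest_chain k) (act (list_nerve P) k n \<theta> y)) =
    act (nerve (envelope P)) k n \<theta> (forest_chain n y)"
proof -
  obtain \<alpha> f g where y: "y = (\<alpha>, f, g)" by (cases y)
  interpret forest P n \<alpha> f g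
    using assms y by (intro forestI) auto
  interpret forest_pullback P n \<alpha> f g k \<theta>
    using assms(3) by unfold_locales
  show ?thesis
    unfolding y by (rule chain_concat_pieces)
qed

lemma forest_chain_in:
  assumes "operad P" "y \<in> forests P n"
  shows "forest_chain n y \<in> simps (nerve (envelope P)) n"
proof -
  obtain \<alpha> f g where y: "y = (\<alpha>, f, g)" by (cases y)
  interpret forest P n \<alpha> f g
    using assms y by (intro forestI) auto
  show ?thesis
    unfolding y by (rule forest_chain_in)
qed

section \<open>Recovering forests from concatenated chains\<close>

lemma snd_nerve_envelope:
  assumes "c \<in> simps (nerve (envelope P)) n" "i \<le> j" "j \<le> n"
  shows "snd c (i, j) \<in> lists (ops P)" "concat (map (src P) (snd c (i, j))) = fst c i"
    "map (tgt P) (snd c (i, j)) = fst c j" "length (snd c (i, j)) = length (fst c j)"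
proof -
  have "(i, j) \<in> intervals n"
    using assms by (simp add: intervals_def)
  then have "snd c (i, j) \<in> Arr (envelope P)" "cdom (envelope P) (snd c (i, j)) = fst c i"
    "ccod (envelope P) (snd c (i, j)) = fst c j"
    using assms unfolding nerve_iff by blast+
  then show "snd c (i, j) \<in> lists (ops P)" "concat (map (src P) (snd c (i, j))) = fst c i"
    "map (tgt P) (snd c (i, j)) = fst c j"
    by (simp_all add: envelope_def)
  then show "length (snd c (i, j)) = length (fst c j)"
    by (metis length_map)
qed

text \<open>The last vertices have length 1, so their concatenation counts the factors. The rest is
  recovered backwards from there, since an edge is as long as its target and determines its
  source.\<close>

lemma chain_concat_inj:
  assumes cs: "\<And>c. c \<in> set cs \<Longrightarrow> c \<in> simps (nerve (envelope P)) n \<and> length (fst c n) = 1"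
    and ds: "\<And>d. d \<in> set ds \<Longrightarrow> d \<in> simps (nerve (envelope P)) n \<and> length (fst d n) = 1"
    and eq: "chain_concat n cs = chain_concat n ds"
  shows "cs = ds"
proof -
  have fst_eq: "concat (map (\<lambda>c. fst c i) cs) = concat (map (\<lambda>c. fst c i) ds)" if "i \<le> n" for i
    using fun_cong[OF arg_cong[OF eq, of fst], of i] that by (simp add: chain_concat_def)
  have snd_eq: "concat (map (\<lambda>c. snd c (i, j)) cs) = concat (map (\<lambda>c. snd c (i, j)) ds)"
    if "i \<le> j" "j \<le> n" for i j
    using fun_cong[OF arg_cong[OF eq, of snd], of "(i, j)"] that
    by (simp add: chain_concat_def intervals_def)
  have len1: "length (concat (map (\<lambda>c. fst c n) es)) = length es"
    if "\<And>c. c \<in> set es \<Longrightarrow> length (fst c n) = 1" for es :: "('a list, 'b list) chain list"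
    using that by (induction es) auto
  have "length cs = length ds"
    using len1[of cs] len1[of ds] cs ds fst_eq[of n] by simp
  have nth: "cs ! m \<in> simps (nerve (envelope P)) n" "ds ! m \<in> simps (nerve (envelope P)) n"
      "length (fst (cs ! m) n) = length (fst (ds ! m) n)" if "m < length cs" for m
    using cs[of "cs ! m"] ds[of "ds ! m"] that \<open>length cs = length ds\<close> by auto
  \<comment> \<open>Edges into the last vertex are one-letter words, so their concatenation splits
    letter by letter; the sources of these letters are the vertices.\<close>
  have fst_nth: "fst (cs ! m) i = fst (ds ! m) i" if m: "m < length cs" and i: "i \<le> n" for m i
  proof -
    have "map (\<lambda>c. snd c (i, n)) cs = map (\<lambda>c. snd c (i, n)) ds"
    proof (rule concat_injective_map[OF snd_eq[OF i order.refl]])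
      show "length (snd (cs ! m) (i, n)) = length (snd (ds ! m) (i, n))" if "m < length cs" for m
        using nth[OF that] i by (simp add: snd_nerve_envelope)
    qed fact
    then have "snd (cs ! m) (i, n) = snd (ds ! m) (i, n)"
      using m \<open>length cs = length ds\<close> by (metis nth_map)
    then show ?thesis
      using snd_nerve_envelope(2)[OF nth(1) i order.refl] snd_nerve_envelope(2)[OF nth(2) i order.refl] m
      by metis
  qed
  \<comment> \<open>As the vertices agree, the blocks of every edge have equal lengths.\<close>
  have snd_nth: "snd (cs ! m) (i, j) = snd (ds ! m) (i, j)"
    if m: "m < length cs" and ij: "i \<le> j" "j \<le> n" for m i j
  proof -
    have "map (\<lambda>c. snd c (i, j)) cs = map (\<lambda>c. snd c (i, j)) ds"
    proof (rule concat_injective_map[OF snd_eq[OF ij]])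
      show "length (snd (cs ! m) (i, j)) = length (snd (ds ! m) (i, j))" if "m < length cs" for m
        using nth[OF that] ij fst_nth[OF that ij(2)] by (simp add: snd_nerve_envelope)
    qed fact
    then show ?thesis
      using m \<open>length cs = length ds\<close> by (metis nth_map)
  qed
  show ?thesis
  proof (rule nth_equalityI)
    show "cs ! m = ds ! m" if "m < length cs" for m
      using nth(1,2)[OF that] fst_nth[OF that] snd_nth[OF that] by (rule chain_eqI)
  qed fact
qed

text \<open>The levels are the lengths of the vertices, and the fibres are consecutive intervals as
  long as the sources of the operations. The fibres determine the maps of the tree, and the edges
  between adjacent levels determine the morphism.\<close>

lemma forest_chain_inj:
  assumes P: "operad P" and y: "y \<in> forests P n" "y' \<in> forests P n"
    and eq: "forest_chain n y = forest_chain n y'"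
  shows "y = y'"
proof -
  obtain \<alpha> f g \<alpha>' f' g' where yy': "y = (\<alpha>, f, g)" "y' = (\<alpha>', f', g')"
    by (cases y, cases y')
  interpret A: forest P n \<alpha> f g
    using P y yy' by (intro forestI) auto
  interpret B: forest P n \<alpha>' f' g'
    using P y yy' by (intro forestI) auto
  have V: "map (\<lambda>a. f (i, a)) [0..<level \<alpha> i] = map (\<lambda>a. f' (i, a)) [0..<level \<alpha>' i]"
    if "i \<le> n" for i
    using arg_cong[OF eq, of "\<lambda>c. fst c i"] that
    by (simp add: yy' A.fst_forest_chain B.fst_forest_chain)
  have E: "map (A.G i j) [0..<level \<alpha> j] = map (B.G i j) [0..<level \<alpha>' j]"
    if "i \<le> j" "j \<le> n" for i j
    using arg_cong[OF eq, of "\<lambda>c. snd c (i, j)"] that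
    by (simp add: yy' A.snd_forest_chain B.snd_forest_chain)
  have level: "level \<alpha> i = level \<alpha>' i" if "i \<le> n" for i
    using arg_cong[OF V[OF that], of length] by simp
  have f: "f (i, a) = f' (i, a)" if "i \<le> n" "a < level \<alpha> i" for i a
    using V[OF that(1)] that level by simp
  have G: "A.G i j a = B.G i j a" if "i \<le> j" "j \<le> n" "a < level \<alpha> j" for i j a
    using E[OF that(1,2)] that level by simp
  have fibre: "fibre \<alpha> i j a = fibre \<alpha>' i j a" if ij: "i \<le> j" "j \<le> n" and a: "a < level \<alpha> j" for i j a
  proof -
    have "map (fibre \<alpha> i j) [0..<level \<alpha> j] = map (fibre \<alpha>' i j) [0..<level \<alpha> j]"
    proof (rule concat_injective_map)
      show "concat (map (fibre \<alpha> i j) [0..<level \<alpha> j]) = concat (map (fibre \<alpha>' i j) [0..<level \<alpha> j])"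
        using A.concat_fibre[OF ij] B.concat_fibre[OF ij] level ij by simp
      show "length (fibre \<alpha> i j ([0..<level \<alpha> j] ! a)) = length (fibre \<alpha>' i j ([0..<level \<alpha> j] ! a))"
        if "a < length [0..<level \<alpha> j]" for a
        using A.G_in(2)[OF ij, of a] B.G_in(2)[OF ij, of a] G[OF ij, of a] that level ij
        by simp (metis length_map)
    qed simp
    then show ?thesis using a by simp
  qed
  have lmap: "lmap \<alpha> i j b = lmap \<alpha>' i j b" if ij: "i \<le> j" "j \<le> n" and b: "b < level \<alpha> i" for i j b
  proof -
    have "b \<in> set (fibre \<alpha> i j (lmap \<alpha> i j b))"
      using b by (simp add: set_fibre)
    then show ?thesis
      using fibre[OF ij A.lmap_less[OF ij b]] by (simp add: set_fibre)
  qed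
  have "lmap \<alpha> i j = lmap \<alpha>' i j" if ij: "i \<le> j" "j \<le> n" for i j
    using A.arrow(2)[OF ij] B.arrow(2)[OF ij] lmap[OF ij] level[of i] level[of j] ij
    by (intro extensionalityI[of _ "{..<level \<alpha> i}"]) (auto simp: PiE_def)
  then have "\<alpha> = \<alpha>'"
    using level by (intro chain_eqI[OF A.chain B.chain]) (auto simp: A.arrow(1) B.arrow(1) simp flip: level_def)
  moreover have "(f, g) = (f', g')"
  proof (rule operad_morphism_eqI[OF A.wf_tree_collection])
    show "(f, g) \<in> operad_morphisms (free_operad (tree_collection n \<alpha>)) P"
      using A.morphism by (simp add: tree_operad_def)
    show "(f', g') \<in> operad_morphisms (free_operad (tree_collection n \<alpha>)) P"
      using B.morphism \<open>\<alpha> = \<alpha>'\<close> by (simp add: tree_operad_def)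
    show "f c = f' c" if "c \<in> gcolours (tree_collection n \<alpha>)" for c
      using that f by (cases c) simp
    show "g (Node c (map Leaf (gsrc (tree_collection n \<alpha>) c))) =
        g' (Node c (map Leaf (gsrc (tree_collection n \<alpha>) c)))"
      if "c \<in> gens (tree_collection n \<alpha>)" for c
    proof -
      obtain i a where c: "c = (Suc i, a)" "Suc i \<le> n" "a < level \<alpha> (Suc i)"
        using \<open>c \<in> gens (tree_collection n \<alpha>)\<close> by (cases c; cases "fst c") auto
      \<comment> \<open>A corolla is the composite over a single level, so its value occurs in the
        chain.\<close>
      then have "Node c (map Leaf (gsrc (tree_collection n \<alpha>) c)) = gen_comp \<alpha> i (Suc i) a"
        by (simp add: comp_def)
      moreover have "g (gen_comp \<alpha> i (Suc i) a) = g' (gen_comp \<alpha> i (Suc i) a)"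
        using G[of i "Suc i" a] c unfolding A.G_def B.G_def by (simp add: \<open>\<alpha> = \<alpha>'\<close>)
      ultimately show ?thesis by (simp only:)
    qed
  qed
  ultimately show ?thesis
    by (simp add: yy')
qed

section \<open>Building a forest from a chain\<close>

lemma eq_by_lower_bounds:
  "(x :: nat) \<le> m \<Longrightarrow> y \<le> m \<Longrightarrow> (\<And>a. a \<le> m \<Longrightarrow> a \<le> x \<longleftrightarrow> a \<le> y) \<Longrightarrow> x = y"
  by (metis order.refl order.antisym)

text \<open>\<open>block ks\<close> is the monotone map whose fibres are consecutive blocks of sizes \<open>ks\<close>; it is adjoint to
  the partial sums of \<open>ks\<close>.\<close>

fun block :: "nat list \<Rightarrow> nat \<Rightarrow> nat" where
  "block [] b = 0"
| "block (k # ks) b = (if b < k then 0 else Suc (block ks (b - k)))"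

text \<open>\<open>block ks\<close> is right adjoint to the partial sums, and the zeros in
  \<open>ks\<close> that come from nullary operations need no separate treatment. Beyond the total,
  \<open>block ks\<close> takes the value \<open>length ks\<close>, hence the bound on
  \<open>a\<close>.\<close>

lemma le_block_iff: "a \<le> length ks \<Longrightarrow> a \<le> block ks b \<longleftrightarrow> sum_list (take a ks) \<le> b"
proof (induction ks arbitrary: a b)
  case (Cons k ks)
  then show ?case by (cases a) (auto simp: le_diff_conv2)
qed simp

lemma block_le: "block ks b \<le> length ks"
  by (induction ks arbitrary: b) auto

lemma block_less: "b < sum_list ks \<Longrightarrow> block ks b < length ks"
  using le_block_iff[of "length ks" ks b] by simp

lemma block_mono: "b \<le> c \<Longrightarrow> block ks b \<le> block ks c"
  using le_block_iff[of "block ks b" ks b] le_block_iff[of "block ks b" ks c] block_le[of ks b]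
  by simp

lemma filter_block:
  assumes "a < length ks"
  shows "filter (\<lambda>b. block ks b = a) [0..<sum_list ks] =
    [sum_list (take a ks)..<sum_list (take (Suc a) ks)]"
proof -
  have block: "block ks b = a \<longleftrightarrow> sum_list (take a ks) \<le> b \<and> b < sum_list (take (Suc a) ks)" for b
    using le_block_iff[of a ks b] le_block_iff[of "Suc a" ks b] assms by auto
  have "sum_list (take (Suc a) ks) \<le> sum_list ks"
    by (metis append_take_drop_id sum_list_append le_add1)
  then show ?thesis
    by (intro sorted_distinct_set_unique) (auto simp: block sorted_wrt_filter)
qed

lemma map_nth_concat:
  assumes "a < length xss"
  shows "map ((!) (concat xss)) [sum_list (take a (map length xss))..<sum_list (take (Suc a) (map length xss))] =
    xss ! a"
proof -
  have xss: "concat xss = concat (take a xss) @ xss ! a @ concat (drop (Suc a) xss)"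
    using id_take_nth_drop[OF assms] by (metis concat.simps(2) concat_append)
  have sums: "sum_list (take a (map length xss)) = length (concat (take a xss))"
    "sum_list (take (Suc a) (map length xss)) = length (concat (take a xss)) + length (xss ! a)"
    using assms by (simp_all add: length_concat take_map take_Suc_conv_app_nth)
  show ?thesis
    unfolding sums by (rule nth_equalityI) (simp_all add: xss nth_append)
qed

context operad
begin

text \<open>Describes the arguments by an interval of positions, because that interval will be the
  fibre of \<open>shape\<close> over \<open>a\<close>.\<close>

lemma nth_lcomp:
  assumes "map (tgt P) fs = concat (map (src P) gs)" "a < length gs"
  shows "lcomp P gs fs ! a = ocomp P (gs ! a) (map ((!) fs)
    [sum_list (take a (map (\<lambda>g. length (src P g)) gs))..<
     sum_list (take (Suc a) (map (\<lambda>g. length (src P g)) gs))])"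
proof -
  obtain rss where r: "fs = concat rss" "map (map (tgt P)) rss = map (src P) gs"
    using map_eq_concat_conv[OF assms(1)] by blast
  have len: "map length rss = map (\<lambda>g. length (src P g)) gs"
    using arg_cong[OF r(2), of "map length"] by (simp add: comp_def)
  then have "length rss = length gs"
    by (metis length_map)
  then show ?thesis
    using map_nth_concat[of a rss] assms(2) by (simp add: r(1) lcomp_concat len)
qed

text \<open>The first \<open>a\<close> composites consume exactly the operations of
  \<open>fs\<close> that feed the first \<open>a\<close> operations of \<open>gs\<close>. Counting
  inputs on both sides will give the functoriality of partial sums.\<close>

lemma concat_src_take_lcomp:
  assumes "gs \<in> lists (ops P)" "fs \<in> lists (ops P)" "map (tgt P) fs = concat (map (src P) gs)"
    "a \<le> length gs"
  shows "concat (map (src P) (take a (lcomp P gs fs))) =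
    concat (map (src P) (take (length (concat (map (src P) (take a gs)))) fs))"
proof -
  let ?g1 = "take a gs" and ?g2 = "drop a gs"
  have "map (tgt P) fs = concat (map (src P) ?g1) @ concat (map (src P) ?g2)"
    using assms(3) by (metis append_take_drop_id concat_append map_append)
  then obtain f1 f2 where f: "fs = f1 @ f2" "map (tgt P) f1 = concat (map (src P) ?g1)"
    by (auto simp: map_eq_append_conv)
  then have len: "length f1 = length (concat (map (src P) ?g1))"
    by (metis length_map)
  have "take a (lcomp P (?g1 @ ?g2) (f1 @ f2)) = lcomp P ?g1 f1"
    using assms(4) by (simp only: lcomp_append[OF len]) simp
  moreover have "concat (map (src P) (lcomp P ?g1 f1)) = concat (map (src P) f1)"
    using lcomp_in[of ?g1 f1] assms f by (auto dest: in_set_takeD)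
  ultimately show ?thesis
    using f(1) len by simp
qed

end

locale envelope_chain = operad P for P :: "('c, 'o) operad" +
  fixes n :: nat and c :: "('c list, 'o list) chain"
  assumes chain: "c \<in> simps (nerve (envelope P)) n"
begin

definition V :: "nat \<Rightarrow> 'c list" where "V i = fst c i"

definition E :: "nat \<Rightarrow> nat \<Rightarrow> 'o list" where "E i j = snd c (i, j)"

text \<open>The sizes of the fibres of the map from level \<open>i\<close> to level \<open>j\<close>
  that is to be built.\<close>

definition valences :: "nat \<Rightarrow> nat \<Rightarrow> nat list" where
  "valences i j = map (\<lambda>p. length (src P p)) (E i j)"

lemma V_in: "i \<le> n \<Longrightarrow> V i \<in> lists (colours P)"
  using chain unfolding nerve_iff V_def by (auto simp: envelope_def PiE_def Pi_def)

lemma E_facts: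
  assumes "i \<le> j" "j \<le> n"
  shows "E i j \<in> lists (ops P)" "concat (map (src P) (E i j)) = V i"
    "map (tgt P) (E i j) = V j" "length (E i j) = length (V j)"
  using snd_nerve_envelope[OF chain assms] by (simp_all add: E_def V_def)

lemma E_refl: "i \<le> n \<Longrightarrow> E i i = map (ounit P) (V i)"
  using chain unfolding nerve_iff E_def V_def by (simp add: envelope_def)

lemma E_trans: "i \<le> j \<Longrightarrow> j \<le> l \<Longrightarrow> l \<le> n \<Longrightarrow> E i l = lcomp P (E j l) (E i j)"
  using chain unfolding nerve_iff E_def by (metis (no_types, lifting) category.select_convs(6) envelope_def)

lemma length_valences: "i \<le> j \<Longrightarrow> j \<le> n \<Longrightarrow> length (valences i j) = length (V j)"
  by (simp add: valences_def E_facts)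

lemma sum_valences: "i \<le> j \<Longrightarrow> j \<le> n \<Longrightarrow> sum_list (valences i j) = length (V i)"
  using arg_cong[OF E_facts(2), of i j length] by (simp add: valences_def length_concat comp_def)

lemma sum_take_valences: "sum_list (take a (valences i j)) = length (concat (map (src P) (take a (E i j))))"
  by (simp add: valences_def length_concat take_map comp_def)

lemma sum_take_valences_trans:
  assumes "i \<le> j" "j \<le> l" "l \<le> n" "a \<le> length (V l)"
  shows "sum_list (take a (valences i l)) =
    sum_list (take (sum_list (take a (valences j l))) (valences i j))"
  unfolding sum_take_valences E_trans[OF assms(1-3)]
  using assms E_facts[of j l] E_facts[of i j] by (subst concat_src_take_lcomp) auto

text \<open>The elements of level \<open>i\<close> are the positions in \<open>V i\<close>. An
  operation takes a block of consecutive positions as its inputs, which dictates the maps.\<close>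

definition shape :: leveled where
  "shape = (\<lambda>i\<in>{..n}. length (V i),
     \<lambda>(i, j)\<in>intervals n. (length (V i), length (V j), \<lambda>b\<in>{..<length (V i)}. block (valences i j) b))"

lemma level_shape: "i \<le> n \<Longrightarrow> level shape i = length (V i)"
  by (simp add: shape_def level_def)

lemma lmap_shape:
  "i \<le> j \<Longrightarrow> j \<le> n \<Longrightarrow> b < length (V i) \<Longrightarrow> lmap shape i j b = block (valences i j) b"
  by (simp add: shape_def lmap_def intervals_def)

lemma fibre_shape:
  assumes "i \<le> j" "j \<le> n" "a < length (V j)"
  shows "fibre shape i j a =
    [sum_list (take a (valences i j))..<sum_list (take (Suc a) (valences i j))]"
proof -
  have "fibre shape i j a = filter (\<lambda>b. block (valences i j) b = a) [0..<length (V i)]"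
    unfolding fibre_def using assms by (auto simp: level_shape lmap_shape intro!: filter_cong)
  then show ?thesis
    using filter_block[of a "valences i j"] assms by (simp add: length_valences sum_valences)
qed

lemma block_valences_less:
  "i \<le> j \<Longrightarrow> j \<le> n \<Longrightarrow> b < length (V i) \<Longrightarrow> block (valences i j) b < length (V j)"
  using block_less[of b "valences i j"] by (simp add: length_valences sum_valences)

text \<open>Units have arity 1, so the partial sums, and with them the adjoint, are the
  identity.\<close>

lemma block_valences_refl:
  assumes "i \<le> n" "b < length (V i)"
  shows "block (valences i i) b = b"
proof (rule eq_by_lower_bounds)
  have "src P (ounit P v) = [v]" if "v \<in> set (V i)" for v
    using that V_in[OF assms(1)] by (auto intro: src_unit)
  then have "valences i i = map (\<lambda>_. 1) (V i)"
    by (simp add: valences_def E_refl assms)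
  then have valences: "valences i i = replicate (length (V i)) 1"
    by (simp add: map_replicate_const)
  show "a \<le> block (valences i i) b \<longleftrightarrow> a \<le> b" if "a \<le> length (V i)" for a
    using that le_block_iff[of a "valences i i" b] by (simp add: valences sum_list_replicate min_def)
  show "block (valences i i) b \<le> length (V i)"
    using block_le[of "valences i i" b] by (simp add: valences)
qed (use assms in simp)

text \<open>Adjoints of composable maps compose: both sides have the same lower bounds, because
  partial sums compose by \<open>sum_take_valences_trans\<close>.\<close>

lemma block_valences_trans:
  assumes "i \<le> j" "j \<le> l" "l \<le> n"
  shows "block (valences i l) b = block (valences j l) (block (valences i j) b)"
proof (rule eq_by_lower_bounds)
  fix a assume a: "a \<le> length (V l)"
  have "sum_list (take a (valences j l)) \<le> length (V j)"
    using sum_valences[OF assms(2,3)] by (metis append_take_drop_id sum_list_append le_add1)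
  then show "a \<le> block (valences i l) b \<longleftrightarrow> a \<le> block (valences j l) (block (valences i j) b)"
    using a assms sum_take_valences_trans[OF assms a] by (simp add: le_block_iff length_valences)
next
  show "block (valences i l) b \<le> length (V l)"
    "block (valences j l) (block (valences i j) b) \<le> length (V l)"
    using block_le[of "valences i l"] block_le[of "valences j l"] assms
    by (simp_all add: length_valences)
qed

lemma shape_in: "shape \<in> simps (nerve Delta_plus) n"
  unfolding nerve_iff
proof (intro conjI allI impI)
  show "fst shape \<in> {..n} \<rightarrow>\<^sub>E Obj Delta_plus"
    by (simp add: shape_def Delta_plus_simps)
  show "snd shape \<in> intervals n \<rightarrow>\<^sub>E Arr Delta_plus"
  proof (rule PiE_I)
    show "snd shape p \<in> Arr Delta_plus" if "p \<in> intervals n" for p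
      using that block_valences_less block_mono
      by (auto simp: shape_def intervals_def Delta_plus_simps mono_on_def)
    show "snd shape p = undefined" if "p \<notin> intervals n" for p
      using that by (simp add: shape_def)
  qed
next
  fix i j assume "i \<le> j \<and> j \<le> n"
  then show "cdom Delta_plus (snd shape (i, j)) = fst shape i"
    "ccod Delta_plus (snd shape (i, j)) = fst shape j"
    by (simp_all add: shape_def intervals_def Delta_plus_simps)
next
  fix i assume "i \<le> n"
  then show "snd shape (i, i) = cid Delta_plus (fst shape i)"
    by (auto simp: shape_def intervals_def Delta_plus_simps block_valences_refl)
next
  fix i j l assume ijl: "i \<le> j \<and> j \<le> l \<and> l \<le> n"
  then show "snd shape (i, l) = ccomp Delta_plus (snd shape (j, l)) (snd shape (i, j))"
    using block_valences_trans[of i j l] block_valences_less[of i j]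
    by (auto simp: shape_def intervals_def Delta_plus_simps compose_def)
qed

sublocale shape: leveled_tree n shape
  by unfold_locales (rule shape_in)

definition colour :: "nat \<times> nat \<Rightarrow> 'c" where "colour = (\<lambda>(i, a). V i ! a)"

definition generator :: "nat \<times> nat \<Rightarrow> 'o" where "generator = (\<lambda>(i, a). E (i - 1) i ! a)"

lemma src_E:
  assumes "i \<le> j" "j \<le> n" "a < length (V j)"
  shows "src P (E i j ! a) = map ((!) (V i)) (fibre shape i j a)"
  using map_nth_concat[of a "map (src P) (E i j)"] E_facts[OF assms(1,2)] fibre_shape[OF assms] assms(3)
  by (simp add: valences_def comp_def)

lemma gen_maps: "(colour, generator) \<in> gen_maps (tree_collection n shape) P"
proof -
  have "V i ! a \<in> colours P" if "i \<le> n" "a < length (V i)" for i a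
    using V_in[OF that(1)] that(2) by auto
  \<comment> \<open>For \<open>i = 0\<close> the truncated subtraction yields the identity edge from
    0 to 0, so level 0 is no exception.\<close>
  moreover have "E (i - 1) i ! a \<in> ops P" "tgt P (E (i - 1) i ! a) = V i ! a"
    if "i \<le> n" "a < length (V i)" for i a
  proof -
    show "E (i - 1) i ! a \<in> ops P"
      using E_facts[of "i - 1" i] that by auto
    have "map (tgt P) (E (i - 1) i) ! a = V i ! a"
      using E_facts(3)[of "i - 1" i] that by simp
    then show "tgt P (E (i - 1) i ! a) = V i ! a"
      using E_facts(4)[of "i - 1" i] that by simp
  qed
  ultimately show ?thesis
    using src_E by (auto simp: gen_maps_def colour_def generator_def level_shape comp_def)
qed

text \<open>Only edges between adjacent levels enter the labelling; longer edges are their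
  composites by \<open>E_trans\<close>, read entry by entry through
  \<open>nth_lcomp\<close>.\<close>

lemma free_eval_gen_comp:
  "i \<le> j \<Longrightarrow> j \<le> n \<Longrightarrow> a < length (V j) \<Longrightarrow>
     free_eval P colour generator (gen_comp shape i j a) = E i j ! a"
proof (induction j arbitrary: a)
  case 0
  then show ?case by (simp add: colour_def E_refl)
next
  case (Suc j)
  show ?case
  proof (cases "i \<le> j")
    case True
    have "b < length (V j)" if "b \<in> set (fibre shape j (Suc j) a)" for b
      using that Suc.prems by (simp add: set_fibre level_shape)
    then have "map (free_eval P colour generator) (map (gen_comp shape i j) (fibre shape j (Suc j) a)) =
        map ((!) (E i j)) (fibre shape j (Suc j) a)"
      using Suc True by simp
    moreover have "E i (Suc j) ! a = ocomp P (E j (Suc j) ! a) (map ((!) (E i j)) (fibre shape j (Suc j) a))"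
      using nth_lcomp[of "E i j" "E j (Suc j)" a] E_facts[of i j] E_facts[of j "Suc j"] True Suc.prems
        E_trans[of i j "Suc j"] fibre_shape[of j "Suc j" a]
      by (simp add: valences_def)
    ultimately show ?thesis
      using True by (simp add: generator_def del: map_map)
  next
    case False
    then have "i = Suc j"
      using Suc.prems by simp
    then show ?thesis
      using Suc.prems by (simp add: colour_def E_refl)
  qed
qed

definition chain_forest :: "('c, 'o) list_simplex" where
  "chain_forest = (shape, free_morphism (tree_collection n shape) P colour generator)"

lemma chain_forest_in: "chain_forest \<in> forests P n"
  using free_morphism_in[OF shape.wf_tree_collection gen_maps] shape_in
  by (simp add: forests_def chain_forest_def tree_operad_def)

lemma forest_chain_chain_forest: "forest_chain n chain_forest = c"
proof (rule chain_eqI[OF forest_chain_in[OF operad_axioms chain_forest_in] chain])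
  show "fst (forest_chain n chain_forest) i = fst c i" if "i \<le> n" for i
    using that
    by (auto intro!: nth_equalityI simp: forest_chain_def chain_forest_def free_morphism_def
      level_shape colour_def simp flip: V_def)
  show "snd (forest_chain n chain_forest) (i, j) = snd c (i, j)" if ij: "i \<le> j" "j \<le> n" for i j
    using ij shape.gen_comp_in[OF ij] E_facts[OF ij]
    by (auto intro!: nth_equalityI simp: forest_chain_def chain_forest_def free_morphism_def
      intervals_def level_shape free_eval_gen_comp simp flip: E_def)
qed

end

lemma forest_chain_surj:
  assumes "operad P" "c \<in> simps (nerve (envelope P)) n"
  shows "\<exists>y\<in>forests P n. forest_chain n y = c"
proof -
  interpret envelope_chain P n c
    using assms by (simp add: envelope_chain_def envelope_chain_axioms_def)
  show ?thesis
    using chain_forest_in forest_chain_chain_forest by blast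
qed

section \<open>Concatenating chains\<close>

lemma simplex_maps_id: "(\<lambda>i\<in>{..n}. i) \<in> simplex_maps n n"
  by (auto simp: simplex_maps_def mono_on_def)

lemma act_nerve_id:
  assumes "c \<in> simps (nerve C) n"
  shows "act (nerve C) n n (\<lambda>i\<in>{..n}. i) c = c"
  using assms simplex_maps_id
  by (intro chain_eqI[OF act_nerve_in[OF simplex_maps_id assms] assms]) (auto simp: act_nerve intervals_def)

lemma lcomp_concat_map:
  assumes "\<And>x. x \<in> set xs \<Longrightarrow> length (v x) = length (concat (map (src P) (u x)))"
  shows "lcomp P (concat (map u xs)) (concat (map v xs)) = concat (map (\<lambda>x. lcomp P (u x) (v x)) xs)"
  using assms by (induction xs) (auto simp: lcomp_append)

text \<open>Concatenation is a functor on the envelope, its compatibility with composition being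
  \<open>lcomp_concat_map\<close>, so it may be applied pointwise to chains.\<close>

lemma chain_concat_in:
  assumes cs: "\<And>c. c \<in> set cs \<Longrightarrow> c \<in> simps (nerve (envelope P)) n"
  shows "chain_concat n cs \<in> simps (nerve (envelope P)) n"
  unfolding nerve_iff
proof (intro conjI allI impI)
  have "set (fst c i) \<subseteq> colours P" if "c \<in> set cs" "i \<le> n" for c i
    using cs[OF that(1)] that(2) unfolding nerve_iff by (auto simp: envelope_def PiE_def Pi_def)
  then show "fst (chain_concat n cs) \<in> {..n} \<rightarrow>\<^sub>E Obj (envelope P)"
    by (force simp: chain_concat_def envelope_def)
  show "snd (chain_concat n cs) \<in> intervals n \<rightarrow>\<^sub>E Arr (envelope P)"
  proof (rule PiE_I)
    show "snd (chain_concat n cs) p \<in> Arr (envelope P)" if "p \<in> intervals n" for p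
      using that snd_nerve_envelope(1)[OF cs]
      by (fastforce simp: chain_concat_def envelope_def intervals_def)
    show "snd (chain_concat n cs) p = undefined" if "p \<notin> intervals n" for p
      using that by (simp add: chain_concat_def)
  qed
next
  fix i j assume ij: "i \<le> j \<and> j \<le> n"
  then have "map (\<lambda>c. concat (map (src P) (snd c (i, j)))) cs = map (\<lambda>c. fst c i) cs"
    "map (\<lambda>c. map (tgt P) (snd c (i, j))) cs = map (\<lambda>c. fst c j) cs"
    using snd_nerve_envelope[OF cs] by auto
  moreover have "concat (concat (map u xs)) = concat (map (\<lambda>x. concat (u x)) xs)"
    for u :: "('a list, 'b list) chain \<Rightarrow> 'a list list" and xs
    by (induction xs) auto
  ultimately show "cdom (envelope P) (snd (chain_concat n cs) (i, j)) = fst (chain_concat n cs) i"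
    "ccod (envelope P) (snd (chain_concat n cs) (i, j)) = fst (chain_concat n cs) j"
    using ij by (simp_all add: chain_concat_def envelope_def intervals_def map_concat comp_def del: map_eq_conv)
next
  fix i assume i: "i \<le> n"
  then have "map (\<lambda>c. snd c (i, i)) cs = map (\<lambda>c. map (ounit P) (fst c i)) cs"
    using cs unfolding nerve_iff by (auto simp: envelope_def)
  then show "snd (chain_concat n cs) (i, i) = cid (envelope P) (fst (chain_concat n cs) i)"
    using i by (simp add: chain_concat_def envelope_def intervals_def map_concat comp_def del: map_eq_conv)
next
  fix i j l assume ijl: "i \<le> j \<and> j \<le> l \<and> l \<le> n"
  have "snd c (i, l) = lcomp P (snd c (j, l)) (snd c (i, j))" if "c \<in> set cs" for c
  proof -
    have "snd c (i, l) = ccomp (envelope P) (snd c (j, l)) (snd c (i, j))"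
      using cs[OF that] ijl unfolding nerve_iff by blast
    then show ?thesis by (simp add: envelope_def)
  qed
  then have "map (\<lambda>c. snd c (i, l)) cs = map (\<lambda>c. lcomp P (snd c (j, l)) (snd c (i, j))) cs"
    by simp
  moreover have "lcomp P (concat (map (\<lambda>c. snd c (j, l)) cs)) (concat (map (\<lambda>c. snd c (i, j)) cs)) =
      concat (map (\<lambda>c. lcomp P (snd c (j, l)) (snd c (i, j))) cs)"
    using ijl snd_nerve_envelope[OF cs] by (intro lcomp_concat_map) simp
  ultimately show "snd (chain_concat n cs) (i, l) = ccomp (envelope P)
      (snd (chain_concat n cs) (j, l)) (snd (chain_concat n cs) (i, j))"
    using ijl by (simp add: chain_concat_def envelope_def intervals_def del: map_eq_conv)
qed

lemma length_root_forest_chain: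
  "length (fst (forest_chain n y) n) = level (fst y) n"
  by (simp add: forest_chain_def split: prod.splits)

text \<open>The criterion by which lists of simplices of the list nerve are shown to be equal:
  rootedness makes the factors separable, and each factor determines its simplex.\<close>

lemma chain_concat_forest_chain_inj:
  assumes P: "operad P"
    and ys: "ys \<in> lists (simps (list_nerve P) n)" "zs \<in> lists (simps (list_nerve P) n)"
    and eq: "chain_concat n (map (forest_chain n) ys) = chain_concat n (map (forest_chain n) zs)"
  shows "ys = zs"
proof -
  have "c \<in> simps (nerve (envelope P)) n \<and> length (fst c n) = 1"
    if "c \<in> set (map (forest_chain n) us)" "us \<in> lists (simps (list_nerve P) n)" for c us
    using that forest_chain_in[OF P]
    by (auto simp: simps_list_nerve rooted_def length_root_forest_chain)
  then have "map (forest_chain n) ys = map (forest_chain n) zs"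
    using ys eq by (intro chain_concat_inj) blast+
  moreover have "inj_on (forest_chain n) (set ys \<union> set zs)"
  proof (rule inj_onI)
    fix y z assume "y \<in> set ys \<union> set zs" "z \<in> set ys \<union> set zs"
    then have "y \<in> forests P n" "z \<in> forests P n"
      using ys by (auto simp: simps_list_nerve)
    then show "forest_chain n y = forest_chain n z \<Longrightarrow> y = z"
      by (rule forest_chain_inj[OF P])
  qed
  ultimately show ?thesis
    by (rule map_inj_on)
qed

text \<open>Surjectivity: the identity of \<open>[n]\<close> acts on a leveled forest by cutting it into its
  rooted components.\<close>

lemma bij_betw_chain_concat:
  assumes P: "operad P"
  shows "bij_betw (\<lambda>ys. chain_concat n (map (forest_chain n) ys))
    (lists (simps (list_nerve P) n)) (simps (nerve (envelope P)) n)"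
proof (rule bij_betw_imageI)
  show "inj_on (\<lambda>ys. chain_concat n (map (forest_chain n) ys)) (lists (simps (list_nerve P) n))"
    by (rule inj_onI) (rule chain_concat_forest_chain_inj[OF P])
  have "chain_concat n (map (forest_chain n) ys) \<in> simps (nerve (envelope P)) n"
    if "ys \<in> lists (simps (list_nerve P) n)" for ys
    using that forest_chain_in[OF P] by (intro chain_concat_in) (auto simp: simps_list_nerve)
  moreover have "c \<in> (\<lambda>ys. chain_concat n (map (forest_chain n) ys)) ` lists (simps (list_nerve P) n)"
    if c: "c \<in> simps (nerve (envelope P)) n" for c
  proof -
    obtain y where y: "y \<in> forests P n" "forest_chain n y = c"
      using forest_chain_surj[OF P c] by blast
    show ?thesis
    proof (rule image_eqI)
      show "c = chain_concat n (map (forest_chain n) (act (list_nerve P) n n (\<lambda>i\<in>{..n}. i) y))"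
        using chain_concat_act[OF P y(1) simplex_maps_id] act_nerve_id[OF c] y(2) by simp
    qed (rule act_list_nerve_in[OF P y(1) simplex_maps_id])
  qed
  ultimately show "(\<lambda>ys. chain_concat n (map (forest_chain n) ys)) ` lists (simps (list_nerve P) n) =
      simps (nerve (envelope P)) n"
    by blast
qed

section \<open>Categories recovered from a nerve\<close>

definition map_chain :: "nat \<Rightarrow> ('c \<Rightarrow> 'e) \<Rightarrow> ('d \<Rightarrow> 'f) \<Rightarrow> ('c, 'd) chain \<Rightarrow> ('e, 'f) chain" where
  "map_chain n F0 F1 c = (\<lambda>i\<in>{..n}. F0 (fst c i), \<lambda>p\<in>intervals n. F1 (snd c p))"

definition is_functor ::
    "('c, 'd) category \<Rightarrow> ('e, 'f) category \<Rightarrow> ('c \<Rightarrow> 'e) \<Rightarrow> ('d \<Rightarrow> 'f) \<Rightarrow> bool" where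
  "is_functor C D F0 F1 \<longleftrightarrow>
     (\<forall>a\<in>Obj C. F0 a \<in> Obj D) \<and>
     (\<forall>f\<in>Arr C. F1 f \<in> Arr D \<and> cdom D (F1 f) = F0 (cdom C f) \<and> ccod D (F1 f) = F0 (ccod C f)) \<and>
     (\<forall>a\<in>Obj C. F1 (cid C a) = cid D (F0 a)) \<and>
     (\<forall>f\<in>Arr C. \<forall>g\<in>Arr C. cdom C g = ccod C f \<longrightarrow> F1 (ccomp C g f) = ccomp D (F1 g) (F1 f))"

lemma nerve_facts:
  assumes "c \<in> simps (nerve C) n"
  shows "fst c \<in> extensional {..n}" "snd c \<in> extensional (intervals n)"
    "i \<le> n \<Longrightarrow> fst c i \<in> Obj C"
    "i \<le> j \<Longrightarrow> j \<le> n \<Longrightarrow> snd c (i, j) \<in> Arr C"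
    "i \<le> j \<Longrightarrow> j \<le> n \<Longrightarrow> cdom C (snd c (i, j)) = fst c i"
    "i \<le> j \<Longrightarrow> j \<le> n \<Longrightarrow> ccod C (snd c (i, j)) = fst c j"
    "i \<le> n \<Longrightarrow> snd c (i, i) = cid C (fst c i)"
    "i \<le> j \<Longrightarrow> j \<le> l \<Longrightarrow> l \<le> n \<Longrightarrow> snd c (i, l) = ccomp C (snd c (j, l)) (snd c (i, j))"
  using assms unfolding nerve_iff PiE_def Pi_def intervals_def by blast+

lemma nerveI:
  assumes "fst c \<in> extensional {..n}" "snd c \<in> extensional (intervals n)"
    "\<And>i. i \<le> n \<Longrightarrow> fst c i \<in> Obj C"
    "\<And>i j. i \<le> j \<Longrightarrow> j \<le> n \<Longrightarrow> snd c (i, j) \<in> Arr C \<and>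
       cdom C (snd c (i, j)) = fst c i \<and> ccod C (snd c (i, j)) = fst c j"
    "\<And>i. i \<le> n \<Longrightarrow> snd c (i, i) = cid C (fst c i)"
    "\<And>i j l. i \<le> j \<Longrightarrow> j \<le> l \<Longrightarrow> l \<le> n \<Longrightarrow> snd c (i, l) = ccomp C (snd c (j, l)) (snd c (i, j))"
  shows "c \<in> simps (nerve C) n"
  unfolding nerve_iff
proof (intro conjI allI impI)
  show "fst c \<in> {..n} \<rightarrow>\<^sub>E Obj C"
    using assms(1,3) by (simp add: PiE_iff)
  show "snd c \<in> intervals n \<rightarrow>\<^sub>E Arr C"
    using assms(2,4) by (auto simp: PiE_iff intervals_def)
qed (use assms(4-6) in blast)+

lemma map_chain_in:
  assumes F: "is_functor C D F0 F1" and c: "c \<in> simps (nerve C) n"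
  shows "map_chain n F0 F1 c \<in> simps (nerve D) n"
proof (rule nerveI)
  fix i j l assume "i \<le> j" "j \<le> l" "l \<le> n"
  moreover from this have "F1 (ccomp C (snd c (j, l)) (snd c (i, j))) =
      ccomp D (F1 (snd c (j, l))) (F1 (snd c (i, j)))"
    using F nerve_facts(4-6)[OF c] unfolding is_functor_def by simp
  ultimately show "snd (map_chain n F0 F1 c) (i, l) =
      ccomp D (snd (map_chain n F0 F1 c) (j, l)) (snd (map_chain n F0 F1 c) (i, j))"
    using nerve_facts(8)[OF c, of i j l] by (simp add: map_chain_def intervals_def)
qed (use F nerve_facts(1-7)[OF c] in \<open>auto simp: map_chain_def is_functor_def intervals_def\<close>)

text \<open>Two records may differ at arguments without meaning, such as composites of
  non-composable arrows; on the carriers the identity is a functor in both directions.\<close>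

lemma simps_nerve_cong:
  assumes C: "category C" and eq: "Obj C = Obj D" "Arr C = Arr D"
    "\<And>f. f \<in> Arr C \<Longrightarrow> cdom C f = cdom D f" "\<And>f. f \<in> Arr C \<Longrightarrow> ccod C f = ccod D f"
    "\<And>a. a \<in> Obj C \<Longrightarrow> cid C a = cid D a"
    "\<And>f g. f \<in> Arr C \<Longrightarrow> g \<in> Arr C \<Longrightarrow> cdom C g = ccod C f \<Longrightarrow> ccomp C g f = ccomp D g f"
  shows "simps (nerve C) n = simps (nerve D) n"
proof (rule set_eqI)
  fix c :: "('a, 'b) chain"
  have id: "map_chain n (\<lambda>a. a) (\<lambda>f. f) c = c" if "c \<in> simps (nerve K) n" for K
    using nerve_facts(1,2)[OF that] by (auto simp: map_chain_def extensional_restrict)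
  have "is_functor C D (\<lambda>a. a) (\<lambda>f. f)" "is_functor D C (\<lambda>a. a) (\<lambda>f. f)"
    using eq by (auto simp: is_functor_def)
  then show "c \<in> simps (nerve C) n \<longleftrightarrow> c \<in> simps (nerve D) n"
    using map_chain_in id by metis
qed

definition chain2 :: "('c, 'd) category \<Rightarrow> 'd \<Rightarrow> 'd \<Rightarrow> ('c, 'd) chain" where
  "chain2 C g f =
     (let ob = (\<lambda>i. if i = 0 then cdom C f else if i = 1 then ccod C f else ccod C g)
      in (restrict ob {..2},
          \<lambda>(i, j)\<in>intervals 2. if i = j then cid C (ob i) else if j = 1 then f
            else if i = 1 then g else ccomp C g f))"

lemma intervals_2_cases:
  assumes "i \<le> j" "j \<le> (2 :: nat)"
  obtains "i = j" "i \<le> 2" | "i = 0" "j = 1" | "i = 1" "j = 2" | "i = 0" "j = 2"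
  using assms by linarith

text \<open>Supplies simplices of the nerve on demand: composable pairs when composition has to be
  read off, and, with identities in place of arrows, single objects and arrows by
  restriction.\<close>

lemma chain2_in:
  assumes C: "category C" and f: "f \<in> Arr C" and g: "g \<in> Arr C" and fg: "cdom C g = ccod C f"
  shows "chain2 C g f \<in> simps (nerve C) 2"
    "snd (chain2 C g f) (0, 1) = f" "snd (chain2 C g f) (1, 2) = g"
    "snd (chain2 C g f) (0, 2) = ccomp C g f"
proof -
  interpret category C by (rule C)
  show arr: "snd (chain2 C g f) (0, 1) = f" "snd (chain2 C g f) (1, 2) = g"
    "snd (chain2 C g f) (0, 2) = ccomp C g f"
    by (simp_all add: chain2_def intervals_def Let_def)
  have ob: "fst (chain2 C g f) 0 = cdom C f" "fst (chain2 C g f) 1 = ccod C f"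
    "fst (chain2 C g f) 2 = ccod C g"
    by (simp_all add: chain2_def Let_def)
  have id: "snd (chain2 C g f) (i, i) = cid C (fst (chain2 C g f) i)" if "i \<le> 2" for i
    using that by (simp add: chain2_def intervals_def Let_def)
  have ob_in: "fst (chain2 C g f) i \<in> Obj C" if "i \<le> 2" for i
    using that f g by (auto simp: chain2_def Let_def dom_in cod_in)
  have typing: "snd (chain2 C g f) (i, j) \<in> Arr C \<and>
       cdom C (snd (chain2 C g f) (i, j)) = fst (chain2 C g f) i \<and>
       ccod C (snd (chain2 C g f) (i, j)) = fst (chain2 C g f) j" if "i \<le> j" "j \<le> 2" for i j
    using that f g fg ob_in
    by (cases rule: intervals_2_cases)
      (auto simp: ob[simplified] arr[simplified] id id_in dom_id cod_id comp_in dom_comp cod_comp)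
  show "chain2 C g f \<in> simps (nerve C) 2"
  proof (rule nerveI[OF _ _ ob_in typing id])
    fix i j l :: nat assume ijl: "i \<le> j" "j \<le> l" "l \<le> 2"
    \<comment> \<open>Only the triple 0, 1, 2 carries the composite; all the others are unit
      laws.\<close>
    consider "i = j" | "j = l" | "i = 0" "j = 1" "l = 2"
      using ijl by linarith
    then show "snd (chain2 C g f) (i, l) = ccomp C (snd (chain2 C g f) (j, l)) (snd (chain2 C g f) (i, j))"
    proof cases
      case 1
      then show ?thesis
        using ijl typing[of j l] id[of j] comp_id_right[of "snd (chain2 C g f) (j, l)"] by simp
    next
      case 2
      then show ?thesis
        using ijl typing[of i j] id[of j] comp_id_left[of "snd (chain2 C g f) (i, j)"] by simp
    next
      case 3
      then show ?thesis using arr by simp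
    qed
  qed (auto simp: chain2_def Let_def)
qed

section \<open>Vertices and edges of a simplex\<close>

definition vertex_map :: "nat \<Rightarrow> nat \<Rightarrow> nat" where
  "vertex_map i = (\<lambda>_\<in>{..0}. i)"

definition edge_map :: "nat \<Rightarrow> nat \<Rightarrow> nat \<Rightarrow> nat" where
  "edge_map i j = (\<lambda>m\<in>{..1}. if m = 0 then i else j)"

lemma vertex_map_in: "i \<le> n \<Longrightarrow> vertex_map i \<in> simplex_maps 0 n"
  by (auto simp: vertex_map_def simplex_maps_def mono_on_def)

lemma edge_map_in: "i \<le> j \<Longrightarrow> j \<le> n \<Longrightarrow> edge_map i j \<in> simplex_maps 1 n"
  by (auto simp: edge_map_def simplex_maps_def mono_on_def)

lemma vertex_map_apply [simp]: "vertex_map i 0 = i"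
  by (simp add: vertex_map_def)

lemma edge_map_apply [simp]: "edge_map i j 0 = i" "edge_map i j 1 = j" "edge_map i j (Suc 0) = j"
  by (simp_all add: edge_map_def)

lemma compose_vertex_map: "compose {..0} \<theta> (vertex_map i) = vertex_map (\<theta> i)"
  by (auto simp: compose_def vertex_map_def)

lemma compose_edge_map: "compose {..1} \<theta> (edge_map i j) = edge_map (\<theta> i) (\<theta> j)"
  by (auto simp: compose_def edge_map_def)

text \<open>The chain has simplices of \<open>Y\<close> itself as objects and arrows, so it involves
  no choice of an isomorphism with a nerve.\<close>

definition vertices_edges :: "'a sset \<Rightarrow> nat \<Rightarrow> 'a \<Rightarrow> ('a, 'a) chain" where
  "vertices_edges Y n y = (\<lambda>i\<in>{..n}. act Y 0 n (vertex_map i) y,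
     \<lambda>(i, j)\<in>intervals n. act Y 1 n (edge_map i j) y)"

section \<open>Isomorphisms and transport along bijections\<close>

lemma sset_morphism_bij_iso:
  assumes "sset_morphism X Y f" "\<And>n. bij_betw (f n) (simps X n) (simps Y n)"
    and closed: "\<And>k n \<theta> x. \<theta> \<in> simplex_maps k n \<Longrightarrow> x \<in> simps X n \<Longrightarrow> act X k n \<theta> x \<in> simps X k"
  shows "sset_iso X Y"
proof -
  define g where "g n = inv_into (simps X n) (f n)" for n
  have g: "g n y \<in> simps X n" "f n (g n y) = y" if "y \<in> simps Y n" for n y
    using assms(2)[of n] that unfolding g_def bij_betw_def
    by (auto simp: inv_into_into f_inv_into_f)
  have gf: "g n (f n x) = x" if "x \<in> simps X n" for n x
    using assms(2)[of n] that unfolding g_def bij_betw_def by (simp add: inv_into_f_f)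
  have "sset_morphism Y X g"
    unfolding sset_morphism_def
  proof (intro conjI allI ballI)
    show "g n \<in> simps Y n \<rightarrow> simps X n" for n
      using g by auto
    fix k n \<theta> y assume \<theta>: "\<theta> \<in> simplex_maps k n" and y: "y \<in> simps Y n"
    have "act Y k n \<theta> (f n (g n y)) = f k (act X k n \<theta> (g n y))"
      using assms(1) \<theta> g(1)[OF y] by (simp add: sset_morphism_def)
    then show "act X k n \<theta> (g n y) = g k (act Y k n \<theta> y)"
      using closed[OF \<theta> g(1)[OF y]] by (simp add: g(2)[OF y] gf)
  qed
  then show ?thesis
    using assms(1) g gf unfolding sset_iso_def by blast
qed

lemma slist_morphism_bij_iso:
  assumes "slist_morphism X Y f" "\<And>n. bij_betw (f n) (simps X n) (simps Y n)"
    and closed: "\<And>k n \<theta> x. \<theta> \<in> simplex_maps k n \<Longrightarrow> x \<in> simps X n \<Longrightarrow>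
      act X k n \<theta> x \<in> lists (simps X k)"
  shows "slist_iso X Y"
proof -
  define g where "g n = inv_into (simps X n) (f n)" for n
  have g: "g n y \<in> simps X n" "f n (g n y) = y" if "y \<in> simps Y n" for n y
    using assms(2)[of n] that unfolding g_def bij_betw_def
    by (auto simp: inv_into_into f_inv_into_f)
  have gf: "g n (f n x) = x" if "x \<in> simps X n" for n x
    using assms(2)[of n] that unfolding g_def bij_betw_def by (simp add: inv_into_f_f)
  have "slist_morphism Y X g"
    unfolding slist_morphism_def
  proof (intro conjI allI ballI)
    show "g n \<in> simps Y n \<rightarrow> simps X n" for n
      using g by auto
    fix k n \<theta> y assume \<theta>: "\<theta> \<in> simplex_maps k n" and y: "y \<in> simps Y n"
    have "act Y k n \<theta> (f n (g n y)) = map (f k) (act X k n \<theta> (g n y))"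
      using assms(1) \<theta> g(1)[OF y] by (simp add: slist_morphism_def)
    moreover have "map (g k) (map (f k) (act X k n \<theta> (g n y))) = act X k n \<theta> (g n y)"
      using closed[OF \<theta> g(1)[OF y]] gf by (auto simp: map_idI)
    ultimately show "act X k n \<theta> (g n y) = map (g k) (act Y k n \<theta> y)"
      by (simp add: g(2)[OF y])
  qed
  then show ?thesis
    using assms(1) g gf unfolding slist_iso_def by blast
qed

lemma sset_iso_bij:
  assumes "sset_iso X Y"
  obtains f where "sset_morphism X Y f" "\<And>n. bij_betw (f n) (simps X n) (simps Y n)"
proof -
  obtain f g where f: "sset_morphism X Y f" and g: "sset_morphism Y X g"
    "\<forall>n. \<forall>x\<in>simps X n. g n (f n x) = x" "\<forall>n. \<forall>y\<in>simps Y n. f n (g n y) = y"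
    using assms by (auto simp: sset_iso_def)
  have "bij_betw (f n) (simps X n) (simps Y n)" for n
    using f g by (intro bij_betw_byWitness[where f' = "g n"]) (auto simp: sset_morphism_def)
  then show thesis using f that by blast
qed

text \<open>Prescribes the carriers: the operad to be built has colours and operations in the type
  of \<open>X\<close>, whereas the given category may live on any types.\<close>

lemma transport_category:
  assumes C: "category C" and F0: "bij_betw F0 A (Obj C)" and F1: "bij_betw F1 B (Arr C)"
  obtains D where "category D" "Obj D = A" "Arr D = B" "is_functor D C F0 F1"
    "is_functor C D (inv_into A F0) (inv_into B F1)"
proof -
  interpret category C by (rule C)
  define G0 where "G0 = inv_into A F0"
  define G1 where "G1 = inv_into B F1"
  have F0': "F0 a \<in> Obj C" "G0 (F0 a) = a" if "a \<in> A" for a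
    using F0 that by (auto simp: G0_def bij_betw_def inv_into_f_f)
  have F1': "F1 f \<in> Arr C" "G1 (F1 f) = f" if "f \<in> B" for f
    using F1 that by (auto simp: G1_def bij_betw_def inv_into_f_f)
  have G0: "G0 a \<in> A" "F0 (G0 a) = a" if "a \<in> Obj C" for a
    using F0 that by (auto simp: G0_def bij_betw_def inv_into_into f_inv_into_f)
  have G1: "G1 f \<in> B" "F1 (G1 f) = f" if "f \<in> Arr C" for f
    using F1 that by (auto simp: G1_def bij_betw_def inv_into_into f_inv_into_f)
  define D where "D = \<lparr>Obj = A, Arr = B, cdom = (\<lambda>f. G0 (cdom C (F1 f))),
    ccod = (\<lambda>f. G0 (ccod C (F1 f))), cid = (\<lambda>a. G1 (cid C (F0 a))),
    ccomp = (\<lambda>g f. G1 (ccomp C (F1 g) (F1 f)))\<rparr>"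
  have G0_eq: "G0 a = G0 b \<longleftrightarrow> a = b" if "a \<in> Obj C" "b \<in> Obj C" for a b
    using that G0(2) by metis
  note rules = F0' F1' G0 G1 G0_eq dom_in cod_in id_in dom_id cod_id comp_in dom_comp cod_comp
    comp_id_left comp_id_right comp_assoc
  show thesis
  proof
    show "category D"
      by unfold_locales (simp_all add: D_def rules)
    show "is_functor D C F0 F1" "is_functor C D (inv_into A F0) (inv_into B F1)"
      unfolding is_functor_def D_def G0_def[symmetric] G1_def[symmetric]
      by (auto simp: rules)
  qed (simp_all add: D_def)
qed

text \<open>In degrees 0 and 1 the given isomorphism identifies simplices with objects and arrows of
  \<open>C\<close>. Transporting \<open>C\<close> along these two bijections turns the isomorphism
  into \<open>vertices_edges\<close> in every degree, because its naturality at the maps out of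
  \<open>[0]\<close> and \<open>[1]\<close> computes vertices and edges.\<close>

lemma canonical_nerve:
  assumes C: "category C" and iso: "sset_iso Y (nerve C)"
    and closed: "\<And>k n \<theta> y. \<theta> \<in> simplex_maps k n \<Longrightarrow> y \<in> simps Y n \<Longrightarrow> act Y k n \<theta> y \<in> simps Y k"
  obtains D where "category D" "Obj D = simps Y 0" "Arr D = simps Y 1"
    "\<And>n. bij_betw (vertices_edges Y n) (simps Y n) (simps (nerve D) n)"
proof -
  interpret category C by (rule C)
  obtain h where h: "sset_morphism Y (nerve C) h"
    "\<And>n. bij_betw (h n) (simps Y n) (simps (nerve C) n)"
    using sset_iso_bij[OF iso] by blast
  have h_act: "act (nerve C) k n \<theta> (h n y) = h k (act Y k n \<theta> y)"
    if "\<theta> \<in> simplex_maps k n" "y \<in> simps Y n" for k n \<theta> y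
    using h(1) that by (simp add: sset_morphism_def)
  have h_in: "h n y \<in> simps (nerve C) n" if "y \<in> simps Y n" for n y
    using h(2) that by (auto simp: bij_betw_def)
  have "bij_betw (\<lambda>c. fst c 0) (simps (nerve C) 0) (Obj C)"
  proof (rule bij_betw_imageI)
    show "inj_on (\<lambda>c. fst c 0) (simps (nerve C) 0)"
    proof (rule inj_onI)
      fix c d assume cd: "c \<in> simps (nerve C) 0" "d \<in> simps (nerve C) 0" and eq: "fst c 0 = fst d 0"
      show "c = d"
        using nerve_facts(7)[OF cd(1), of 0] nerve_facts(7)[OF cd(2), of 0] eq
        by (intro chain_eqI[OF cd]) auto
    qed
    \<comment> \<open>An object is the first vertex of the chain consisting of its identity taken
      twice.\<close>
    have "\<exists>c\<in>simps (nerve C) 0. fst c 0 = a" if a: "a \<in> Obj C" for a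
    proof -
      have c: "chain2 C (cid C a) (cid C a) \<in> simps (nerve C) 2"
        using a by (intro chain2_in(1)[OF C]) (simp_all add: id_in dom_id cod_id)
      show ?thesis
        using act_nerve_in[OF vertex_map_in[of 0 2] c] a
        by (intro bexI[OF _ act_nerve_in[OF vertex_map_in[of 0 2] c]])
          (simp_all add: act_nerve chain2_def Let_def dom_id)
    qed
    then have "Obj C \<subseteq> (\<lambda>c. fst c 0) ` simps (nerve C) 0"
      by (auto simp only: image_iff)
    moreover have "(\<lambda>c. fst c 0) ` simps (nerve C) 0 \<subseteq> Obj C"
      by (intro image_subsetI nerve_facts(3)[of _ C 0 0]) simp_all
    ultimately show "(\<lambda>c. fst c 0) ` simps (nerve C) 0 = Obj C"
      by blast
  qed
  then have F0: "bij_betw (\<lambda>y. fst (h 0 y) 0) (simps Y 0) (Obj C)"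
    using bij_betw_trans[OF h(2)[of 0]] by (simp add: comp_def)
  have "bij_betw (\<lambda>c. snd c (0, 1)) (simps (nerve C) 1) (Arr C)"
  proof (rule bij_betw_imageI)
    show "inj_on (\<lambda>c. snd c (0, 1)) (simps (nerve C) 1)"
    proof (rule inj_onI)
      fix c d assume cd: "c \<in> simps (nerve C) 1" "d \<in> simps (nerve C) 1"
        and eq: "snd c (0, 1) = snd d (0, 1)"
      have ob: "fst c i = fst d i" if "i \<le> 1" for i
      proof (cases "i = 0")
        case True
        then show ?thesis
          using nerve_facts(5)[OF cd(1), of 0 1] nerve_facts(5)[OF cd(2), of 0 1] eq by simp
      next
        case False
        then have "i = 1" using that by simp
        then show ?thesis
          using nerve_facts(6)[OF cd(1), of 0 1] nerve_facts(6)[OF cd(2), of 0 1] eq by simp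
      qed
      show "c = d"
      proof (rule chain_eqI[OF cd ob])
        fix i j :: nat assume "i \<le> j" "j \<le> 1"
        then consider "i = j" "i \<le> 1" | "i = 0" "j = 1" by linarith
        then show "snd c (i, j) = snd d (i, j)"
          using eq nerve_facts(7)[OF cd(1)] nerve_facts(7)[OF cd(2)] ob by cases auto
      qed
    qed
    \<comment> \<open>An arrow is the first edge of the chain that continues it by the identity of
      its codomain.\<close>
    have "\<exists>c\<in>simps (nerve C) 1. snd c (0, 1) = f" if f: "f \<in> Arr C" for f
    proof -
      have f': "cid C (ccod C f) \<in> Arr C" "cdom C (cid C (ccod C f)) = ccod C f"
        using f by (simp_all add: id_in dom_id cod_in)
      have c: "chain2 C (cid C (ccod C f)) f \<in> simps (nerve C) 2"
        "snd (chain2 C (cid C (ccod C f)) f) (0, 1) = f"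
        using chain2_in[OF C f f'] by simp_all
      show ?thesis
        using c(2)
        by (intro bexI[OF _ act_nerve_in[OF edge_map_in[of 0 1 2] c(1)]])
          (simp_all add: act_nerve intervals_def)
    qed
    then have "Arr C \<subseteq> (\<lambda>c. snd c (0, 1)) ` simps (nerve C) 1"
      by (auto simp only: image_iff)
    moreover have "(\<lambda>c. snd c (0, 1)) ` simps (nerve C) 1 \<subseteq> Arr C"
      by (intro image_subsetI nerve_facts(4)[of _ C 1 0 1]) simp_all
    ultimately show "(\<lambda>c. snd c (0, 1)) ` simps (nerve C) 1 = Arr C"
      by blast
  qed
  then have F1: "bij_betw (\<lambda>y. snd (h 1 y) (0, 1)) (simps Y 1) (Arr C)"
    using bij_betw_trans[OF h(2)[of 1]] by (simp add: comp_def)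
  let ?F0 = "\<lambda>y. fst (h 0 y) 0" and ?F1 = "\<lambda>y. snd (h 1 y) (0, 1)"
  let ?G0 = "inv_into (simps Y 0) ?F0" and ?G1 = "inv_into (simps Y 1) ?F1"
  obtain D where D: "category D" "Obj D = simps Y 0" "Arr D = simps Y 1"
    "is_functor D C ?F0 ?F1" "is_functor C D ?G0 ?G1"
    using transport_category[OF C F0 F1] by blast
  have G0: "?G0 (?F0 a) = a" if "a \<in> simps Y 0" for a
    using bij_betw_inv_into_left[OF F0 that] .
  have G1: "?G1 (?F1 f) = f" if "f \<in> simps Y 1" for f
    using bij_betw_inv_into_left[OF F1 that] .
  have FG0: "?F0 (?G0 a) = a" if "a \<in> Obj C" for a
    using bij_betw_inv_into_right[OF F0 that] .
  have FG1: "?F1 (?G1 f) = f" if "f \<in> Arr C" for f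
    using bij_betw_inv_into_right[OF F1 that] .
  have bij: "bij_betw (map_chain n ?G0 ?G1) (simps (nerve C) n) (simps (nerve D) n)" for n
  proof (rule bij_betw_byWitness[where f' = "map_chain n ?F0 ?F1"])
    show "\<forall>c\<in>simps (nerve C) n. map_chain n ?F0 ?F1 (map_chain n ?G0 ?G1 c) = c"
    proof
      fix c assume c: "c \<in> simps (nerve C) n"
      show "map_chain n ?F0 ?F1 (map_chain n ?G0 ?G1 c) = c"
        using map_chain_in[OF D(4) map_chain_in[OF D(5) c]] c
        by (rule chain_eqI) (simp_all add: map_chain_def intervals_def FG0 FG1 nerve_facts(3,4)[OF c] del: One_nat_def)
    qed
    show "\<forall>c\<in>simps (nerve D) n. map_chain n ?G0 ?G1 (map_chain n ?F0 ?F1 c) = c"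
    proof
      fix c assume c: "c \<in> simps (nerve D) n"
      show "map_chain n ?G0 ?G1 (map_chain n ?F0 ?F1 c) = c"
        using map_chain_in[OF D(5) map_chain_in[OF D(4) c]] c
        using nerve_facts(3,4)[OF c]
        by (intro chain_eqI[of _ D n _ D]) (simp_all add: map_chain_def intervals_def G0 G1 D(2,3) del: One_nat_def)
    qed
  qed (use map_chain_in D(4,5) in blast)+
  have eq: "map_chain n ?G0 ?G1 (h n y) = vertices_edges Y n y" if y: "y \<in> simps Y n" for n y
  proof -
    have "?G0 (fst (h n y) i) = act Y 0 n (vertex_map i) y" if "i \<le> n" for i
    proof -
      have "fst (h n y) i = ?F0 (act Y 0 n (vertex_map i) y)"
        using h_act[OF vertex_map_in[OF that] y, symmetric] by (simp add: act_nerve)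
      then show ?thesis
        using G0 closed[OF vertex_map_in[OF that] y] by simp
    qed
    moreover have "?G1 (snd (h n y) (i, j)) = act Y 1 n (edge_map i j) y" if "i \<le> j" "j \<le> n" for i j
    proof -
      have "snd (h n y) (i, j) = ?F1 (act Y 1 n (edge_map i j) y)"
        using h_act[OF edge_map_in[OF that] y, symmetric] by (simp add: act_nerve intervals_def)
      then show ?thesis
        using G1 closed[OF edge_map_in[OF that] y] by simp
    qed
    ultimately show ?thesis
      by (auto simp: map_chain_def vertices_edges_def intervals_def simp del: One_nat_def intro!: restrict_ext)
  qed
  have "bij_betw (vertices_edges Y n) (simps Y n) (simps (nerve D) n)" for n
    by (rule iffD1[OF bij_betw_cong, OF _ bij_betw_trans[OF h(2)[of n] bij[of n]]]) (simp add: eq del: One_nat_def)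
  then show thesis
    using D(1-3) that by blast
qed

section \<open>The operad of an operadic simplicial list\<close>

lemma simps_lists_of [simp]: "simps (lists_of X) n = lists (simps X n)"
  by (simp add: lists_of_def)

lemma act_lists_of: "act (lists_of X) k n \<theta> xs = concat (map (act X k n \<theta>) xs)"
  by (simp add: lists_of_def extend_listing_def)

lemma act_chain_concat:
  assumes "\<theta> \<in> simplex_maps k n"
  shows "act (nerve C) k n \<theta> (chain_concat n cs) = chain_concat k (map (act (nerve C) k n \<theta>) cs)"
  using simplex_maps_le[OF assms] simplex_maps_mono[OF assms]
  by (auto simp: act_nerve chain_concat_def intervals_def comp_def intro!: restrict_ext)

lemma concat_concat_map: "concat (map u (concat (map v xs))) = concat (map (\<lambda>x. concat (map u (v x))) xs)"
  by (induction xs) auto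

lemma chain_concat_concat:
  "chain_concat n (map u (concat (map v xs))) = chain_concat n (map (\<lambda>x. chain_concat n (map u (v x))) xs)"
  by (auto simp: chain_concat_def concat_concat_map comp_def intro!: restrict_ext)

lemma bij_betw_map_lists:
  assumes "bij_betw f A B"
  shows "bij_betw (map f) (lists A) (lists B)"
  using assms by (auto simp: bij_betw_def inj_on_map_lists simp flip: lists_image)

lemma (in simplicial_list) act_lists_of_in:
  "\<theta> \<in> simplex_maps k n \<Longrightarrow> xs \<in> lists (simps X n) \<Longrightarrow>
     act (lists_of X) k n \<theta> xs \<in> lists (simps X k)"
  using act_in by (fastforce simp: act_lists_of)

text \<open>A pulled back simplex has one entry for each element of level \<open>\<theta> k\<close>,
  and for \<open>\<theta> k = n\<close> that level is the root. Morphisms of simplicial lists act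
  entrywise, so they preserve these lengths.\<close>

lemma list_nerve_operadic:
  assumes iso: "slist_iso X (list_nerve P)"
  shows "operadic X"
proof -
  obtain f where f: "slist_morphism X (list_nerve P) f"
    using iso by (auto simp: slist_iso_def)
  show ?thesis
    unfolding operadic_def
  proof (intro allI ballI impI)
    fix k n \<theta> x assume \<theta>: "\<theta> \<in> simplex_maps k n" "\<theta> k = n" and x: "x \<in> simps X n"
    obtain \<alpha> z where y: "f n x = (\<alpha>, z)" by (cases "f n x")
    have "f n x \<in> simps (list_nerve P) n"
      using f x by (auto simp: slist_morphism_def)
    then have "level \<alpha> n = 1"
      by (simp add: y simps_list_nerve rooted_def)
    then have "length (act (list_nerve P) k n \<theta> (f n x)) = 1"
      using \<theta> by (simp add: y list_nerve_def Let_def level_act)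
    moreover have "act (list_nerve P) k n \<theta> (f n x) = map (f k) (act X k n \<theta> x)"
      using f \<theta>(1) x by (simp add: slist_morphism_def)
    ultimately show "length (act X k n \<theta> x) = 1"
      by simp
  qed
qed

text \<open>For a single simplex naturality is \<open>chain_concat_act\<close>; it extends to lists
  because the structure maps on both sides respect concatenation.\<close>

lemma list_nerve_nerve:
  assumes X: "simplicial_list X" and P: "operad P" and iso: "slist_iso X (list_nerve P)"
  shows "sset_iso (lists_of X) (nerve (envelope P))"
proof -
  interpret simplicial_list X by (rule X)
  obtain f g where f: "slist_morphism X (list_nerve P) f" and g: "slist_morphism (list_nerve P) X g"
    "\<forall>n. \<forall>x\<in>simps X n. g n (f n x) = x" "\<forall>n. \<forall>y\<in>simps (list_nerve P) n. f n (g n y) = y"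
    using iso by (auto simp: slist_iso_def)
  have f_in: "f n x \<in> simps (list_nerve P) n" if "x \<in> simps X n" for n x
    using f that by (auto simp: slist_morphism_def)
  have g_in: "g n y \<in> simps X n" if "y \<in> simps (list_nerve P) n" for n y
    using g(1) that by (auto simp: slist_morphism_def)
  have "bij_betw (f n) (simps X n) (simps (list_nerve P) n)" for n
    by (rule bij_betw_byWitness[where f' = "g n"]) (use g(2,3) f_in g_in in blast)+
  then have bij: "bij_betw (\<lambda>xs. chain_concat n (map (forest_chain n) (map (f n) xs)))
      (lists (simps X n)) (simps (nerve (envelope P)) n)" for n
    using bij_betw_trans[OF bij_betw_map_lists bij_betw_chain_concat[OF P]]
    by (fastforce simp: comp_def)
  have "act (nerve (envelope P)) k n \<theta> (chain_concat n (map (forest_chain n) (map (f n) xs))) =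
      chain_concat k (map (forest_chain k) (map (f k) (act (lists_of X) k n \<theta> xs)))"
    if \<theta>: "\<theta> \<in> simplex_maps k n" and xs: "xs \<in> lists (simps X n)" for k n \<theta> xs
  proof -
    have "act (nerve (envelope P)) k n \<theta> (forest_chain n (f n x)) =
        chain_concat k (map (\<lambda>y. forest_chain k (f k y)) (act X k n \<theta> x))" if "x \<in> set xs" for x
    proof -
      have x: "x \<in> simps X n"
        using that xs by auto
      then have "f n x \<in> forests P n"
        using f_in by (simp add: simps_list_nerve)
      moreover have "act (list_nerve P) k n \<theta> (f n x) = map (f k) (act X k n \<theta> x)"
        using f \<theta> x by (simp add: slist_morphism_def)
      ultimately show ?thesis
        using chain_concat_act[OF P _ \<theta>, of "f n x"] by (simp add: comp_def)
    qed
    then have "map (\<lambda>x. act (nerve (envelope P)) k n \<theta> (forest_chain n (f n x))) xs =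
        map (\<lambda>x. chain_concat k (map (\<lambda>y. forest_chain k (f k y)) (act X k n \<theta> x))) xs"
      by simp
    then show ?thesis
      by (simp add: act_chain_concat[OF \<theta>] act_lists_of comp_def chain_concat_concat del: map_eq_conv)
  qed
  then have "sset_morphism (lists_of X) (nerve (envelope P))
      (\<lambda>n xs. chain_concat n (map (forest_chain n) (map (f n) xs)))"
    unfolding sset_morphism_def simps_lists_of using bij_betw_apply[OF bij] by blast
  then show ?thesis
    by (rule sset_morphism_bij_iso) (use bij act_lists_of_in in simp_all)
qed

text \<open>Functoriality on composites of \<open>\<theta>\<close> with maps out of
  \<open>[0]\<close> and \<open>[1]\<close>. It makes the comparison map an isomorphism of
  simplicial sets and not only a bijection in each degree.\<close>

lemma (in simplicial_list) act_vertices_edges: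
  assumes \<theta>: "\<theta> \<in> simplex_maps k n" and xs: "xs \<in> lists (simps X n)"
  shows "act (nerve C) k n \<theta> (vertices_edges (lists_of X) n xs) =
    vertices_edges (lists_of X) k (act (lists_of X) k n \<theta> xs)"
proof -
  have comp: "act (lists_of X) j n (compose {..j} \<theta> \<phi>) xs =
      act (lists_of X) j k \<phi> (act (lists_of X) k n \<theta> xs)" if "\<phi> \<in> simplex_maps j k" for j \<phi>
  proof -
    have "act X j n (compose {..j} \<theta> \<phi>) x = concat (map (act X j k \<phi>) (act X k n \<theta> x))"
      if "x \<in> set xs" for x
      using act_comp[OF \<open>\<phi> \<in> simplex_maps j k\<close> \<theta>] that xs by (auto simp: extend_listing_def)
    then have "map (act X j n (compose {..j} \<theta> \<phi>)) xs =
        map (\<lambda>x. concat (map (act X j k \<phi>) (act X k n \<theta> x))) xs"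
      by simp
    then show ?thesis
      by (simp add: act_lists_of concat_concat_map del: map_eq_conv)
  qed
  have "act (lists_of X) 0 n (vertex_map (\<theta> i)) xs =
      act (lists_of X) 0 k (vertex_map i) (act (lists_of X) k n \<theta> xs)" if "i \<le> k" for i
    using comp[OF vertex_map_in[OF that]] by (simp only: compose_vertex_map)
  moreover have "act (lists_of X) 1 n (edge_map (\<theta> i) (\<theta> j)) xs =
      act (lists_of X) 1 k (edge_map i j) (act (lists_of X) k n \<theta> xs)" if "i \<le> j" "j \<le> k" for i j
    using comp[OF edge_map_in[OF that]] by (simp only: compose_edge_map)
  ultimately show ?thesis
    using simplex_maps_le[OF \<theta>] simplex_maps_mono[OF \<theta>]
    by (auto simp: act_nerve vertices_edges_def intervals_def simp del: One_nat_def
      intro!: restrict_ext)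
qed

locale segal = simplicial_list X for X :: "'a slist" +
  fixes D :: "('a list, 'a list) category"
  assumes category: "category D"
    and Obj: "Obj D = lists (simps X 0)" and Arr: "Arr D = lists (simps X 1)"
    and canonical: "bij_betw (vertices_edges (lists_of X) n) (lists (simps X n)) (simps (nerve D) n)"

lemma (in simplicial_list) canonical_category:
  assumes "category C" "sset_iso (lists_of X) (nerve C)"
  shows "\<exists>D. segal X D \<and> sset_iso (lists_of X) (nerve D)"
proof -
  obtain D where D: "category D" "Obj D = simps (lists_of X) 0" "Arr D = simps (lists_of X) 1"
    "\<And>n. bij_betw (vertices_edges (lists_of X) n) (simps (lists_of X) n) (simps (nerve D) n)"
    using canonical_nerve[OF assms] act_lists_of_in by (metis simps_lists_of)
  from D have "segal X D"
    by (intro segal.intro segal_axioms.intro simplicial_list_axioms) simp_all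
  moreover have "sset_iso (lists_of X) (nerve D)"
  proof (rule sset_morphism_bij_iso[OF _ D(4)])
    show "sset_morphism (lists_of X) (nerve D) (vertices_edges (lists_of X))"
      using D(4) act_vertices_edges
      by (auto simp: sset_morphism_def bij_betw_def simp del: in_lists_conv_set)
  qed (use act_lists_of_in in auto)
  ultimately show ?thesis
    by blast
qed

section \<open>The operad carried by an operadic simplicial list\<close>

locale operadic_segal = segal +
  assumes operadic: "operadic X"
begin

sublocale D: category D by (rule category)

lemma act_eq_singleton:
  assumes "\<theta> \<in> simplex_maps k n" "\<theta> k = n" "x \<in> simps X n"
  shows "act X k n \<theta> x = [hd (act X k n \<theta> x)] \<and> hd (act X k n \<theta> x) \<in> simps X k"
proof -
  have "length (act X k n \<theta> x) = 1"
    using operadic assms unfolding operadic_def by blast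
  then obtain y where "act X k n \<theta> x = [y]"
    by (auto simp: length_Suc_conv)
  then show ?thesis
    using act_in[OF assms(1,3)] by simp
qed

text \<open>The form in which the operadic condition is used. It covers \<open>vertex_map 1\<close>
  from \<open>[0]\<close> to \<open>[1]\<close>, which gives targets, and
  \<open>edge_map 0 0\<close> from \<open>[1]\<close> to \<open>[0]\<close>, which gives identities,
  but not \<open>vertex_map 0\<close> into \<open>[1]\<close>, so sources remain words.\<close>

lemma act_lists_eq_map:
  assumes "\<theta> \<in> simplex_maps k n" "\<theta> k = n" "xs \<in> lists (simps X n)"
  shows "act (lists_of X) k n \<theta> xs = map (\<lambda>x. hd (act X k n \<theta> x)) xs"
  using assms(3)
proof (induction xs)
  case (Cons x xs)
  then show ?case
    using act_eq_singleton[OF assms(1,2), of x] by (simp add: act_lists_of)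
qed (simp add: act_lists_of)

text \<open>A letter is regarded as a one-letter word. On meaningful arguments \<open>hd\<close> is
  taken of words of length 1: for \<open>tgt\<close> and \<open>ounit\<close> by the operadic
  condition, for \<open>ocomp\<close> by \<open>comp_length\<close>.\<close>

definition underlying_operad :: "('a, 'a) operad" where
  "underlying_operad = \<lparr>colours = simps X 0, ops = simps X 1,
     src = act X 0 1 (vertex_map 0), tgt = (\<lambda>p. hd (act X 0 1 (vertex_map 1) p)),
     ounit = (\<lambda>c. hd (act X 1 0 (edge_map 0 0) c)), ocomp = (\<lambda>p qs. hd (ccomp D [p] qs))\<rparr>"

abbreviation P where "P \<equiv> underlying_operad"

lemma P_simps: "colours P = simps X 0" "ops P = simps X 1" "src P = act X 0 1 (vertex_map 0)"
  "tgt P = (\<lambda>p. hd (act X 0 1 (vertex_map 1) p))" "ocomp P p qs = hd (ccomp D [p] qs)"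
  "ounit P = (\<lambda>c. hd (act X 1 0 (edge_map 0 0) c))"
  by (simp_all add: underlying_operad_def)

lemma ve_in: "xs \<in> lists (simps X n) \<Longrightarrow> vertices_edges (lists_of X) n xs \<in> simps (nerve D) n"
  using canonical[of n] by (auto simp: bij_betw_def)

lemma dom_cod:
  assumes "e \<in> lists (simps X 1)"
  shows "cdom D e = concat (map (src P) e)" "ccod D e = map (tgt P) e"
proof -
  \<comment> \<open>This is the identity of \<open>[1]\<close>, so a word of 1-simplices has itself
    as its edge from 0 to 1.\<close>
  have "edge_map 0 1 = (\<lambda>i\<in>{..1}. i)"
    by (auto simp: edge_map_def)
  then have "map (act X 1 1 (edge_map 0 1)) e = map (\<lambda>x. [x]) e"
    using assms act_id[of _ 1] by (auto simp del: One_nat_def)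
  then have "snd (vertices_edges (lists_of X) 1 e) (0, 1) = e"
    by (simp add: vertices_edges_def intervals_def act_lists_of del: map_eq_conv)
  then have "cdom D e = act (lists_of X) 0 1 (vertex_map 0) e"
    "ccod D e = act (lists_of X) 0 1 (vertex_map 1) e"
    using nerve_facts(5,6)[OF ve_in[OF assms], of 0 1] by (simp_all add: vertices_edges_def)
  then show "cdom D e = concat (map (src P) e)" "ccod D e = map (tgt P) e"
    using act_lists_eq_map[OF vertex_map_in[of 1 1] _ assms] by (simp_all add: act_lists_of P_simps)
qed

lemma id_eq:
  assumes "v \<in> lists (simps X 0)"
  shows "cid D v = map (ounit P) v"
proof -
  \<comment> \<open>Likewise in degree 0: a word of colours is its own vertex, and its degeneracy is
    the identity arrow on it.\<close>
  have "vertex_map 0 = (\<lambda>i\<in>{..0}. i)"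
    by (auto simp: vertex_map_def)
  then have "map (act X 0 0 (vertex_map 0)) v = map (\<lambda>x. [x]) v"
    using assms act_id[of _ 0] by auto
  then have "fst (vertices_edges (lists_of X) 0 v) 0 = v"
    by (simp add: vertices_edges_def act_lists_of del: map_eq_conv)
  then have "cid D v = act (lists_of X) 1 0 (edge_map 0 0) v"
    using nerve_facts(7)[OF ve_in[OF assms], of 0] by (simp add: vertices_edges_def intervals_def)
  then show ?thesis
    using act_lists_eq_map[OF edge_map_in[of 0 0 0] _ assms] by (simp add: P_simps)
qed

text \<open>Targets are taken letter by letter, so a word of operations is as long as its target,
  and the composite has the same target as \<open>g\<close>.\<close>

lemma comp_length:
  assumes "f \<in> lists (simps X 1)" "g \<in> lists (simps X 1)" "cdom D g = ccod D f"
  shows "length (ccomp D g f) = length g"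
proof -
  have "map (tgt P) (ccomp D g f) = map (tgt P) g"
    using D.cod_comp[of f g] D.comp_in[of f g] assms dom_cod(2) by (simp add: Arr del: in_lists_conv_set)
  then show ?thesis by (metis length_map)
qed

text \<open>Concatenating two 2-simplices of \<open>\<L>X\<close> concatenates their edges, so composition in \<open>D\<close> is
  compatible with concatenation.\<close>

lemma comp_append:
  assumes "f1 \<in> lists (simps X 1)" "g1 \<in> lists (simps X 1)" "cdom D g1 = ccod D f1"
    and "f2 \<in> lists (simps X 1)" "g2 \<in> lists (simps X 1)" "cdom D g2 = ccod D f2"
  shows "ccomp D (g1 @ g2) (f1 @ f2) = ccomp D g1 f1 @ ccomp D g2 f2"
proof -
  \<comment> \<open>Surjectivity of the comparison map in degree 2: a composable pair and its
    composite are the edges of a word of 2-simplices.\<close>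
  have simplex: "\<exists>s\<in>lists (simps X 2). act (lists_of X) 1 2 (edge_map 0 1) s = f \<and>
      act (lists_of X) 1 2 (edge_map 1 2) s = g \<and>
      act (lists_of X) 1 2 (edge_map 0 2) s = ccomp D g f"
    if "f \<in> lists (simps X 1)" "g \<in> lists (simps X 1)" "cdom D g = ccod D f" for f g
  proof -
    have chain2: "chain2 D g f \<in> simps (nerve D) 2" "snd (chain2 D g f) (0, 1) = f"
      "snd (chain2 D g f) (1, 2) = g" "snd (chain2 D g f) (0, 2) = ccomp D g f"
      using that chain2_in[OF category, of f g]
      by (simp_all add: Arr del: in_lists_conv_set One_nat_def)
    obtain s where s: "s \<in> lists (simps X 2)" "vertices_edges (lists_of X) 2 s = chain2 D g f"
      using canonical[of 2] chain2(1) unfolding bij_betw_def by (metis imageE)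
    have "act (lists_of X) 1 2 (edge_map i j) s = snd (chain2 D g f) (i, j)" if "i \<le> j" "j \<le> 2" for i j
      using that by (simp add: vertices_edges_def intervals_def flip: s(2))
    then show ?thesis
      using chain2(2-4) s(1) by (intro bexI[of _ s]) (simp_all del: One_nat_def)
  qed
  obtain s1 where s1: "s1 \<in> lists (simps X 2)" "act (lists_of X) 1 2 (edge_map 0 1) s1 = f1"
      "act (lists_of X) 1 2 (edge_map 1 2) s1 = g1" "act (lists_of X) 1 2 (edge_map 0 2) s1 = ccomp D g1 f1"
    using simplex[OF assms(1-3)] by blast
  obtain s2 where s2: "s2 \<in> lists (simps X 2)" "act (lists_of X) 1 2 (edge_map 0 1) s2 = f2"
      "act (lists_of X) 1 2 (edge_map 1 2) s2 = g2" "act (lists_of X) 1 2 (edge_map 0 2) s2 = ccomp D g2 f2"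
    using simplex[OF assms(4-6)] by blast
  have "s1 @ s2 \<in> lists (simps X 2)"
    using s1(1) s2(1) by auto
  from nerve_facts(8)[OF ve_in[OF this], of 0 1 2]
  have "act (lists_of X) 1 2 (edge_map 0 2) (s1 @ s2) =
      ccomp D (act (lists_of X) 1 2 (edge_map 1 2) (s1 @ s2)) (act (lists_of X) 1 2 (edge_map 0 1) (s1 @ s2))"
    by (simp add: vertices_edges_def intervals_def)
  moreover have "act (lists_of X) k n \<theta> (s1 @ s2) = act (lists_of X) k n \<theta> s1 @ act (lists_of X) k n \<theta> s2"
    for k n \<theta>
    by (simp add: act_lists_of)
  ultimately show ?thesis
    using s1 s2 by simp
qed

lemma comp_singleton:
  assumes "p \<in> simps X 1" "qs \<in> lists (simps X 1)" "map (tgt P) qs = src P p"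
  shows "ccomp D [p] qs = [ocomp P p qs]"
proof -
  have "cdom D [p] = ccod D qs"
    using assms dom_cod[of "[p]"] dom_cod[of qs] by simp
  then have "length (ccomp D [p] qs) = 1"
    using comp_length[of qs "[p]"] assms by simp
  then obtain r where "ccomp D [p] qs = [r]"
    by (auto simp: length_Suc_conv)
  then show ?thesis
    by (simp add: P_simps(5))
qed

text \<open>\<open>comp_append\<close> splits off the letters of \<open>gs\<close> one at a time
  together with the arguments they take. A single letter is \<open>comp_singleton\<close>, and the
  empty composite has length 0.\<close>

lemma comp_eq_lcomp:
  "gs \<in> lists (simps X 1) \<Longrightarrow> fs \<in> lists (simps X 1) \<Longrightarrow>
     map (tgt P) fs = concat (map (src P) gs) \<Longrightarrow> ccomp D gs fs = lcomp P gs fs"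
proof (induction gs arbitrary: fs)
  case Nil
  then show ?case
    using comp_length[of "[]" "[]"] dom_cod[of "[]"] by simp
next
  case (Cons g gs)
  then obtain f1 f2 where f: "fs = f1 @ f2" "map (tgt P) f1 = src P g"
      "map (tgt P) f2 = concat (map (src P) gs)"
    by (auto simp: map_eq_append_conv)
  have len: "length (src P g) = length f1"
    using f(2) by (metis length_map)
  have in_X: "g \<in> simps X 1" "[g] \<in> lists (simps X 1)" "gs \<in> lists (simps X 1)"
    "f1 \<in> lists (simps X 1)" "f2 \<in> lists (simps X 1)"
    using Cons.prems f(1) by auto
  then have "ccomp D ([g] @ gs) (f1 @ f2) = ccomp D [g] f1 @ ccomp D gs f2"
    using f(2,3) by (intro comp_append) (simp_all add: dom_cod del: in_lists_conv_set)
  then show ?case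
    using Cons.IH[OF in_X(3,5) f(3)] comp_singleton[OF in_X(1,4) f(2)] f(1) len by simp
qed

text \<open>The operad axioms are the axioms of \<open>D\<close> on one-letter words. Associativity
  involves several composites side by side, and \<open>comp_eq_lcomp\<close> recognises these as one
  composite in \<open>D\<close>.\<close>

lemma operad_P: "operad P"
proof
  show "src P p \<in> lists (colours P)" if "p \<in> ops P" for p
    using that act_in[OF vertex_map_in[of 0 1]] by (simp add: P_simps del: in_lists_conv_set)
  show "tgt P p \<in> colours P" if "p \<in> ops P" for p
    using that act_eq_singleton[OF vertex_map_in[of 1 1]] by (simp add: P_simps)
  fix a assume a: "a \<in> colours P"
  then show "ounit P a \<in> ops P"
    using act_eq_singleton[OF edge_map_in[of 0 0 0]] by (simp add: P_simps)
  have v: "[a] \<in> Obj D" "cid D [a] = [ounit P a]"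
    using a id_eq[of "[a]"] by (simp_all add: P_simps Obj)
  then show "src P (ounit P a) = [a]" "tgt P (ounit P a) = a"
    using D.dom_id[OF v(1)] D.cod_id[OF v(1)] D.id_in[OF v(1)] dom_cod[of "[ounit P a]"]
    by (simp_all add: Arr)
next
  fix p assume p: "p \<in> ops P"
  then have "[p] \<in> Arr D"
    by (simp add: Arr P_simps)
  then have "ccomp D [p] (cid D (src P p)) = [p]" "ccomp D (cid D [tgt P p]) [p] = [p]"
    "src P p \<in> lists (simps X 0)" "[tgt P p] \<in> lists (simps X 0)"
    using D.comp_id_right[of "[p]"] D.comp_id_left[of "[p]"] D.dom_in[of "[p]"] D.cod_in[of "[p]"]
      dom_cod[of "[p]"] by (simp_all add: Arr Obj del: in_lists_conv_set)
  then show "ocomp P p (map (ounit P) (src P p)) = p" "ocomp P (ounit P (tgt P p)) [p] = p"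
    using id_eq[of "src P p"] id_eq[of "[tgt P p]"] by (simp_all add: P_simps(5) del: in_lists_conv_set)
next
  fix p qs assume "p \<in> ops P" "qs \<in> lists (ops P)" "map (tgt P) qs = src P p"
  then have pq: "p \<in> simps X 1" "qs \<in> lists (simps X 1)" "map (tgt P) qs = src P p"
    by (simp_all add: P_simps del: in_lists_conv_set)
  have Arr': "[p] \<in> Arr D" "qs \<in> Arr D" "cdom D [p] = ccod D qs"
    using pq dom_cod[of "[p]"] dom_cod[of qs] by (simp_all add: Arr)
  have pq_in: "[ocomp P p qs] \<in> lists (simps X 1)"
    using D.comp_in[OF Arr'(2,1,3)] comp_singleton[OF pq] by (simp add: Arr del: in_lists_conv_set)
  then show "ocomp P p qs \<in> ops P"
    by (simp add: P_simps)
  show "src P (ocomp P p qs) = concat (map (src P) qs)" "tgt P (ocomp P p qs) = tgt P p"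
    using D.dom_comp[OF Arr'(2,1,3)] D.cod_comp[OF Arr'(2,1,3)] comp_singleton[OF pq]
      dom_cod[OF pq_in] dom_cod[OF pq(2)] dom_cod[of "[p]"] pq(1) by simp_all
  fix rss assume rss: "rss \<in> lists (lists (ops P))" "map (map (tgt P)) rss = map (src P) qs"
  have "map length rss = map (\<lambda>q. length (src P q)) qs"
    using arg_cong[OF rss(2), of "map length"] by (simp add: comp_def)
  then have qs_rss: "map2 (ocomp P) qs rss = lcomp P qs (concat rss)"
    by (rule lcomp_concat[symmetric])
  have concat_rss: "concat rss \<in> lists (simps X 1)"
    using rss(1) by (fastforce simp: P_simps)
  have tgt: "map (tgt P) (concat rss) = concat (map (src P) qs)"
    using rss(2) by (simp add: map_concat)
  have dom: "cdom D qs = ccod D (concat rss)"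
    using dom_cod[OF pq(2)] dom_cod[OF concat_rss] tgt by simp
  have "ocomp P p (map2 (ocomp P) qs rss) = hd (ccomp D [p] (ccomp D qs (concat rss)))"
    unfolding qs_rss comp_eq_lcomp[OF pq(2) concat_rss tgt] by (rule P_simps(5))
  also have "ccomp D [p] (ccomp D qs (concat rss)) = ccomp D (ccomp D [p] qs) (concat rss)"
    using concat_rss Arr' dom by (intro D.comp_assoc) (simp_all add: Arr del: in_lists_conv_set)
  also have "hd \<dots> = ocomp P (ocomp P p qs) (concat rss)"
    unfolding comp_singleton[OF pq] by (rule P_simps(5)[symmetric])
  finally show "ocomp P p (map2 (ocomp P) qs rss) = ocomp P (ocomp P p qs) (concat rss)" .
qed

section \<open>Comparison with the list nerve\<close>

lemma simps_nerve_D: "simps (nerve D) n = simps (nerve (envelope P)) n"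
proof (rule simps_nerve_cong[OF category])
  show "Obj D = Obj (envelope P)" "Arr D = Arr (envelope P)"
    by (simp_all add: envelope_def Obj Arr P_simps)
  show "cdom D f = cdom (envelope P) f" "ccod D f = ccod (envelope P) f" if "f \<in> Arr D" for f
    using that dom_cod[of f] by (simp_all add: envelope_def Arr)
  show "cid D a = cid (envelope P) a" if "a \<in> Obj D" for a
    using that id_eq[of a] by (simp add: envelope_def Obj)
  show "ccomp D g f = ccomp (envelope P) g f"
    if "f \<in> Arr D" "g \<in> Arr D" "cdom D g = ccod D f" for f g
    using that comp_eq_lcomp[of g f] dom_cod by (simp add: envelope_def Arr del: in_lists_conv_set)
qed

text \<open>By the operadic condition the last vertex of a word of simplices has as many letters as
  the word, so length 1 singles out the simplices of \<open>X\<close> among the words.\<close>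

lemma bij_betw_single_root:
  "bij_betw (\<lambda>x. vertices_edges (lists_of X) n [x]) (simps X n)
     {c \<in> simps (nerve (envelope P)) n. length (fst c n) = 1}"
proof (rule bij_betw_imageI)
  have length: "length (fst (vertices_edges (lists_of X) n xs) n) = length xs"
    if "xs \<in> lists (simps X n)" for xs
    using act_lists_eq_map[OF vertex_map_in[of n n] _ that] by (simp add: vertices_edges_def)
  show "inj_on (\<lambda>x. vertices_edges (lists_of X) n [x]) (simps X n)"
  proof (rule inj_onI)
    fix x y assume "x \<in> simps X n" "y \<in> simps X n"
      "vertices_edges (lists_of X) n [x] = vertices_edges (lists_of X) n [y]"
    then have "[x] = [y]"
      using bij_betw_imp_inj_on[OF canonical[of n]] by (auto dest!: inj_onD)
    then show "x = y" by simp
  qed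
  have "vertices_edges (lists_of X) n [x] \<in> {c \<in> simps (nerve (envelope P)) n. length (fst c n) = 1}"
    if "x \<in> simps X n" for x
    using that length[of "[x]"] ve_in[of "[x]"] by (simp add: simps_nerve_D)
  moreover have "\<exists>x\<in>simps X n. c = vertices_edges (lists_of X) n [x]"
    if c: "c \<in> simps (nerve (envelope P)) n" "length (fst c n) = 1" for c
  proof -
    obtain xs where xs: "xs \<in> lists (simps X n)" "c = vertices_edges (lists_of X) n xs"
      using canonical[of n] c(1) unfolding bij_betw_def simps_nerve_D by (metis imageE)
    then obtain x where "xs = [x]"
      using length[OF xs(1)] c(2) by (auto simp: length_Suc_conv)
    then show ?thesis
      using xs by auto
  qed
  ultimately show "(\<lambda>x. vertices_edges (lists_of X) n [x]) ` simps X n =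
      {c \<in> simps (nerve (envelope P)) n. length (fst c n) = 1}"
    by blast
qed

text \<open>Naturality is checked on concatenated chains: \<open>chain_concat_act\<close> computes
  one side, \<open>act_vertices_edges\<close> the other, and the chain of a word is the
  concatenation of the chains of its letters.\<close>

lemma slist_iso_list_nerve: "slist_iso X (list_nerve P)"
proof -
  let ?ve = "vertices_edges (lists_of X)"
  let ?N1 = "\<lambda>n. {c \<in> simps (nerve (envelope P)) n. length (fst c n) = 1}"
  have bij_forest: "bij_betw (forest_chain n) (simps (list_nerve P) n) (?N1 n)" for n
  proof (rule bij_betw_imageI)
    show "inj_on (forest_chain n) (simps (list_nerve P) n)"
      by (rule inj_onI) (rule forest_chain_inj[OF operad_P], auto simp: simps_list_nerve)
    have "forest_chain n y \<in> ?N1 n" if "y \<in> simps (list_nerve P) n" for y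
      using that forest_chain_in[OF operad_P]
      by (simp add: simps_list_nerve length_root_forest_chain rooted_def)
    moreover have "\<exists>y\<in>simps (list_nerve P) n. c = forest_chain n y" if "c \<in> ?N1 n" for c
      using that forest_chain_surj[OF operad_P, of c n]
      by (force simp: simps_list_nerve length_root_forest_chain rooted_def)
    ultimately show "forest_chain n ` simps (list_nerve P) n = ?N1 n"
      by blast
  qed
  define f where "f n x = inv_into (simps (list_nerve P) n) (forest_chain n) (?ve n [x])" for n x
  have bij_f: "bij_betw (f n) (simps X n) (simps (list_nerve P) n)" for n
    using bij_betw_trans[OF bij_betw_single_root bij_betw_inv_into[OF bij_forest]]
    by (simp add: f_def[abs_def] comp_def)
  have f_in: "f n x \<in> simps (list_nerve P) n" if "x \<in> simps X n" for n x
    using bij_f[of n] that by (auto simp: bij_betw_def)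
  have chain_f: "forest_chain n (f n x) = ?ve n [x]" if "x \<in> simps X n" for n x
    unfolding f_def using bij_betw_inv_into_right[OF bij_forest] bij_betw_apply[OF bij_betw_single_root that]
    by blast
  have ve: "?ve n xs = chain_concat n (map (\<lambda>x. ?ve n [x]) xs)" for n xs
    by (auto simp: vertices_edges_def chain_concat_def act_lists_of comp_def intervals_def intro!: restrict_ext)
  have "slist_morphism X (list_nerve P) f"
    unfolding slist_morphism_def
  proof (intro conjI allI ballI)
    show "f n \<in> simps X n \<rightarrow> simps (list_nerve P) n" for n
      using f_in by auto
    fix k n \<theta> x assume \<theta>: "\<theta> \<in> simplex_maps k n" and x: "x \<in> simps X n"
    have x': "f n x \<in> forests P n"
      using f_in[OF x] by (simp add: simps_list_nerve)
    have act_x: "act X k n \<theta> x \<in> lists (simps X k)"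
      using act_in[OF \<theta> x] .
    show "act (list_nerve P) k n \<theta> (f n x) = map (f k) (act X k n \<theta> x)"
    proof (rule chain_concat_forest_chain_inj[OF operad_P])
      show "act (list_nerve P) k n \<theta> (f n x) \<in> lists (simps (list_nerve P) k)"
        by (rule act_list_nerve_in[OF operad_P x' \<theta>])
      show "map (f k) (act X k n \<theta> x) \<in> lists (simps (list_nerve P) k)"
        using act_x f_in by auto
      have "chain_concat k (map (forest_chain k) (act (list_nerve P) k n \<theta> (f n x))) =
          act (nerve (envelope P)) k n \<theta> (?ve n [x])"
        using chain_concat_act[OF operad_P x' \<theta>] chain_f[OF x] by simp
      also have "\<dots> = ?ve k (act X k n \<theta> x)"
        using act_vertices_edges[OF \<theta>, of "[x]"] x by (simp add: act_lists_of)
      also have "\<dots> = chain_concat k (map (\<lambda>y. ?ve k [y]) (act X k n \<theta> x))"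
        by (rule ve)
      also have "map (\<lambda>y. ?ve k [y]) (act X k n \<theta> x) = map (forest_chain k) (map (f k) (act X k n \<theta> x))"
        using act_x chain_f by auto
      finally show "chain_concat k (map (forest_chain k) (act (list_nerve P) k n \<theta> (f n x))) =
          chain_concat k (map (forest_chain k) (map (f k) (act X k n \<theta> x)))" .
    qed
  qed
  then show ?thesis
    using bij_f act_in by (rule slist_morphism_bij_iso)
qed

end

text \<open>An existential quantifier ranges over fixed types. The equivalence is therefore stated
  for operads on the type of \<open>X\<close> and categories on words in it, and the two
  implications say that an operad or a category on any other types may be replaced by one on
  these.\<close>

theorem theorem1p1:
  fixes X :: "'a slist"
  assumes "simplicial_list X"
  shows "((\<exists>P :: ('a, 'a) operad. operad P \<and> slist_iso X (list_nerve P)) \<longleftrightarrow>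
            operadic X \<and>
            (\<exists>C :: ('a list, 'a list) category. category C \<and> sset_iso (lists_of X) (nerve C))) \<and>
         ((\<exists>P :: ('c, 'o) operad. operad P \<and> slist_iso X (list_nerve P)) \<longrightarrow>
            (\<exists>P :: ('a, 'a) operad. operad P \<and> slist_iso X (list_nerve P))) \<and>
         ((\<exists>C :: ('d, 'e) category. category C \<and> sset_iso (lists_of X) (nerve C)) \<longrightarrow>
            (\<exists>C :: ('a list, 'a list) category. category C \<and> sset_iso (lists_of X) (nerve C)))"
proof -
  interpret simplicial_list X by fact
  \<comment> \<open>Stated for arbitrary types, since it is applied both to the given category and
    to the envelope of an operad on other types.\<close>
  have operad: "\<exists>P :: ('a, 'a) operad. operad P \<and> slist_iso X (list_nerve P)"
    if X: "operadic X" and C: "category C" "sset_iso (lists_of X) (nerve C)"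
    for C :: "('u, 'v) category"
  proof -
    obtain D where "segal X D"
      using canonical_category[OF C] by blast
    then interpret operadic_segal X D
      using X by (simp add: operadic_segal_def operadic_segal_axioms_def)
    show ?thesis
      using operad_P slist_iso_list_nerve by blast
  qed
  have nerve: "operadic X" "category (envelope P)" "sset_iso (lists_of X) (nerve (envelope P))"
    if P: "operad P" "slist_iso X (list_nerve P)" for P :: "('u, 'v) operad"
    using list_nerve_operadic[OF P(2)] list_nerve_nerve[OF assms P] operad.category_envelope[OF P(1)]
    by simp_all
  have transfer: "\<exists>C :: ('a list, 'a list) category. category C \<and> sset_iso (lists_of X) (nerve C)"
    if C: "category C" "sset_iso (lists_of X) (nerve C)" for C :: "('u, 'v) category"
    using canonical_category[OF C] segal.category by blast
  show ?thesis
  proof (intro conjI iffI impI)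
    assume "\<exists>P :: ('a, 'a) operad. operad P \<and> slist_iso X (list_nerve P)"
    then show "operadic X" "\<exists>C :: ('a list, 'a list) category. category C \<and> sset_iso (lists_of X) (nerve C)"
      using nerve by blast+
  next
    assume "operadic X \<and>
      (\<exists>C :: ('a list, 'a list) category. category C \<and> sset_iso (lists_of X) (nerve C))"
    then show "\<exists>P :: ('a, 'a) operad. operad P \<and> slist_iso X (list_nerve P)"
      using operad by blast
  next
    assume "\<exists>P :: ('c, 'o) operad. operad P \<and> slist_iso X (list_nerve P)"
    then show "\<exists>P :: ('a, 'a) operad. operad P \<and> slist_iso X (list_nerve P)"
      using nerve operad by blast
  next
    assume "\<exists>C :: ('d, 'e) category. category C \<and> sset_iso (lists_of X) (nerve C)"
    then show "\<exists>C :: ('a list, 'a list) category. category C \<and> sset_iso (lists_of X) (nerve C)"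
      using transfer by blast
  qed
qed

end
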